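(* Let $d\ge1$, $\alpha\in(0,2)$, $2<p<\infty$ and $f\in L^p(\mathbb{R}^d)$. Then: (i) for every $\lambda>0$ there is a constant $c_\lambda>0$ (not depending on $f$) such that $A_f\le c_\lambda\,\overrightarrow{G}^*_{\lambda,f}$ pointwise on $\mathbb{R}^d$; (ii) if $\lambda_0=(2d+\alpha)/(2d)$, then $\|\overrightarrow{G}^*_{\lambda_0,f}\|_p\le c\,\|f\|_p$; (iii) $\|A_f\|_p\le c\,\|f\|_p$; where in (ii) and (iii) $c>0$ is a constant not depending on $f$.
   Context: For $s>0$ let $p(s,x,y)$ be the transition density of the rotationally symmetric $\alpha$-stable process on $\mathbb{R}^d$, i.e. $p(s,x,y)=p(s,x-y,0)$ and $\int_{\mathbb{R}^d}e^{i\xi\cdot x}p(s,x,0)\,dx=e^{-s|\xi|^\alpha}$. For $t>0$ let $\mu_t(ds)=\frac{t}{2\sqrt\pi}e^{-t^2/(4s)}s^{-3/2}\,ds$ on $(0,\infty)$, and $q_t(x)=\int_0^\infty p(s,x,0)\,\mu_t(ds)$ (a probability density whose Fourier transform is $e^{-t|\xi|^{\alpha/2}}$). For $f\in L^p(\mathbb{R}^d)$ its extension to the upper half-space is $f_t(x)=f(x,t)=Q_tf(x)=f*q_t(x)$, $t>0$. Define $$\Gamma_\alpha(f_t,f_t)(x)=\int_{|h|<t^{2/\alpha}}[f_t(x+h)-f_t(x)]^2\frac{dh}{|h|^{d+\alpha}},$$ the Area functional $$A_f(x)=\Big[\int_0^\infty\int_{|y|<t^{2/\alpha}}t^{1-2d/\alpha}\,\Gamma_\alpha(f_t,f_t)(x-y)\,dy\,dt\Big]^{1/2},$$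 the kernel $$K_t^\lambda(x)=t^{-2d/\alpha}\Big[\frac{t^{2/\alpha}}{t^{2/\alpha}+|x|}\Big]^{\lambda d},\qquad t>0,$$ and the horizontal component of the $G^*$ functional $$\overrightarrow{G}^*_{\lambda,f}(x)=\Big[\int_0^\infty t\cdot \big(K_t^\lambda*\Gamma_\alpha(f_t,f_t)\big)(x)\,dt\Big]^{1/2}.$$ These functionals take values in $[0,\infty]$. $\|\cdot\|_p$ is the $L^p(\mathbb{R}^d)$ norm. *)

theory Defs
  imports "HOL-Analysis.Analysis"
begin

(* r is always positive here, so that top is mapped to top and 0 to 0. *)
definition ennpowr :: "ennreal \<Rightarrow> real \<Rightarrow> ennreal" where
  "ennpowr x r = (if x = top then top else ennreal (enn2real x powr r))"

definition Lp_norm :: "real \<Rightarrow> ('a::euclidean_space \<Rightarrow> ennreal) \<Rightarrow> ennreal" where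
  "Lp_norm r g = ennpowr (\<integral>\<^sup>+x. ennpowr (g x) r \<partial>lebesgue) (1 / r)"

definition in_Lp :: "real \<Rightarrow> ('a::euclidean_space \<Rightarrow> real) \<Rightarrow> bool" where
  "in_Lp r f \<longleftrightarrow>
     f \<in> borel_measurable lebesgue \<and> Lp_norm r (\<lambda>x. ennreal \<bar>f x\<bar>) < top"

(* The characteristic function fixes a density only up to null sets; continuity
   selects the usual version, which makes dens s unique for every s > 0. *)
definition stable_transition_density ::
    "real \<Rightarrow> (real \<Rightarrow> 'a::euclidean_space \<Rightarrow> 'a \<Rightarrow> real) \<Rightarrow> bool" where
  "stable_transition_density \<alpha> dens \<longleftrightarrow>
     (\<forall>s>0.
        (\<forall>x y. dens s x y \<ge> 0) \<and>
        (\<forall>x y. dens s x y = dens s (x - y) 0) \<and>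
        continuous_on UNIV (\<lambda>x. dens s x 0) \<and>
        integrable lborel (\<lambda>x. dens s x 0) \<and>
        (\<forall>\<xi>. (\<integral>x. exp (\<i> * complex_of_real (\<xi> \<bullet> x)) * complex_of_real (dens s x 0) \<partial>lborel)
              = complex_of_real (exp (- s * norm \<xi> powr \<alpha>))))"

definition mu_meas :: "real \<Rightarrow> real measure" where
  "mu_meas t = density lborel (\<lambda>s. ennreal (indicator {0<..} s *
     (t / (2 * sqrt pi) * exp (- t\<^sup>2 / (4 * s)) * s powr (- 3 / 2))))"

(* The set integral keeps values of dens at s \<le> 0, which are arbitrary and
   possibly non-measurable in s, out of the integrand. *)
definition q_dens :: "(real \<Rightarrow> 'a::euclidean_space \<Rightarrow> 'a \<Rightarrow> real) \<Rightarrow> real \<Rightarrow> 'a \<Rightarrow> real" where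
  "q_dens dens t x = (LINT s:{0<..}|mu_meas t. dens s x 0)"

definition Q_ext ::
    "(real \<Rightarrow> 'a::euclidean_space \<Rightarrow> 'a \<Rightarrow> real) \<Rightarrow> real \<Rightarrow> ('a \<Rightarrow> real) \<Rightarrow> 'a \<Rightarrow> real" where
  "Q_ext dens t f x = (\<integral>y. f y * q_dens dens t (x - y) \<partial>lebesgue)"

(* The carre du champ, truncated to |h| < t^(2/alpha), of g with itself. The integrand at
   h = 0 is 0 / 0 = 0. *)
definition Gamma_form :: "real \<Rightarrow> real \<Rightarrow> ('a::euclidean_space \<Rightarrow> real) \<Rightarrow> 'a \<Rightarrow> ennreal" where
  "Gamma_form \<alpha> t g x =
     (\<integral>\<^sup>+h\<in>{h. norm h < t powr (2 / \<alpha>)}.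
        ennreal ((g (x + h) - g x)\<^sup>2 / norm h powr (real DIM('a) + \<alpha>)) \<partial>lborel)"

definition area_functional ::
    "real \<Rightarrow> (real \<Rightarrow> 'a::euclidean_space \<Rightarrow> 'a \<Rightarrow> real) \<Rightarrow> ('a \<Rightarrow> real) \<Rightarrow> 'a \<Rightarrow> ennreal" where
  "area_functional \<alpha> dens f x =
     ennpowr
       (\<integral>\<^sup>+t\<in>{0<..}.
          (\<integral>\<^sup>+y\<in>{y. norm y < t powr (2 / \<alpha>)}.
             ennreal (t powr (1 - 2 * real DIM('a) / \<alpha>)) * Gamma_form \<alpha> t (Q_ext dens t f) (x - y)
           \<partial>lborel)
        \<partial>lborel)
       (1 / 2)"

definition K_kernel :: "real \<Rightarrow> real \<Rightarrow> real \<Rightarrow> 'a::euclidean_space \<Rightarrow> real" where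
  "K_kernel \<alpha> l t x =
     t powr (- 2 * real DIM('a) / \<alpha>) *
     (t powr (2 / \<alpha>) / (t powr (2 / \<alpha>) + norm x)) powr (l * real DIM('a))"

definition G_star ::
    "real \<Rightarrow> (real \<Rightarrow> 'a::euclidean_space \<Rightarrow> 'a \<Rightarrow> real) \<Rightarrow> real \<Rightarrow> ('a \<Rightarrow> real) \<Rightarrow> 'a \<Rightarrow> ennreal" where
  "G_star \<alpha> dens l f x =
     ennpowr
       (\<integral>\<^sup>+t\<in>{0<..}.
          ennreal t * (\<integral>\<^sup>+y. ennreal (K_kernel \<alpha> l t (x - y)) * Gamma_form \<alpha> t (Q_ext dens t f) y \<partial>lborel)
        \<partial>lborel)
       (1 / 2)"

end

theory Submission
  imports Defs "HOL-Probability.Probability" "HOL-Complex_Analysis.Complex_Analysis" "HOL-Real_Asymp.Real_Asymp"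
begin

text \<open>Put \<open>q = p / (p - 2)\<close>. There is a nonnegative function \<open>B u w \<le> C (\<bar>u\<bar>\<^sup>p + w\<^sup>q)\<close> of \<open>u \<in> \<real>\<close>, \<open>w \<ge> 0\<close>
  that is convex with a gain of \<open>c w (u' - u)\<^sup>2\<close> over its tangent planes. Jensen's inequality for \<open>B\<close> along
  the symmetric semigroup \<open>Q\<^sub>t\<close>, applied to \<open>(Q\<^sub>s f, Q\<^sub>s h)\<close> and summed over scales, bounds the integral of
  \<open>Q\<^sub>2\<^sub>s h (x)\<close> against the variance of \<open>Q\<^sub>s f\<close> under \<open>q\<^sub>s (x - y) dy\<close> and against \<open>ds / s\<close> by
  \<open>\<parallel>f\<parallel>\<^sub>p\<^sup>p + \<parallel>h\<parallel>\<^sub>q\<^sup>q\<close>. For \<open>\<lambda> = \<lambda>\<^sub>0\<close> both \<open>K\<^sub>t\<close> and the difference quotients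
  of \<open>q\<^sub>t\<close> are dominated by \<open>q\<^sub>t\<close>, so that \<open>t \<Gamma>(f\<^sub>t, f\<^sub>t)\<close> is at most \<open>1 / t\<close> times such a variance, and duality gives
  the bound on \<open>G\<^sup>*\<close>. The area functional is pointwise smaller, because \<open>K\<^sub>t\<close> is at least a multiple of
  \<open>t\<^sup>-\<^sup>2\<^sup>d\<^sup>/\<^sup>\<alpha>\<close> on \<open>\<bar>y\<bar> < t\<^sup>2\<^sup>/\<^sup>\<alpha>\<close>.

  The two-sided control of \<open>q\<^sub>t\<close> comes from writing it as a mixture of Gaussians: moving the contour of a Cauchy
  integral onto the imaginary axis represents \<open>exp (- \<rho>\<^sup>g)\<close>, \<open>g = \<alpha> / 2 < 1\<close>, as a Stieltjes integral
  in \<open>\<rho>\<^sup>2\<close> and hence as a Laplace transform in \<open>\<rho>\<^sup>2\<close>. The mixing function \<open>theta g\<close> is given explicitly,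
  and its behaviour at infinity yields the tail \<open>\<bar>x\<bar>\<^sup>-\<^sup>d\<^sup>-\<^sup>g\<close> of the kernel.\<close>

section \<open>A Bellman function\<close>

text \<open>The gain carries the weight w of the base point. In Jensen's inequality the base point
  is the average (Q_{2s} f, Q_{2s} h), so the weight comes out as Q_{2s} h; and testing the square
  of the functional against h, with K_t replaced by q_t, produces Q_t h, the same weight for t = 2
  s. Doubling the time makes the Jensen defect a variance outright, so the semigroup is never
  differentiated. Since p > 2, p / 2 and q are conjugate exponents, and h ranges over the dual of
  the space that contains the square.

  \<lambda>0 is the value with \<lambda>0 d = d + \<alpha> / 2, the tail exponent of q_1. Domination
  by q_t needs this tail as a lower bound, which the oscillatory Fourier integral does not show and
  the Gaussian mixture does. \<open>theta g\<close> is the density of the g/2-stable subordinator,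
  but only its size and its leading term at infinity are computed, so the mixture bounds the kernel
  below far from the origin only. Near the origin the bound comes from q_1 being the convolution of
  q_{1/2} with itself, where q_t is nonnegative because \<open>dens\<close> is.\<close>

lemma powr_tangent_le:
  fixes k s r :: real
  assumes "1 \<le> k" "0 \<le> s" "0 \<le> r"
  shows "r powr k + k * r powr (k - 1) * (s - r) \<le> s powr k"
proof (cases "r = 0")
  \<comment> \<open>Since \<open>0 powr 0 = 0\<close>, the slope at r = 0 is 0 even for k = 1; it
    still supports the graph on the half-line s >= 0.\<close>
  case True
  then show ?thesis by simp
next
  case False
  then have r: "0 < r" using assms by simp
  have rk: "r powr (k - 1) * r = r powr k"
    using r by (simp add: powr_diff)
  show ?thesis
  proof (cases "s = 0")
    case True
    have "r powr k + k * r powr (k - 1) * (s - r) = (1 - k) * r powr k"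
      using True by (simp add: algebra_simps rk[symmetric])
    also have "\<dots> \<le> 0" using assms by (simp add: mult_nonpos_nonneg)
    finally show ?thesis using True by simp
  next
    case False
    then have s: "0 < s" using assms by simp
    \<comment> \<open>Weighted arithmetic-geometric means with weights 1/k and 1 - 1/k: this is the
      tangent inequality divided by k.\<close>
    have "(s powr k) powr (1/k) * (r powr k) powr (1 - 1/k) \<le> 1/k * s powr k + (1 - 1/k) * r powr k"
      using assms r s by (intro Youngs_inequality_0) auto
    moreover have "(s powr k) powr (1/k) = s" "(r powr k) powr (1 - 1/k) = r powr (k - 1)"
      using assms r s by (auto simp: powr_powr right_diff_distrib)
    ultimately have "k * (s * r powr (k - 1)) \<le> k * (1/k * s powr k + (1 - 1/k) * r powr k)"
      using assms by (intro mult_left_mono) auto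
    also have "\<dots> = s powr k + (k - 1) * r powr k"
      using assms by (simp add: field_simps)
    finally show ?thesis using rk by (simp add: algebra_simps)
  qed
qed

lemma powr_add_le_max:
  fixes x y k :: real
  assumes "0 \<le> x" "0 \<le> y" "0 \<le> k"
  shows "(x + y) powr k \<le> 2 powr k * (x powr k + y powr k)"
proof -
  have "(x + y) powr k \<le> (2 * max x y) powr k"
    using assms by (intro powr_mono2) auto
  also have "\<dots> = 2 powr k * max x y powr k"
    using assms by (subst powr_mult) auto
  also have "\<dots> \<le> 2 powr k * (x powr k + y powr k)"
    by (intro mult_left_mono) (auto simp: max_def)
  finally show ?thesis .
qed

text \<open>Taylor's formula with integral remainder: 1/3 is the integral of (1 - x)^2 over [0,1],
  one factor coming from the remainder and one from the lower bound. That bound degenerates at x = 1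
  because along a segment the weight is only known to be at least (1 - x) times its initial
  value.\<close>

lemma taylor_third_lower_bound:
  fixes \<phi> \<phi>' \<phi>'' :: "real \<Rightarrow> real"
  assumes "\<And>x. 0 \<le> x \<Longrightarrow> x \<le> 1 \<Longrightarrow> (\<phi> has_real_derivative \<phi>' x) (at x)"
    and "\<And>x. 0 \<le> x \<Longrightarrow> x \<le> 1 \<Longrightarrow> (\<phi>' has_real_derivative \<phi>'' x) (at x)"
    and "\<And>x. 0 \<le> x \<Longrightarrow> x \<le> 1 \<Longrightarrow> K * (1 - x) \<le> \<phi>'' x"
  shows "\<phi> 0 + \<phi>' 0 + K / 3 \<le> \<phi> 1"
proof -
  define \<psi>' where "\<psi>' x = \<phi>' x - \<phi>' 0 - K * (x - x^2/2)" for x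
  define \<psi> where "\<psi> x = \<phi> x - \<phi>' 0 * x - K * (x^2/2 - x^3/6)" for x
  have d1: "(\<psi> has_real_derivative \<psi>' x) (at x)" if "0 \<le> x" "x \<le> 1" for x
    unfolding \<psi>_def \<psi>'_def
    by (auto intro!: derivative_eq_intros assms(1) that simp: field_simps power2_eq_square)
  have d2: "(\<psi>' has_real_derivative (\<phi>'' x - K * (1 - x))) (at x)" if "0 \<le> x" "x \<le> 1" for x
    unfolding \<psi>'_def
    by (auto intro!: derivative_eq_intros assms(2) that simp: field_simps power2_eq_square)
  have nn: "0 \<le> \<psi>' x" if "0 \<le> x" "x \<le> 1" for x
  proof -
    have "\<psi>' 0 \<le> \<psi>' x"
      by (rule DERIV_nonneg_imp_nondecreasing[OF that(1)])
         (use d2 assms(3) that in \<open>force intro!: exI\<close>)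
    then show ?thesis by (simp add: \<psi>'_def)
  qed
  have "\<psi> 0 \<le> \<psi> 1"
    by (rule DERIV_nonneg_imp_nondecreasing) (use d1 nn in \<open>force intro!: exI\<close>)+
  then show ?thesis by (simp add: \<psi>_def field_simps)
qed

lemma power2_powr_half: "(u\<^sup>2) powr (p / 2) = \<bar>u\<bar> powr p" for u p :: real
proof -
  have "u\<^sup>2 = \<bar>u\<bar> powr 2" by simp
  then show ?thesis by (simp only: powr_powr) simp
qed

text \<open>The last clause asks for a supporting plane at every point of the closed half-plane, the
  boundary w = 0 included, so D and E form a subgradient and not necessarily a gradient. The
  exponent p / (p - 2) is the conjugate of p / 2.\<close>

definition bellman_fun :: "real \<Rightarrow> (real \<Rightarrow> real \<Rightarrow> real) \<Rightarrow> real \<Rightarrow> real \<Rightarrow> bool" where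
  "bellman_fun p B c C \<longleftrightarrow>
     0 < c \<and> 0 < C \<and> continuous_on ({(u, w). 0 \<le> w}) (\<lambda>(u, w). B u w) \<and>
     (\<forall>u w. 0 \<le> w \<longrightarrow> 0 \<le> B u w \<and> B u w \<le> C * (\<bar>u\<bar> powr p + w powr (p / (p - 2)))) \<and>
     (\<forall>u w. 0 \<le> w \<longrightarrow> (\<exists>D E. \<forall>u' w'. 0 \<le> w' \<longrightarrow>
        B u w + D * (u' - u) + E * (w' - w) + c * w * (u' - u)\<^sup>2 \<le> B u' w'))"

text \<open>A convex increasing power of u^2 + w^k. The term u^2 exceeds its tangent by exactly (u'
  - u)^2, and this remainder is multiplied by the outer derivative (p/2) s^(p/2-1), which is at
  least w because k (p/2 - 1) = 1. The bound p <= 4 makes k >= 1, so that w^k is convex.\<close>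

lemma bellman_fun_le4:
  fixes p :: real
  assumes "2 < p" "p \<le> 4"
  shows "bellman_fun p (\<lambda>u w. (u\<^sup>2 + w powr (2 / (p - 2))) powr (p / 2)) 1 (2 powr (p / 2))"
proof -
  define k where "k = 2 / (p - 2)"
  have k: "1 \<le> k" "k * (p / 2) = p / (p - 2)" "k * (p / 2 - 1) = 1"
    using assms by (auto simp: k_def field_simps)
  have low: "(u\<^sup>2 + w powr k) powr (p/2) + (p/2 * (u\<^sup>2 + w powr k) powr (p/2 - 1) * 2 * u) * (u' - u)
      + (p/2 * (u\<^sup>2 + w powr k) powr (p/2 - 1) * k * w powr (k - 1)) * (w' - w) + 1 * w * (u' - u)\<^sup>2
      \<le> (u'\<^sup>2 + w' powr k) powr (p/2)" if "0 \<le> w" "0 \<le> w'" for u u' w w'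
  proof -
    define s where "s = u\<^sup>2 + w powr k"
    define Z where "Z = p/2 * s powr (p/2 - 1)"
    have Z: "0 \<le> Z" using assms by (simp add: Z_def)
    have "w = (w powr k) powr (p/2 - 1)"
      using that k(3) by (simp add: powr_powr)
    also have "\<dots> \<le> s powr (p/2 - 1)"
      using assms by (intro powr_mono2) (auto simp: s_def)
    also have "\<dots> \<le> Z"
      unfolding Z_def using assms mult_right_mono[of 1 "p/2" "s powr (p/2 - 1)"] by simp
    finally have wZ: "w \<le> Z" .
    have "2 * u * (u' - u) + (u' - u)\<^sup>2 + k * w powr (k - 1) * (w' - w) \<le> (u'\<^sup>2 + w' powr k) - s"
      using powr_tangent_le[OF k(1) that(2) that(1)]
      by (simp add: s_def power2_eq_square algebra_simps)
    then have "Z * (2 * u * (u' - u) + (u' - u)\<^sup>2 + k * w powr (k - 1) * (w' - w)) \<le> Z * ((u'\<^sup>2 + w' powr k) - s)"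
      using Z by (rule mult_left_mono)
    moreover have "s powr (p/2) + Z * ((u'\<^sup>2 + w' powr k) - s) \<le> (u'\<^sup>2 + w' powr k) powr (p/2)"
      unfolding Z_def using assms by (intro powr_tangent_le) (auto simp: s_def)
    moreover have "w * (u' - u)\<^sup>2 \<le> Z * (u' - u)\<^sup>2"
      using wZ by (intro mult_right_mono) auto
    ultimately show ?thesis
      unfolding s_def[symmetric] Z_def[symmetric] by (simp add: algebra_simps)
  qed
  have up: "(u\<^sup>2 + w powr k) powr (p/2) \<le> 2 powr (p/2) * (\<bar>u\<bar> powr p + w powr (p / (p - 2)))" if "0 \<le> w" for u w
  proof -
    have "(w powr k) powr (p/2) = w powr (p / (p - 2))"
      by (simp only: powr_powr k(2))
    then show ?thesis
      using powr_add_le_max[of "u\<^sup>2" "w powr k" "p/2"] assms by (simp add: power2_powr_half)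
  qed
  have cont: "continuous_on {(u, w). 0 \<le> w} (\<lambda>(u, w). (u\<^sup>2 + w powr k) powr (p/2))"
    unfolding case_prod_beta'
    using assms k(1) by (intro continuous_on_powr' continuous_intros) (auto simp: case_prod_beta')
  show ?thesis
    unfolding bellman_fun_def k_def[symmetric]
  proof (intro conjI allI impI)
    fix u w :: real assume "0 \<le> w"
    then show "\<exists>D E. \<forall>u' w'. 0 \<le> w' \<longrightarrow> (u\<^sup>2 + w powr k) powr (p/2) + D * (u' - u) + E * (w' - w)
        + 1 * w * (u' - u)\<^sup>2 \<le> (u'\<^sup>2 + w' powr k) powr (p/2)"
      using low[OF \<open>0 \<le> w\<close>] by blast
  qed (use up cont in auto)
qed

text \<open>For \<open>p > 4\<close> the exponent \<open>2 / (p - 2)\<close> drops below one and the tangent-line argument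
  breaks down; here a Hessian estimate for \<open>\<bar>u\<bar>\<^sup>p + w\<^sup>q + u\<^sup>2 w\<close> takes over.\<close>

lemma bellman_regularized:
  fixes p :: real
  assumes p: "4 < p" and e: "0 < e" and w: "0 < w" and w': "0 < w'"
  defines "q \<equiv> p / (p - 2)"
  shows "1/p * (u\<^sup>2 + e) powr (p/2) + 4 / (q * (q - 1)) * w powr q + u\<^sup>2 * w
      + ((u\<^sup>2 + e) powr (p/2 - 1) * u + 2 * u * w) * (u' - u)
      + (4 / (q - 1) * w powr (q - 1) + u\<^sup>2) * (w' - w) + w * (u' - u)\<^sup>2 / 3
    \<le> 1/p * (u'\<^sup>2 + e) powr (p/2) + 4 / (q * (q - 1)) * w' powr q + u'\<^sup>2 * w'"
proof -
  define a b where "a = u' - u" and "b = w' - w"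
  define U where "U x = u + x * a" for x
  define W where "W x = w + x * b" for x
  define X where "X x = (U x)\<^sup>2 + e" for x
  have q: "1 < q" "q < 2" using p by (auto simp: q_def field_simps)
  have Xp: "0 < X x" for x using e by (auto simp: X_def intro: add_nonneg_pos)
  have Wge: "(1 - x) * w \<le> W x" if "0 \<le> x" "x \<le> 1" for x
  proof -
    have "0 \<le> x * w'" using that w' by simp
    then show ?thesis by (simp add: W_def b_def algebra_simps)
  qed
  have Wp: "0 < W x" if "0 \<le> x" "x \<le> 1" for x
  proof (cases "x = 1")
    case True then show ?thesis using w' by (simp add: W_def b_def)
  next
    case False
    then have "0 < (1 - x) * w" using that w by simp
    then show ?thesis using Wge[OF that] by linarith
  qed
  have dU: "(U has_real_derivative a) (at x)" for x
    unfolding U_def by (auto intro!: derivative_eq_intros)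
  have dW: "(W has_real_derivative b) (at x)" for x
    unfolding W_def by (auto intro!: derivative_eq_intros)
  have dX: "(X has_real_derivative (2 * U x * a)) (at x)" for x
    unfolding X_def by (auto intro!: derivative_eq_intros dU)
  define \<phi> where "\<phi> x = 1/p * X x powr (p/2) + 4 / (q * (q - 1)) * W x powr q + (U x)\<^sup>2 * W x" for x
  define \<phi>1 where "\<phi>1 x = X x powr (p/2 - 1) * U x * a + 4 / (q - 1) * W x powr (q - 1) * b
     + 2 * U x * a * W x + (U x)\<^sup>2 * b" for x
  define \<phi>2 where "\<phi>2 x = (p - 2) * X x powr (p/2 - 2) * (U x)\<^sup>2 * a\<^sup>2 + X x powr (p/2 - 1) * a\<^sup>2
     + 4 * W x powr (q - 2) * b\<^sup>2 + 2 * a\<^sup>2 * W x + 4 * U x * a * b" for x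
  have dXp: "((\<lambda>x. X x powr r) has_real_derivative r * X x powr (r - 1) * (2 * U x * a)) (at x)" for r x
    using DERIV_fun_powr[OF dX Xp, of r x] by simp
  have dWp: "((\<lambda>x. W x powr r) has_real_derivative r * W x powr (r - 1) * b) (at x)"
    if "0 \<le> x" "x \<le> 1" for r x
    using DERIV_fun_powr[OF dW Wp[OF that], of r] by simp
  have dU2: "((\<lambda>x. (U x)\<^sup>2) has_real_derivative 2 * U x * a) (at x)" for x
    by (auto intro!: derivative_eq_intros dU)
  have d1: "(\<phi> has_real_derivative \<phi>1 x) (at x)" if "0 \<le> x" "x \<le> 1" for x
  proof -
    have "(\<phi> has_real_derivative 1/p * (p/2 * X x powr (p/2 - 1) * (2 * U x * a))
       + 4 / (q * (q - 1)) * (q * W x powr (q - 1) * b) + (2 * U x * a * W x + b * (U x)\<^sup>2)) (at x)"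
      unfolding \<phi>_def
      by (intro DERIV_add DERIV_mult DERIV_cmult dXp dWp[OF that] dU2 dW)
    also have "1/p * (p/2 * X x powr (p/2 - 1) * (2 * U x * a))
       + 4 / (q * (q - 1)) * (q * W x powr (q - 1) * b) + (2 * U x * a * W x + b * (U x)\<^sup>2) = \<phi>1 x"
      using p q by (simp add: \<phi>1_def)
    finally show ?thesis .
  qed
  have d2: "(\<phi>1 has_real_derivative \<phi>2 x) (at x)" if "0 \<le> x" "x \<le> 1" for x
  proof -
    have "(\<phi>1 has_real_derivative (((p/2 - 1) * X x powr (p/2 - 1 - 1) * (2 * U x * a)) * U x + a * X x powr (p/2 - 1)) * a
       + 4 / (q - 1) * ((q - 1) * W x powr (q - 1 - 1) * b) * b
       + ((2 * a * a) * W x + b * (2 * U x * a)) + (2 * U x * a) * b) (at x)"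
      unfolding \<phi>1_def
      by (intro DERIV_add DERIV_mult DERIV_cmult DERIV_cmult_right dXp dWp[OF that] dU2 dU dW)
    also have "(((p/2 - 1) * X x powr (p/2 - 1 - 1) * (2 * U x * a)) * U x + a * X x powr (p/2 - 1)) * a
       + 4 / (q - 1) * ((q - 1) * W x powr (q - 1 - 1) * b) * b
       + ((2 * a * a) * W x + b * (2 * U x * a)) + (2 * U x * a) * b = \<phi>2 x"
    proof -
      have [simp]: "p/2 - 1 - 1 = p/2 - 2" "q - 1 - 1 = q - 2" by simp_all
      have "4 / (q - 1) * ((q - 1) * W x powr (q - 2) * b) * b = 4 * W x powr (q - 2) * b\<^sup>2"
        using q by (simp add: power2_eq_square)
      then show ?thesis
        by (simp add: \<phi>2_def power2_eq_square algebra_simps)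
    qed
    finally show ?thesis .
  qed
  have lb: "w * a\<^sup>2 * (1 - x) \<le> \<phi>2 x" if x: "0 \<le> x" "x \<le> 1" for x
  proof -
    define Y where "Y = X x powr (p/2 - 1)"
    have Y: "0 < Y" using Xp[of x] by (simp add: Y_def)
    have th: "1 - 2 / (p - 2) = 2 - q" using p by (simp add: q_def field_simps)
    \<comment> \<open>The weights 2 / (p - 2) and 2 - q add up to 1, and Y^(2/(p-2)) = X; the
      outcome is X W^(2-q) <= Y + W, which is the bound on U^2 needed for the discriminant.\<close>
    have "Y powr (2 / (p - 2)) * W x powr (2 - q) \<le> 2 / (p - 2) * Y + (2 - q) * W x"
      using p q Y Wp[OF x] th by (intro Youngs_inequality_0) auto
    also have "\<dots> \<le> 1 * Y + 1 * W x"
      using p q Y Wp[OF x] by (intro add_mono mult_right_mono) auto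
    also have "Y powr (2 / (p - 2)) = X x"
      using p Xp[of x] by (simp add: Y_def powr_powr field_simps)
    finally have YW: "X x * W x powr (2 - q) \<le> Y + W x" by simp
    have "(U x)\<^sup>2 = (U x)\<^sup>2 * (W x powr (2 - q) * W x powr (q - 2))"
      using Wp[OF x] by (simp flip: powr_add)
    also have "\<dots> \<le> X x * (W x powr (2 - q) * W x powr (q - 2))"
      using e by (intro mult_right_mono) (auto simp: X_def)
    also have "\<dots> \<le> (Y + W x) * W x powr (q - 2)"
      using YW by (subst mult.assoc[symmetric], intro mult_right_mono) auto
    finally have key: "(U x)\<^sup>2 \<le> (Y + W x) * W x powr (q - 2)" .
    define P Q where "P = Y + W x" and "Q = W x powr (q - 2)"
    have PQ: "0 < P" "0 < Q" using Y Wp[OF x] by (auto simp: P_def Q_def)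
    \<comment> \<open>Completing the square in a and b, with discriminant condition U^2 <= P Q. The
      factor 4 / (q (q - 1)) in the function is chosen to make the coefficient of b^2 equal to 4 Q.
      Of the available 2 W a^2, one half is spent in P and the other half is the gain.\<close>
    have "0 \<le> P * a\<^sup>2 + 4 * Q * b\<^sup>2 + 4 * U x * a * b"
    proof -
      have "(U x)\<^sup>2 * (4 * b\<^sup>2) \<le> (P * Q) * (4 * b\<^sup>2)"
        using key by (intro mult_right_mono) (auto simp: P_def Q_def)
      moreover have "0 \<le> (P * a + 2 * U x * b)\<^sup>2" by simp
      ultimately have "0 \<le> P * (P * a\<^sup>2 + 4 * Q * b\<^sup>2 + 4 * U x * a * b)"
        by (simp add: power2_eq_square algebra_simps)
      then show ?thesis using PQ by (simp add: zero_le_mult_iff)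
    qed
    moreover have "0 \<le> (p - 2) * X x powr (p/2 - 2) * (U x)\<^sup>2 * a\<^sup>2" using p by simp
    moreover have "w * a\<^sup>2 * (1 - x) \<le> W x * a\<^sup>2"
      using mult_right_mono[OF Wge[OF x], of "a\<^sup>2"] by (simp add: algebra_simps)
    ultimately show ?thesis
      unfolding \<phi>2_def P_def Q_def Y_def by (simp add: algebra_simps)
  qed
  have "\<phi> 0 + \<phi>1 0 + w * a\<^sup>2 / 3 \<le> \<phi> 1"
    using taylor_third_lower_bound[OF d1 d2 lb] by simp
  then show ?thesis
    by (simp add: \<phi>_def \<phi>1_def X_def U_def W_def a_def b_def algebra_simps)
qed

text \<open>Points with u = 0 or w = 0 are reached by adding e > 0 to u^2, w and w' and letting e
  tend to 0. The powers p/2 - 1 and q - 1 in the tangent plane are positive, so the plane converges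
  too; only second derivatives blow up, and they do not occur in the inequality.\<close>

lemma bellman_fun_gt4:
  fixes p :: real
  assumes p: "4 < p"
  defines "q \<equiv> p / (p - 2)"
  shows "bellman_fun p (\<lambda>u w. 1/p * (u\<^sup>2) powr (p/2) + 4 / (q * (q - 1)) * w powr q + u\<^sup>2 * w)
    (1/3) (2 + 4 / (q * (q - 1)))"
proof -
  have q: "1 < q" "q < 2" using p by (auto simp: q_def field_simps)
  have ev: "\<forall>\<^sub>F e in at_right 0. 0 \<le> z + e" if "0 \<le> z" for z :: real
    using eventually_at_right_less[of 0] by eventually_elim (use that in auto)
  have low: "1/p * (u\<^sup>2) powr (p/2) + 4 / (q * (q - 1)) * w powr q + u\<^sup>2 * w
      + ((u\<^sup>2) powr (p/2 - 1) * u + 2 * u * w) * (u' - u)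
      + (4 / (q - 1) * w powr (q - 1) + u\<^sup>2) * (w' - w) + w * (u' - u)\<^sup>2 / 3
    \<le> 1/p * (u'\<^sup>2) powr (p/2) + 4 / (q * (q - 1)) * w' powr q + u'\<^sup>2 * w'" (is "?L \<le> ?R")
    if "0 \<le> w" "0 \<le> w'" for u w u' w'
  proof (rule tendsto_le)
    show "((\<lambda>e. 1/p * (u\<^sup>2 + e) powr (p/2) + 4 / (q * (q - 1)) * (w + e) powr q + u\<^sup>2 * (w + e)
      + ((u\<^sup>2 + e) powr (p/2 - 1) * u + 2 * u * (w + e)) * (u' - u)
      + (4 / (q - 1) * (w + e) powr (q - 1) + u\<^sup>2) * ((w' + e) - (w + e)) + (w + e) * (u' - u)\<^sup>2 / 3)
      \<longlongrightarrow> ?L) (at_right 0)"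
      (is "(?F \<longlongrightarrow> _) _")
    proof -
      have "(?F \<longlongrightarrow> ?F 0) (at_right 0)"
        using ev[OF that(1)] ev[OF zero_le_power2[of u]] p q
        by (intro tendsto_intros tendsto_powr' tendsto_ident_at) auto
      then show ?thesis by simp
    qed
    show "((\<lambda>e. 1/p * (u'\<^sup>2 + e) powr (p/2) + 4 / (q * (q - 1)) * (w' + e) powr q + u'\<^sup>2 * (w' + e))
      \<longlongrightarrow> ?R) (at_right 0)"
      (is "(?F \<longlongrightarrow> _) _")
    proof -
      have "(?F \<longlongrightarrow> ?F 0) (at_right 0)"
        using ev[OF that(2)] ev[OF zero_le_power2[of u']] p q
        by (intro tendsto_intros tendsto_powr' tendsto_ident_at) auto
      then show ?thesis by simp
    qed
    show "\<forall>\<^sub>F e in at_right 0. 1/p * (u\<^sup>2 + e) powr (p/2) + 4 / (q * (q - 1)) * (w + e) powr q + u\<^sup>2 * (w + e)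
      + ((u\<^sup>2 + e) powr (p/2 - 1) * u + 2 * u * (w + e)) * (u' - u)
      + (4 / (q - 1) * (w + e) powr (q - 1) + u\<^sup>2) * ((w' + e) - (w + e)) + (w + e) * (u' - u)\<^sup>2 / 3
      \<le> 1/p * (u'\<^sup>2 + e) powr (p/2) + 4 / (q * (q - 1)) * (w' + e) powr q + u'\<^sup>2 * (w' + e)"
      using eventually_at_right_less[of 0]
    proof eventually_elim
      case (elim e)
      then show ?case
        using bellman_regularized[OF p elim, of "w + e" "w' + e" u u'] that
        unfolding q_def by simp
    qed
  qed simp
  have up: "1/p * (u\<^sup>2) powr (p/2) + 4 / (q * (q - 1)) * w powr q + u\<^sup>2 * w
     \<le> (2 + 4 / (q * (q - 1))) * (\<bar>u\<bar> powr p + w powr q)" if "0 \<le> w" for u w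
  proof -
    have "u\<^sup>2 * w \<le> (u\<^sup>2) powr (p/2) / (p/2) + w powr q / q"
      using p q that by (intro Youngs_inequality) (auto simp: q_def field_simps)
    also have "\<dots> \<le> \<bar>u\<bar> powr p + w powr q"
      unfolding power2_powr_half using p q
      using mult_right_mono[of 1 q "w powr q"] mult_right_mono[of 2 p "\<bar>u\<bar> powr p"]
      by (intro add_mono) (auto simp: field_simps)
    finally have 1: "u\<^sup>2 * w \<le> \<bar>u\<bar> powr p + w powr q" .
    have 2: "1/p * \<bar>u\<bar> powr p \<le> \<bar>u\<bar> powr p"
      using p mult_right_mono[of 1 p "\<bar>u\<bar> powr p"] by (simp add: field_simps)
    have 3: "0 \<le> 4 / (q * (q - 1)) * \<bar>u\<bar> powr p" using q by simp
    have 4: "0 \<le> w powr q" by simp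
    have "1/p * \<bar>u\<bar> powr p + K * w powr q + u\<^sup>2 * w \<le> 2 * (\<bar>u\<bar> powr p + w powr q) + (K * \<bar>u\<bar> powr p + K * w powr q)"
      if "0 \<le> K * \<bar>u\<bar> powr p" for K
      using 1 2 4 that unfolding distrib_left by linarith
    from this[OF 3] show ?thesis unfolding power2_powr_half by (simp only: distrib_left distrib_right)
  qed
  have cont: "continuous_on {(u, w). 0 \<le> w}
      (\<lambda>(u, w). 1/p * (u\<^sup>2) powr (p/2) + 4 / (q * (q - 1)) * w powr q + u\<^sup>2 * w)"
    unfolding case_prod_beta'
    using p q by (intro continuous_on_powr' continuous_intros) (auto simp: case_prod_beta')
  have C: "0 < 2 + 4 / (q * (q - 1))" using q by (intro add_pos_nonneg) auto
  show ?thesis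
    unfolding bellman_fun_def q_def[symmetric]
  proof (intro conjI allI impI)
    fix u w :: real assume "0 \<le> w"
    then show "\<exists>D E. \<forall>u' w'. 0 \<le> w' \<longrightarrow> 1/p * (u\<^sup>2) powr (p/2) + 4 / (q * (q - 1)) * w powr q + u\<^sup>2 * w
        + D * (u' - u) + E * (w' - w) + 1/3 * w * (u' - u)\<^sup>2
      \<le> 1/p * (u'\<^sup>2) powr (p/2) + 4 / (q * (q - 1)) * w' powr q + u'\<^sup>2 * w'"
      using low by (intro exI[of _ "(u\<^sup>2) powr (p/2 - 1) * u + 2 * u * w"]
          exI[of _ "4 / (q - 1) * w powr (q - 1) + u\<^sup>2"]) simp
    show "0 \<le> 1/p * (u\<^sup>2) powr (p/2) + 4 / (q * (q - 1)) * w powr q + u\<^sup>2 * w"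
      using p q \<open>0 \<le> w\<close> by simp
    show "1/p * (u\<^sup>2) powr (p/2) + 4 / (q * (q - 1)) * w powr q + u\<^sup>2 * w
     \<le> (2 + 4 / (q * (q - 1))) * (\<bar>u\<bar> powr p + w powr q)"
      by (rule up) fact
  qed (use cont C in auto)
qed

lemma bellman_fun_exists:
  assumes "2 < p"
  obtains B c C where "bellman_fun p B c C"
  using bellman_fun_le4[OF assms] bellman_fun_gt4 by (cases "p \<le> 4") force+

section \<open>Symmetric convolution semigroups\<close>

text \<open>Measurability is joint in time and space because the estimates integrate over both. The
  remaining clauses speak of positive times, values at other times being arbitrary. Boundedness of
  each kernel is what lets it act on every L^r with r >= 1.\<close>

locale convolution_semigroup =
  fixes k :: "real \<Rightarrow> 'a::euclidean_space \<Rightarrow> real"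
  assumes measurable_pair: "(\<lambda>(t, x). k t x) \<in> borel_measurable borel"
    and nonneg: "0 < t \<Longrightarrow> 0 \<le> k t x"
    and total: "0 < t \<Longrightarrow> (\<integral>\<^sup>+x. ennreal (k t x) \<partial>lborel) = 1"
    and sym: "0 < t \<Longrightarrow> k t (- x) = k t x"
    and bounded: "0 < t \<Longrightarrow> \<exists>M. \<forall>x. k t x \<le> M"
    and semigroup: "0 < s \<Longrightarrow> 0 < t \<Longrightarrow>
      (\<integral>\<^sup>+y. ennreal (k s (x - y)) * ennreal (k t y) \<partial>lborel) = ennreal (k (s + t) x)"
begin

lemma measurable_kernel [measurable (raw)]:
  assumes "f \<in> borel_measurable M" "g \<in> borel_measurable M"
  shows "(\<lambda>x. k (f x) (g x)) \<in> borel_measurable M"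
proof -
  have "(\<lambda>x. (f x, g x)) \<in> borel_measurable M" using assms by (rule borel_measurable_Pair)
  from measurable_compose[OF this measurable_pair] show ?thesis by simp
qed

definition conv :: "real \<Rightarrow> ('a \<Rightarrow> real) \<Rightarrow> 'a \<Rightarrow> real" where
  "conv t f x = (\<integral>y. f y * k t (x - y) \<partial>lborel)"

lemma measurable_conv [measurable (raw)]:
  assumes [measurable]: "f \<in> borel_measurable borel" "g \<in> borel_measurable M" "h \<in> borel_measurable M"
  shows "(\<lambda>x. conv (g x) f (h x)) \<in> borel_measurable M"
  unfolding conv_def by measurable

lemma nn_integral_translate:
  assumes [measurable]: "f \<in> borel_measurable borel"
  shows "(\<integral>\<^sup>+y. f (x + y) \<partial>lborel) = (\<integral>\<^sup>+y. f y \<partial>(lborel :: 'a measure))"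
  by (subst lborel_distr_plus[of x, symmetric]) (simp add: nn_integral_distr)

lemma nn_integral_reflect:
  assumes [measurable]: "f \<in> borel_measurable borel"
  shows "(\<integral>\<^sup>+y. f (x - y) \<partial>lborel) = (\<integral>\<^sup>+y. f y \<partial>(lborel :: 'a measure))"
proof -
  have "(\<integral>\<^sup>+y. f y \<partial>lborel) = (\<integral>\<^sup>+y. f y \<partial>density (distr lborel borel (\<lambda>y. x + (-1) *\<^sub>R y)) (\<lambda>_. \<bar>-1::real\<bar> ^ DIM('a)))"
    using lborel_affine[of "-1" x] by simp
  also have "\<dots> = (\<integral>\<^sup>+y. f (x - y) \<partial>lborel)"
    by (simp add: density_1 nn_integral_distr)
  finally show ?thesis by simp
qed

lemma total_shift:
  "0 < t \<Longrightarrow> (\<integral>\<^sup>+y. ennreal (k t (x - y)) \<partial>lborel) = 1"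
  "0 < t \<Longrightarrow> (\<integral>\<^sup>+y. ennreal (k t (y - x)) \<partial>lborel) = 1"
  using nn_integral_reflect[of "\<lambda>y. ennreal (k t y)" x]
    nn_integral_translate[of "\<lambda>y. ennreal (k t y)" "- x"] total[of t]
  by (simp_all add: add.commute)

lemma integrable_kernel:
  assumes "0 < t"
  shows "integrable lborel (\<lambda>y. k t (x - y))"
  using assms total_shift(1)[OF assms, of x] nonneg
  by (intro integrableI_nonneg) auto

lemma integral_kernel:
  assumes "0 < t"
  shows "(\<integral>y. k t (x - y) \<partial>lborel) = 1"
  using assms total_shift(1)[OF assms, of x] nonneg
  by (subst integral_eq_nn_integral) auto

text \<open>One predicate covers f in L^p and the test function h in L^q. Some exponent r >= 1 is
  enough for the convolution to converge: |f| <= 1 + |f|^r, and both the constant and an integrable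
  function can be integrated against a bounded probability density.\<close>

definition admissible :: "('a \<Rightarrow> real) \<Rightarrow> bool" where
  "admissible f \<longleftrightarrow> f \<in> borel_measurable borel \<and> (\<exists>r\<ge>1. (\<integral>\<^sup>+x. ennreal (\<bar>f x\<bar> powr r) \<partial>lborel) < \<infinity>)"

lemma le_one_plus_powr: "1 \<le> r \<Longrightarrow> \<bar>x::real\<bar> \<le> 1 + \<bar>x\<bar> powr r"
  using powr_mono[of 1 r "\<bar>x\<bar>"] by (cases "\<bar>x\<bar> \<le> 1") (auto intro: add_increasing2)

lemma conv_bound:
  assumes f: "admissible f" and t: "0 < t"
  shows "integrable lborel (\<lambda>y. f y * k t (x - y))"
    and "\<exists>M. \<forall>x. \<bar>conv t f x\<bar> \<le> M"
proof -
  obtain r where r: "1 \<le> r" "(\<integral>\<^sup>+x. ennreal (\<bar>f x\<bar> powr r) \<partial>lborel) < \<infinity>"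
    and [measurable]: "f \<in> borel_measurable borel"
    using f by (auto simp: admissible_def)
  obtain M where M: "\<And>x. k t x \<le> M" using bounded[OF t] by auto
  have int: "integrable lborel (\<lambda>y. \<bar>f y\<bar> powr r)"
    using r by (intro integrableI_nonneg) auto
  have int1: "integrable lborel (\<lambda>y. k t (x - y) + M * \<bar>f y\<bar> powr r)" for x
    using int integrable_kernel[OF t] by auto
  have le: "\<bar>f y * k t (x - y)\<bar> \<le> k t (x - y) + M * \<bar>f y\<bar> powr r" for x y
  proof -
    have "\<bar>f y\<bar> * k t (x - y) \<le> (1 + \<bar>f y\<bar> powr r) * k t (x - y)"
      using le_one_plus_powr[OF r(1)] nonneg[OF t] by (intro mult_right_mono) auto
    also have "\<dots> \<le> k t (x - y) + \<bar>f y\<bar> powr r * M"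
      using M[of "x - y"] by (simp add: distrib_right mult_left_mono)
    finally show ?thesis using nonneg[OF t] by (simp add: abs_mult mult.commute)
  qed
  show int2: "integrable lborel (\<lambda>y. f y * k t (x - y))" for x
  proof (rule Bochner_Integration.integrable_bound[OF int1[of x]])
    have "norm (f y * k t (x - y)) \<le> norm (k t (x - y) + M * \<bar>f y\<bar> powr r)" for y
      using le[of y x] by simp
    then show "AE y in lborel. norm (f y * k t (x - y)) \<le> norm (k t (x - y) + M * \<bar>f y\<bar> powr r)"
      by simp
  qed simp
  have "\<bar>conv t f x\<bar> \<le> 1 + M * (\<integral>y. \<bar>f y\<bar> powr r \<partial>lborel)" for x
  proof -
    have "\<bar>conv t f x\<bar> \<le> (\<integral>y. \<bar>f y * k t (x - y)\<bar> \<partial>lborel)"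
      unfolding conv_def by (rule integral_abs_bound)
    also have "\<dots> \<le> (\<integral>y. k t (x - y) + M * \<bar>f y\<bar> powr r \<partial>lborel)"
      using int1 int2 le by (intro integral_mono) auto
    also have "\<dots> = 1 + M * (\<integral>y. \<bar>f y\<bar> powr r \<partial>lborel)"
      using int integrable_kernel[OF t] integral_kernel[OF t] by simp
    finally show ?thesis .
  qed
  then show "\<exists>M. \<forall>x. \<bar>conv t f x\<bar> \<le> M" by blast
qed

lemma conv_nonneg: "(\<And>x. 0 \<le> f x) \<Longrightarrow> 0 < t \<Longrightarrow> 0 \<le> conv t f x"
  unfolding conv_def by (intro integral_nonneg_AE AE_I2 mult_nonneg_nonneg nonneg)

lemma ennreal_conv:
  assumes "admissible f" "\<And>x. 0 \<le> f x" "0 < t"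
  shows "ennreal (conv t f x) = (\<integral>\<^sup>+y. ennreal (f y) * ennreal (k t (x - y)) \<partial>lborel)"
  unfolding conv_def
  using assms nonneg conv_bound(1)[OF assms(1,3)]
  by (subst nn_integral_eq_integral[symmetric]) (auto simp: ennreal_mult)

lemma integrable_bounded_kernel:
  assumes [measurable]: "g \<in> borel_measurable borel" and g: "\<And>y. \<bar>g y\<bar> \<le> M" and t: "0 < t"
  shows "integrable lborel (\<lambda>y. g y * k t (x - y))"
proof (rule Bochner_Integration.integrable_bound)
  show "integrable lborel (\<lambda>y. M * k t (x - y))" using integrable_kernel[OF t] by simp
  show "AE y in lborel. norm (g y * k t (x - y)) \<le> norm (M * k t (x - y))"
    using g nonneg[OF t] by (auto simp: abs_mult intro!: mult_right_mono order_trans[OF g])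
qed simp

lemma integrable_conv_kernel:
  assumes f: "admissible f" and s: "0 < s" and t: "0 < t"
  shows "integrable lborel (\<lambda>y. conv s f y * k t (x - y))"
proof -
  have [measurable]: "f \<in> borel_measurable borel" using f by (simp add: admissible_def)
  show ?thesis
    using conv_bound(2)[OF f s] by (auto intro: integrable_bounded_kernel[OF _ _ t])
qed

text \<open>Fubini. The absolute integrability it requires comes from the semigroup law for the
  nonnegative kernels, which collapses the double integral of absolute values to one of |f| against
  the kernel at time s + t.\<close>

lemma conv_conv:
  assumes f: "admissible f" and s: "0 < s" and t: "0 < t"
  shows "conv t (conv s f) x = conv (s + t) f x"
proof -
  have [measurable]: "f \<in> borel_measurable borel" using f by (simp add: admissible_def)
  have semi: "(\<integral>\<^sup>+y. ennreal (k s (y - z) * k t (x - y)) \<partial>lborel) = ennreal (k (s + t) (x - z))" for z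
  proof -
    have "(\<integral>\<^sup>+y. ennreal (k s (y - z) * k t (x - y)) \<partial>lborel)
        = (\<integral>\<^sup>+y. ennreal (k s ((x - z) - y)) * ennreal (k t y) \<partial>lborel)"
      using nn_integral_reflect[of "\<lambda>y. ennreal (k s (y - z) * k t (x - y))" x] nonneg s t
      by (simp add: ennreal_mult algebra_simps)
    also have "\<dots> = ennreal (k (s + t) (x - z))" by (rule semigroup[OF s t])
    finally show ?thesis .
  qed
  have semi_int: "integrable lborel (\<lambda>y. k s (y - z) * k t (x - y))"
    and semi_eq: "(\<integral>y. k s (y - z) * k t (x - y) \<partial>lborel) = k (s + t) (x - z)" for z
    using semi[of z] nonneg s t add_pos_pos[OF s t]
    by (auto intro!: integrableI_nonneg simp: integral_eq_nn_integral)
  have int: "integrable (lborel \<Otimes>\<^sub>M lborel) (\<lambda>(y, z). f z * (k s (y - z) * k t (x - y)))"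
  proof (rule integrableI_bounded)
    show "(\<lambda>(y, z). f z * (k s (y - z) * k t (x - y))) \<in> borel_measurable (lborel \<Otimes>\<^sub>M lborel)"
      by measurable
    have "(\<integral>\<^sup>+p. ennreal (norm (case p of (y, z) \<Rightarrow> f z * (k s (y - z) * k t (x - y)))) \<partial>(lborel \<Otimes>\<^sub>M lborel))
       = (\<integral>\<^sup>+z. (\<integral>\<^sup>+y. ennreal \<bar>f z\<bar> * ennreal (k s (y - z) * k t (x - y)) \<partial>lborel) \<partial>lborel)"
      using nonneg s t by (subst lborel_pair.nn_integral_snd[symmetric]) (auto simp: abs_mult ennreal_mult)
    also have "\<dots> = (\<integral>\<^sup>+z. ennreal (norm (f z * k (s + t) (x - z))) \<partial>lborel)"
      using nonneg[OF add_pos_pos[OF s t]]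
      by (subst nn_integral_cmult) (auto simp: semi abs_mult ennreal_mult)
    also have "\<dots> < \<infinity>"
      using conv_bound(1)[OF f add_pos_pos[OF s t]] by (simp add: integrable_iff_bounded)
    finally show "(\<integral>\<^sup>+p. ennreal (norm (case p of (y, z) \<Rightarrow> f z * (k s (y - z) * k t (x - y)))) \<partial>(lborel \<Otimes>\<^sub>M lborel)) < \<infinity>" .
  qed
  have "conv t (conv s f) x = (\<integral>y. (\<integral>z. f z * (k s (y - z) * k t (x - y)) \<partial>lborel) \<partial>lborel)"
    unfolding conv_def by (simp flip: integral_mult_left_zero add: mult.assoc)
  also have "\<dots> = (\<integral>z. (\<integral>y. f z * (k s (y - z) * k t (x - y)) \<partial>lborel) \<partial>lborel)"
    by (rule lborel_pair.Fubini_integral[OF int, symmetric])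
  also have "\<dots> = conv (s + t) f x"
    unfolding conv_def by (simp add: semi_eq)
  finally show ?thesis .
qed

text \<open>The probability density \<open>k t (x - y)\<close> gives \<open>conv t f\<close> the
  mean \<open>conv (2 * t) f x\<close>, which explains the centre.\<close>

definition variation :: "real \<Rightarrow> ('a \<Rightarrow> real) \<Rightarrow> 'a \<Rightarrow> ennreal" where
  "variation t f x = (\<integral>\<^sup>+y. ennreal (k t (x - y) * (conv t f y - conv (2 * t) f x)\<^sup>2) \<partial>lborel)"

lemma measurable_variation [measurable (raw)]:
  assumes [measurable]: "f \<in> borel_measurable borel" "g \<in> borel_measurable M" "h \<in> borel_measurable M"
  shows "(\<lambda>x. variation (g x) f (h x)) \<in> borel_measurable M"
proof -
  have [measurable]: "(\<lambda>z. conv (g (fst z)) f (snd z)) \<in> borel_measurable (M \<Otimes>\<^sub>M lborel)"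
    "(\<lambda>z. conv (2 * g (fst z)) f (h (fst z))) \<in> borel_measurable (M \<Otimes>\<^sub>M lborel)"
    "(\<lambda>z. k (g (fst z)) (h (fst z) - snd z)) \<in> borel_measurable (M \<Otimes>\<^sub>M lborel)"
    by (rule measurable_conv measurable_kernel; measurable)+
  have "(\<lambda>z. ennreal (k (g (fst z)) (h (fst z) - snd z) *
      (conv (g (fst z)) f (snd z) - conv (2 * g (fst z)) f (h (fst z)))\<^sup>2)) \<in> borel_measurable (M \<Otimes>\<^sub>M lborel)"
    by measurable
  then show ?thesis
    unfolding variation_def by (intro lborel.borel_measurable_nn_integral) (simp add: case_prod_beta')
qed

text \<open>\<open>B\<close> is continuous on the closed half-plane only. Composing with the
  retraction (u, w) -> (u, max 0 w) yields a continuous function on the plane that agrees with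
  \<open>B\<close> at nonnegative weights.\<close>

lemma measurable_bellman:
  assumes "bellman_fun p B c C"
    and [measurable]: "u \<in> borel_measurable M" "w \<in> borel_measurable M" and "\<And>x. 0 \<le> w x"
  shows "(\<lambda>x. B (u x) (w x)) \<in> borel_measurable M"
proof -
  have cont: "continuous_on {(u, w). 0 \<le> w} (\<lambda>(u, w). B u w)"
    using assms(1) by (simp add: bellman_fun_def)
  have "continuous_on UNIV (\<lambda>x::real \<times> real. (fst x, max 0 (snd x)))"
    by (intro continuous_intros)
  moreover have "range (\<lambda>x::real \<times> real. (fst x, max 0 (snd x))) \<subseteq> {(u, w). 0 \<le> w}" by auto
  ultimately have "continuous_on UNIV (\<lambda>x::real \<times> real. (\<lambda>(u, w). B u w) (fst x, max 0 (snd x)))"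
    by (rule continuous_on_compose2[OF cont])
  then have "continuous_on UNIV (\<lambda>x::real \<times> real. B (fst x) (max 0 (snd x)))"
    by simp
  then have 1: "(\<lambda>x::real \<times> real. B (fst x) (max 0 (snd x))) \<in> borel_measurable borel"
    by (rule borel_measurable_continuous_onI)
  have "(\<lambda>x. (u x, w x)) \<in> borel_measurable M" by (rule borel_measurable_Pair) auto
  from measurable_compose[OF this 1] show ?thesis
    using assms(4) by (simp add: max_def)
qed

text \<open>Integrate the supporting plane at the averaged point against the probability density
  \<open>k t (x - y)\<close>: the linear terms cancel because the base point is the mean, and the
  quadratic gain survives. In extended reals an infinite right-hand side is trivial, and a finite
  one supplies the integrability of \<open>B\<close> along (u, w).\<close>

lemma bellman_jensen:
  assumes B: "bellman_fun p B c C" and t: "0 < t"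
    and [measurable]: "u \<in> borel_measurable borel" "w \<in> borel_measurable borel" and w: "\<And>y. 0 \<le> w y"
    and int: "integrable lborel (\<lambda>y. u y * k t (x - y))" "integrable lborel (\<lambda>y. w y * k t (x - y))"
  shows "ennreal (B (conv t u x) (conv t w x))
      + ennreal (c * conv t w x) * (\<integral>\<^sup>+y. ennreal (k t (x - y) * (u y - conv t u x)\<^sup>2) \<partial>lborel)
    \<le> (\<integral>\<^sup>+y. ennreal (k t (x - y) * B (u y) (w y)) \<partial>lborel)"
proof (cases "(\<integral>\<^sup>+y. ennreal (k t (x - y) * B (u y) (w y)) \<partial>lborel) = \<infinity>")
  case False
  have c: "0 < c" using B by (simp add: bellman_fun_def)
  have Bnn: "0 \<le> B u w" if "0 \<le> w" for u w using B that by (auto simp: bellman_fun_def)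
  note [measurable] = measurable_bellman[OF B \<open>u \<in> borel_measurable borel\<close> \<open>w \<in> borel_measurable borel\<close> w]
  define ub wb where "ub = conv t u x" and "wb = conv t w x"
  have wb: "0 \<le> wb" unfolding wb_def using w t by (rule conv_nonneg)
  obtain D E where DE: "\<And>u' w'. 0 \<le> w' \<Longrightarrow>
      B ub wb + D * (u' - ub) + E * (w' - wb) + c * wb * (u' - ub)\<^sup>2 \<le> B u' w'"
    using B wb unfolding bellman_fun_def by blast
  \<comment> \<open>\<open>R\<close> is the kernel times the gap between \<open>B\<close> and its
    supporting plane without the quadratic term, expanded so that each summand is integrable by
    itself.\<close>
  define R where "R y = k t (x - y) * B (u y) (w y) - B ub wb * k t (x - y)
    - D * (u y * k t (x - y)) + D * ub * k t (x - y) - E * (w y * k t (x - y)) + E * wb * k t (x - y)" for y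
  have intB: "integrable lborel (\<lambda>y. k t (x - y) * B (u y) (w y))"
    using False nonneg[OF t] Bnn[OF w]
    by (intro integrableI_nonneg) (auto simp: less_top)
  have intR: "integrable lborel R"
    unfolding R_def using intB int integrable_kernel[OF t]
    by (intro Bochner_Integration.integrable_add Bochner_Integration.integrable_diff
        integrable_mult_right) auto
  have "(\<integral>y. R y \<partial>lborel) = (\<integral>y. k t (x - y) * B (u y) (w y) \<partial>lborel) - B ub wb
    - D * ub + D * ub - E * wb + E * wb"
    unfolding R_def using intB int integrable_kernel[OF t] integral_kernel[OF t, of x]
    by (simp add: ub_def wb_def conv_def)
  then have eqR: "(\<integral>y. R y \<partial>lborel) = (\<integral>y. k t (x - y) * B (u y) (w y) \<partial>lborel) - B ub wb"
    by simp
  have le: "c * wb * (k t (x - y) * (u y - ub)\<^sup>2) \<le> R y" for y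
    using mult_left_mono[OF DE[OF w[of y], of "u y"] nonneg[OF t, of "x - y"]]
    by (simp add: R_def algebra_simps)
  have nn: "0 \<le> c * wb * (k t (x - y) * (u y - ub)\<^sup>2)" for y
    using c wb nonneg[OF t] by simp
  have "ennreal (c * wb) * (\<integral>\<^sup>+y. ennreal (k t (x - y) * (u y - ub)\<^sup>2) \<partial>lborel)
      = (\<integral>\<^sup>+y. ennreal (c * wb * (k t (x - y) * (u y - ub)\<^sup>2)) \<partial>lborel)"
    using c wb nonneg[OF t] by (subst nn_integral_cmult[symmetric]) (auto simp: ennreal_mult)
  also have "\<dots> \<le> (\<integral>\<^sup>+y. ennreal (R y) \<partial>lborel)"
    using le by (intro nn_integral_mono ennreal_leI) auto
  also have "\<dots> = ennreal (\<integral>y. R y \<partial>lborel)"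
    using order_trans[OF nn le] by (intro nn_integral_eq_integral intR) auto
  finally have "ennreal (B ub wb) + ennreal (c * wb) * (\<integral>\<^sup>+y. ennreal (k t (x - y) * (u y - ub)\<^sup>2) \<partial>lborel)
     \<le> ennreal (B ub wb) + ennreal (\<integral>y. R y \<partial>lborel)"
    by (rule add_left_mono)
  also have "\<dots> = ennreal (\<integral>y. k t (x - y) * B (u y) (w y) \<partial>lborel)"
  proof -
    have "0 \<le> (\<integral>y. R y \<partial>lborel)"
      using order_trans[OF nn le] by (intro integral_nonneg_AE AE_I2)
    then show ?thesis using Bnn[OF wb] by (simp add: eqR flip: ennreal_plus)
  qed
  also have "\<dots> = (\<integral>\<^sup>+y. ennreal (k t (x - y) * B (u y) (w y)) \<partial>lborel)"
    using intB nonneg[OF t] Bnn[OF w] by (intro nn_integral_eq_integral[symmetric]) auto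
  finally show ?thesis by (simp add: ub_def wb_def)
qed simp

lemma nn_integral_kernel_average:
  assumes [measurable]: "g \<in> borel_measurable borel" and t: "0 < t"
  shows "(\<integral>\<^sup>+x. (\<integral>\<^sup>+y. ennreal (k t (x - y)) * g y \<partial>lborel) \<partial>lborel) = (\<integral>\<^sup>+y. g y \<partial>lborel)"
proof -
  have "(\<integral>\<^sup>+x. (\<integral>\<^sup>+y. ennreal (k t (x - y)) * g y \<partial>lborel) \<partial>lborel)
     = (\<integral>\<^sup>+y. (\<integral>\<^sup>+x. ennreal (k t (x - y)) * g y \<partial>lborel) \<partial>lborel)"
    by (rule lborel_pair.Fubini'[symmetric]) measurable
  also have "\<dots> = (\<integral>\<^sup>+y. g y \<partial>lborel)"
    using total_shift(2)[OF t] by (subst nn_integral_multc) auto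
  finally show ?thesis .
qed

text \<open>Jensen with the gain dropped, then integration in x, where the kernel has mass one:
  along the semigroup the integral of \<open>B\<close> never exceeds its value at the initial pair
  (f, h), which the growth bound controls.\<close>

lemma conv_power_integral_le:
  assumes B: "bellman_fun p B c C"
    and f: "admissible f" and h: "admissible h" "\<And>x. 0 \<le> h x" and s: "0 < s"
  shows "(\<integral>\<^sup>+x. ennreal (B (conv s f x) (conv s h x)) \<partial>lborel)
    \<le> ennreal C * ((\<integral>\<^sup>+x. ennreal (\<bar>f x\<bar> powr p) \<partial>lborel) + (\<integral>\<^sup>+x. ennreal (h x powr (p / (p - 2))) \<partial>lborel))"
proof -
  have [measurable]: "f \<in> borel_measurable borel" "h \<in> borel_measurable borel"
    using f h by (auto simp: admissible_def)
  note [measurable] = measurable_bellman[OF B, of f borel h]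
  have Bnn: "0 \<le> B u w" if "0 \<le> w" for u w using B that by (auto simp: bellman_fun_def)
  have Ble: "B u w \<le> C * (\<bar>u\<bar> powr p + w powr (p / (p - 2)))" if "0 \<le> w" for u w
    using B that by (auto simp: bellman_fun_def)
  have C: "0 < C" using B by (simp add: bellman_fun_def)
  have "(\<integral>\<^sup>+x. ennreal (B (conv s f x) (conv s h x)) \<partial>lborel)
    \<le> (\<integral>\<^sup>+x. (\<integral>\<^sup>+y. ennreal (k s (x - y) * B (f y) (h y)) \<partial>lborel) \<partial>lborel)"
    by (intro nn_integral_mono)
       (rule order_trans[OF _ bellman_jensen[OF B s]], use f h conv_bound(1)[OF _ s] in auto)
  also have "\<dots> = (\<integral>\<^sup>+x. (\<integral>\<^sup>+y. ennreal (k s (x - y)) * ennreal (B (f y) (h y)) \<partial>lborel) \<partial>lborel)"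
    using nonneg[OF s] Bnn h by (intro nn_integral_cong) (simp add: ennreal_mult)
  also have "\<dots> = (\<integral>\<^sup>+y. ennreal (B (f y) (h y)) \<partial>lborel)"
    using h by (intro nn_integral_kernel_average s) measurable
  also have "\<dots> \<le> (\<integral>\<^sup>+y. ennreal C * (ennreal (\<bar>f y\<bar> powr p) + ennreal (h y powr (p / (p - 2)))) \<partial>lborel)"
    using Ble[OF h(2)] C
    by (intro nn_integral_mono) (simp flip: ennreal_mult ennreal_plus add: ennreal_leI)
  also have "\<dots> = ennreal C * ((\<integral>\<^sup>+x. ennreal (\<bar>f x\<bar> powr p) \<partial>lborel) + (\<integral>\<^sup>+x. ennreal (h x powr (p / (p - 2))) \<partial>lborel))"
    by (simp add: nn_integral_cmult nn_integral_add)
  finally show ?thesis .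
qed

text \<open>Jensen at time s for the pair (Q_s f, Q_s h), whose averages are (Q_{2s} f, Q_{2s} h) by
  the semigroup law. Integration in x turns the right-hand side into the same functional at scale s,
  so the quantity drops by the weighted variance when s is doubled.\<close>

lemma bellman_step:
  assumes B: "bellman_fun p B c C"
    and f: "admissible f" and h: "admissible h" "\<And>x. 0 \<le> h x" and s: "0 < s"
  shows "(\<integral>\<^sup>+x. ennreal (B (conv (2 * s) f x) (conv (2 * s) h x)) \<partial>lborel)
      + ennreal c * (\<integral>\<^sup>+x. ennreal (conv (2 * s) h x) * variation s f x \<partial>lborel)
    \<le> (\<integral>\<^sup>+x. ennreal (B (conv s f x) (conv s h x)) \<partial>lborel)"
proof -
  have [measurable]: "f \<in> borel_measurable borel" "h \<in> borel_measurable borel"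
    using f h by (auto simp: admissible_def)
  have hs: "0 \<le> conv t h x" if "0 < t" for t x using h that by (intro conv_nonneg) auto
  have s2: "0 < 2 * s" using s by simp
  note [measurable] = measurable_bellman[OF B, of "conv s f" borel "conv s h"]
    measurable_bellman[OF B, of "conv (2 * s) f" borel "conv (2 * s) h"]
  have Bnn: "0 \<le> B u w" if "0 \<le> w" for u w using B that by (auto simp: bellman_fun_def)
  have c: "0 < c" using B by (simp add: bellman_fun_def)
  have twice: "conv s (conv s g) x = conv (2 * s) g x" if "admissible g" for g x
    using conv_conv[OF that s s] by simp
  have "(\<integral>\<^sup>+x. ennreal (B (conv (2 * s) f x) (conv (2 * s) h x)) \<partial>lborel)
      + ennreal c * (\<integral>\<^sup>+x. ennreal (conv (2 * s) h x) * variation s f x \<partial>lborel)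
    = (\<integral>\<^sup>+x. ennreal (B (conv (2 * s) f x) (conv (2 * s) h x))
      + ennreal (c * conv (2 * s) h x) * variation s f x \<partial>lborel)"
    using hs[OF s2] c
    by (subst nn_integral_add) (auto simp: nn_integral_cmult[symmetric] ennreal_mult mult.assoc)
  also have "\<dots> \<le> (\<integral>\<^sup>+x. (\<integral>\<^sup>+y. ennreal (k s (x - y) * B (conv s f y) (conv s h y)) \<partial>lborel) \<partial>lborel)"
  proof (rule nn_integral_mono)
    fix x
    show "ennreal (B (conv (2 * s) f x) (conv (2 * s) h x)) + ennreal (c * conv (2 * s) h x) * variation s f x
      \<le> (\<integral>\<^sup>+y. ennreal (k s (x - y) * B (conv s f y) (conv s h y)) \<partial>lborel)"
      using bellman_jensen[OF B s, of "conv s f" "conv s h" x] hs[OF s]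
        integrable_conv_kernel[OF f s s] integrable_conv_kernel[OF h(1) s s]
      unfolding twice[OF f] twice[OF h(1)] variation_def by simp
  qed
  also have "\<dots> = (\<integral>\<^sup>+x. (\<integral>\<^sup>+y. ennreal (k s (x - y)) * ennreal (B (conv s f y) (conv s h y)) \<partial>lborel) \<partial>lborel)"
    using nonneg[OF s] Bnn hs[OF s] by (intro nn_integral_cong) (simp add: ennreal_mult)
  also have "\<dots> = (\<integral>\<^sup>+y. ennreal (B (conv s f y) (conv s h y)) \<partial>lborel)"
    using hs[OF s] by (intro nn_integral_kernel_average s) measurable
  finally show ?thesis .
qed

end

text \<open>A Frullani-type argument: \<open>\<beta> s - \<beta> (2 s)\<close> telescopes against the dilation-invariant
  measure \<open>ds / s\<close>.\<close>

lemma nn_integral_frullani_le: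
  fixes \<beta> V :: "real \<Rightarrow> ennreal"
  assumes [measurable]: "\<beta> \<in> borel_measurable borel" "V \<in> borel_measurable borel"
    and step: "\<And>s. 0 < s \<Longrightarrow> \<beta> (2 * s) + V s \<le> \<beta> s"
    and M: "\<And>s. 0 < s \<Longrightarrow> \<beta> s \<le> M"
  shows "(\<integral>\<^sup>+s\<in>{0<..}. V s * ennreal (1 / s) \<partial>lborel) \<le> M"
proof (cases "M = \<infinity>")
  case False
  then have Mfin: "M < \<infinity>" by (simp add: less_top)
  have dil: "(\<integral>\<^sup>+s\<in>{a..b}. \<beta> (2 * s) * ennreal (1 / s) \<partial>lborel) = (\<integral>\<^sup>+s\<in>{2 * a..2 * b}. \<beta> s * ennreal (1 / s) \<partial>lborel)"
    if "0 < a" for a b :: real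
  proof -
    have "(\<integral>\<^sup>+s\<in>{2 * a..2 * b}. \<beta> s * ennreal (1 / s) \<partial>lborel)
      = 2 * (\<integral>\<^sup>+s. (\<beta> (2 * s) * ennreal (1 / (2 * s))) * indicator {2 * a..2 * b} (2 * s) \<partial>lborel)"
      using nn_integral_real_affine[of "\<lambda>s. \<beta> s * ennreal (1 / s) * indicator {2 * a..2 * b} s" 2 0] by simp
    also have "\<dots> = (\<integral>\<^sup>+s. 2 * ((\<beta> (2 * s) * ennreal (1 / (2 * s))) * indicator {2 * a..2 * b} (2 * s)) \<partial>lborel)"
      by (rule nn_integral_cmult[symmetric]) measurable
    also have "\<dots> = (\<integral>\<^sup>+s\<in>{a..b}. \<beta> (2 * s) * ennreal (1 / s) \<partial>lborel)"
    proof (rule nn_integral_cong)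
      fix s :: real
      have "2 * ennreal (1 / (2 * s)) = ennreal (1 / s)" if "0 < s"
        using that by (simp flip: ennreal_numeral ennreal_mult)
      then show "2 * ((\<beta> (2 * s) * ennreal (1 / (2 * s))) * indicator {2 * a..2 * b} (2 * s))
         = \<beta> (2 * s) * ennreal (1 / s) * indicator {a..b} s"
        using \<open>0 < a\<close> by (auto split: split_indicator simp: mult.left_commute[of 2] mult.commute)
    qed
    finally show ?thesis ..
  qed
  have part: "(\<integral>\<^sup>+s\<in>{a..b}. V s * ennreal (1 / s) \<partial>lborel) \<le> M" if a: "0 < a" and ab: "a \<le> b" for a b :: real
  proof -
    \<comment> \<open>This term appears on both sides below and is cancelled, which requires it to
      be finite; on a compact interval of s the bound by M suffices.\<close>
    have fin: "(\<integral>\<^sup>+s\<in>{2 * a..2 * b}. \<beta> s * ennreal (1 / s) \<partial>lborel) \<noteq> \<infinity>"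
    proof -
      have "(\<integral>\<^sup>+s\<in>{2 * a..2 * b}. \<beta> s * ennreal (1 / s) \<partial>lborel)
        \<le> (\<integral>\<^sup>+s. (M * ennreal (1 / (2 * a))) * indicator {2 * a..2 * b} s \<partial>lborel)"
        using a M by (intro nn_integral_mono) (auto split: split_indicator intro!: mult_mono ennreal_leI divide_left_mono)
      also have "\<dots> < \<infinity>"
        using Mfin ab by (simp add: nn_integral_cmult_indicator ennreal_mult_less_top)
      finally show ?thesis by simp
    qed
    have "(\<integral>\<^sup>+s\<in>{2 * a..2 * b}. \<beta> s * ennreal (1 / s) \<partial>lborel) + (\<integral>\<^sup>+s\<in>{a..b}. V s * ennreal (1 / s) \<partial>lborel)
      = (\<integral>\<^sup>+s\<in>{a..b}. (\<beta> (2 * s) + V s) * ennreal (1 / s) \<partial>lborel)"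
      unfolding dil[OF a, symmetric]
      by (subst nn_integral_add[symmetric]) (auto intro!: nn_integral_cong simp: distrib_right)
    also have "\<dots> \<le> (\<integral>\<^sup>+s\<in>{a..b}. \<beta> s * ennreal (1 / s) \<partial>lborel)"
      using a step by (intro nn_integral_mono) (auto split: split_indicator intro!: mult_right_mono)
    \<comment> \<open>[a, b] is covered by [2a, 2b] and [a, 2a]. The first piece is the dilated
      integral on the left-hand side. The second has ds/s-mass log 2; the crude bound 1/s <= 1/a
      replaces this by 1.\<close>
    also have "\<dots> \<le> (\<integral>\<^sup>+s. \<beta> s * ennreal (1 / s) * indicator {2 * a..2 * b} s
        + \<beta> s * ennreal (1 / s) * indicator {a..2 * a} s \<partial>lborel)"
      by (intro nn_integral_mono) (use a in \<open>auto split: split_indicator\<close>)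
    also have "\<dots> = (\<integral>\<^sup>+s\<in>{2 * a..2 * b}. \<beta> s * ennreal (1 / s) \<partial>lborel)
        + (\<integral>\<^sup>+s\<in>{a..2 * a}. \<beta> s * ennreal (1 / s) \<partial>lborel)"
      by (intro nn_integral_add) measurable
    also have "(\<integral>\<^sup>+s\<in>{a..2 * a}. \<beta> s * ennreal (1 / s) \<partial>lborel)
        \<le> (\<integral>\<^sup>+s. (M * ennreal (1 / a)) * indicator {a..2 * a} s \<partial>lborel)"
      using a M by (intro nn_integral_mono) (auto split: split_indicator intro!: mult_mono ennreal_leI divide_left_mono)
    also have "\<dots> = M * (ennreal (1 / a) * ennreal a)"
      using a by (subst nn_integral_cmult_indicator) (auto simp: mult.assoc)
    also have "ennreal (1 / a) * ennreal a = 1"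
      using a by (simp flip: ennreal_mult)
    finally have "(\<integral>\<^sup>+s\<in>{2 * a..2 * b}. \<beta> s * ennreal (1 / s) \<partial>lborel) + (\<integral>\<^sup>+s\<in>{a..b}. V s * ennreal (1 / s) \<partial>lborel)
      \<le> (\<integral>\<^sup>+s\<in>{2 * a..2 * b}. \<beta> s * ennreal (1 / s) \<partial>lborel) + M"
      by (simp add: add_left_mono)
    then show ?thesis using fin by (simp add: ennreal_add_left_cancel_le)
  qed
  have "(\<integral>\<^sup>+s\<in>{0<..}. V s * ennreal (1 / s) \<partial>lborel)
    = (\<integral>\<^sup>+s. (SUP n::nat. V s * ennreal (1 / s) * indicator {1 / real (Suc n)..real (Suc n)} s) \<partial>lborel)"
  proof (rule nn_integral_cong)
    fix s :: real
    show "V s * ennreal (1 / s) * indicator {0<..} s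
      = (SUP n::nat. V s * ennreal (1 / s) * indicator {1 / real (Suc n)..real (Suc n)} s)"
    proof (cases "0 < s")
      case True
      obtain n :: nat where n: "max s (1 / s) \<le> real n" using real_arch_simple by blast
      then have "s \<in> {1 / real (Suc n)..real (Suc n)}" using True by (auto simp: field_simps)
      then show ?thesis using True
        by (intro antisym SUP_upper2[of n] SUP_least) (auto split: split_indicator)
    next
      case False
      then have "s \<notin> {1 / real (Suc n)..real (Suc n)}" for n
      proof -
        have "0 < 1 / real (Suc n)" by simp
        then show ?thesis using False unfolding atLeastAtMost_iff by linarith
      qed
      then show ?thesis using False by simp
    qed
  qed
  also have "\<dots> = (SUP n::nat. \<integral>\<^sup>+s. V s * ennreal (1 / s) * indicator {1 / real (Suc n)..real (Suc n)} s \<partial>lborel)"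
  proof (rule nn_integral_monotone_convergence_SUP)
    show "incseq (\<lambda>n s. V s * ennreal (1 / s) * indicator {1 / real (Suc n)..real (Suc n)} s)"
    proof (intro incseq_SucI le_funI)
      fix n and s :: real
      have "1 / real (Suc (Suc n)) \<le> 1 / real (Suc n)" by (simp add: field_simps)
      then show "V s * ennreal (1 / s) * indicator {1 / real (Suc n)..real (Suc n)} s
        \<le> V s * ennreal (1 / s) * indicator {1 / real (Suc (Suc n))..real (Suc (Suc n))} s"
        by (auto split: split_indicator)
    qed
  qed measurable
  also have "\<dots> \<le> M"
    by (intro SUP_least part) (auto simp: field_simps intro: mult_mono order_trans[of 1])
  finally show ?thesis .
qed simp

context convolution_semigroup
begin

lemma variation_weighted_integral_le:
  assumes B: "bellman_fun p B c C"
    and f: "admissible f" and h: "admissible h" "\<And>x. 0 \<le> h x"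
  shows "(\<integral>\<^sup>+s\<in>{0<..}. (\<integral>\<^sup>+x. ennreal (conv (2 * s) h x) * variation s f x \<partial>lborel) * ennreal (1 / s) \<partial>lborel)
    \<le> ennreal (C / c) * ((\<integral>\<^sup>+x. ennreal (\<bar>f x\<bar> powr p) \<partial>lborel) + (\<integral>\<^sup>+x. ennreal (h x powr (p / (p - 2))) \<partial>lborel))"
    (is "?I \<le> _ * ?N")
proof -
  have [measurable]: "f \<in> borel_measurable borel" "h \<in> borel_measurable borel"
    using f h by (auto simp: admissible_def)
  have c: "0 < c" "0 < C" using B by (auto simp: bellman_fun_def)
  have pos: "0 \<le> conv s h x" if "0 < s" for s x using h that by (intro conv_nonneg) auto
  \<comment> \<open>\<open>max 0\<close> makes the integrand measurable at every real s, including s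
    <= 0, where the sign of the convolution is not known. For s > 0 it changes nothing.\<close>
  define \<beta> where "\<beta> s = (\<integral>\<^sup>+x. ennreal (B (conv s f x) (max 0 (conv s h x))) \<partial>lborel)" for s
  define V where "V s = ennreal c * (\<integral>\<^sup>+x. ennreal (conv (2 * s) h x) * variation s f x \<partial>lborel)" for s
  have "(\<lambda>z. B (conv (fst z) f (snd z)) (max 0 (conv (fst z) h (snd z)))) \<in> borel_measurable (borel \<Otimes>\<^sub>M lborel)"
    by (rule measurable_bellman[OF B]) auto
  then have [measurable]: "\<beta> \<in> borel_measurable borel"
    unfolding \<beta>_def by (intro lborel.borel_measurable_nn_integral) (simp add: case_prod_beta')
  have [measurable]: "V \<in> borel_measurable borel" unfolding V_def by measurable
  have eq: "\<beta> s = (\<integral>\<^sup>+x. ennreal (B (conv s f x) (conv s h x)) \<partial>lborel)" if "0 < s" for s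
    unfolding \<beta>_def using pos[OF that] by (simp add: max_absorb2)
  have "(\<integral>\<^sup>+s\<in>{0<..}. V s * ennreal (1 / s) \<partial>lborel) \<le> ennreal C * ?N"
  proof (rule nn_integral_frullani_le[of \<beta>])
    show "\<beta> (2 * s) + V s \<le> \<beta> s" if "0 < s" for s
      using bellman_step[OF B f h that] that by (simp add: eq V_def)
    show "\<beta> s \<le> ennreal C * ?N" if "0 < s" for s
      using conv_power_integral_le[OF B f h that] that by (simp add: eq)
  qed measurable
  also have "(\<integral>\<^sup>+s\<in>{0<..}. V s * ennreal (1 / s) \<partial>lborel) = ennreal c * ?I"
    unfolding V_def by (subst nn_integral_cmult[symmetric]) (auto simp: mult.assoc)
  finally have "ennreal (1 / c) * (ennreal c * ?I) \<le> ennreal (1 / c) * (ennreal C * ?N)"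
    by (intro mult_left_mono) auto
  moreover have "ennreal (1 / c) * (ennreal c * ?I) = ?I"
    using c by (simp flip: mult.assoc ennreal_mult)
  moreover have "ennreal (1 / c) * (ennreal C * ?N) = ennreal (C / c) * ?N"
    using c by (simp flip: mult.assoc ennreal_mult)
  ultimately show ?thesis by simp
qed

end

section \<open>Gaussian kernels and moment integrals\<close>

lemma lborel_integral_prod:
  fixes f :: "'a::euclidean_space \<Rightarrow> real \<Rightarrow> complex"
  assumes int: "\<And>b. b \<in> Basis \<Longrightarrow> integrable lborel (f b)"
  shows "integrable lborel (\<lambda>x::'a. \<Prod>b\<in>Basis. f b (x \<bullet> b))"
    and "(\<integral>x. (\<Prod>b\<in>Basis. f b (x \<bullet> b)) \<partial>lborel) = (\<Prod>b\<in>Basis. integral\<^sup>L lborel (f b))"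
proof -
  interpret product_sigma_finite "\<lambda>_::'a. lborel :: real measure" by standard
  have [measurable]: "f b \<in> borel_measurable borel" if "b \<in> Basis" for b
    using borel_measurable_integrable[OF int[OF that]] by simp
  have m: "(\<lambda>x::'a. \<Prod>b\<in>Basis. f b (x \<bullet> b)) \<in> borel_measurable borel"
    by measurable
  have eq: "(\<Prod>b\<in>Basis. f b ((\<Sum>b'\<in>Basis. y b' *\<^sub>R b') \<bullet> b)) = (\<Prod>b\<in>Basis. f b (y b))" for y
    by (intro prod.cong) auto
  have lb: "(lborel :: 'a measure) = distr (Pi\<^sub>M Basis (\<lambda>_. lborel)) borel (\<lambda>f. \<Sum>b\<in>Basis. f b *\<^sub>R b)"
    by (simp add: lborel_def[where 'a = 'a] lborel_eq_real)
  show "integrable lborel (\<lambda>x::'a. \<Prod>b\<in>Basis. f b (x \<bullet> b))"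
    unfolding lb by (subst integrable_distr_eq) (auto simp: eq intro!: product_integrable_prod int)
  show "(\<integral>x. (\<Prod>b\<in>Basis. f b (x \<bullet> b)) \<partial>lborel) = (\<Prod>b\<in>Basis. integral\<^sup>L lborel (f b))"
    unfolding lb by (subst integral_distr) (auto simp: eq intro!: product_integral_prod int)
qed

text \<open>The characteristic function of the standard normal law, dilated by a = sqrt (2
  c).\<close>

lemma fourier_gaussian_real:
  fixes c t :: real
  assumes c: "0 < c"
  shows "has_bochner_integral lborel (\<lambda>x. iexp (t * x) * complex_of_real (exp (- c * x\<^sup>2)))
    (complex_of_real (sqrt (pi / c) * exp (- t\<^sup>2 / (4 * c))))"
proof -
  define a where "a = sqrt (2 * c)"
  have a: "0 < a" "a\<^sup>2 = 2 * c" using c by (auto simp: a_def)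
  have int0: "integrable lborel (\<lambda>x. std_normal_density x *\<^sub>R iexp (s * x))" for s
  proof (rule Bochner_Integration.integrable_bound)
    show "integrable lborel std_normal_density" by (rule integrable_normal_density) simp
    show "AE x in lborel. norm (std_normal_density x *\<^sub>R iexp (s * x)) \<le> norm (std_normal_density x)"
      by auto
  qed simp
  have "(\<integral>x. std_normal_density x *\<^sub>R iexp (s * x) \<partial>lborel) = complex_of_real (exp (- s\<^sup>2 / 2))" for s
  proof -
    have "(\<integral>x. std_normal_density x *\<^sub>R iexp (s * x) \<partial>lborel) = char std_normal_distribution s"
      unfolding char_def by (subst integral_density) auto
    then show ?thesis by (simp add: char_std_normal_distribution)
  qed
  then have "has_bochner_integral lborel (\<lambda>x. std_normal_density x *\<^sub>R iexp (s * x)) (complex_of_real (exp (- s\<^sup>2 / 2)))" for s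
    using int0[of s] unfolding has_bochner_integral_iff by blast
  note this[of "t / a"]
  from lborel_has_bochner_integral_real_affine_iff[THEN iffD1, OF _ this, of a 0] a
  have "has_bochner_integral lborel (\<lambda>x. std_normal_density (a * x) *\<^sub>R iexp ((t / a) * (a * x)))
      (complex_of_real (exp (- (t / a)\<^sup>2 / 2)) /\<^sub>R a)" by simp
  from has_bochner_integral_mult_right[OF this, of "complex_of_real (sqrt (2 * pi))"]
  have "has_bochner_integral lborel (\<lambda>x. complex_of_real (sqrt (2 * pi)) * (std_normal_density (a * x) *\<^sub>R iexp ((t / a) * (a * x))))
      (complex_of_real (sqrt (2 * pi)) * (complex_of_real (exp (- (t / a)\<^sup>2 / 2)) /\<^sub>R a))" by simp
  also have "(\<lambda>x. complex_of_real (sqrt (2 * pi)) * (std_normal_density (a * x) *\<^sub>R iexp ((t / a) * (a * x))))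
     = (\<lambda>x. iexp (t * x) * complex_of_real (exp (- c * x\<^sup>2)))"
    using a by (auto simp: normal_density_def fun_eq_iff power_mult_distrib scaleR_conv_of_real real_sqrt_mult)
  also have "complex_of_real (sqrt (2 * pi)) * (complex_of_real (exp (- (t / a)\<^sup>2 / 2)) /\<^sub>R a)
    = complex_of_real (sqrt (pi / c) * exp (- t\<^sup>2 / (4 * c)))"
  proof -
    have "sqrt (2 * pi) / a = sqrt (pi / c)"
      unfolding a_def using c by (simp add: real_sqrt_mult real_sqrt_divide)
    then show ?thesis
      using a by (simp add: power_divide scaleR_conv_of_real field_simps flip: of_real_mult of_real_divide)
  qed
  finally show ?thesis .
qed

text \<open>The Gauss-Weierstrass kernel in the normalization with Fourier transform exp (-s
  |\<xi>|^2).\<close>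

definition heat :: "real \<Rightarrow> 'a::euclidean_space \<Rightarrow> real" where
  "heat s x = (4 * pi * s) powr (- real DIM('a) / 2) * exp (- (norm x)\<^sup>2 / (4 * s))"

lemma norm_sum_sq: "(\<Sum>b\<in>Basis. (x \<bullet> b)\<^sup>2) = (norm (x::'a::euclidean_space))\<^sup>2"
  by (simp only: power2_norm_eq_inner) (subst euclidean_inner, simp add: power2_eq_square)

lemma fourier_gaussian:
  fixes x :: "'a::euclidean_space"
  assumes s: "0 < s"
  shows "has_bochner_integral lborel (\<lambda>\<xi>. cos (\<xi> \<bullet> x) * exp (- s * (norm \<xi>)\<^sup>2)) ((2 * pi) ^ DIM('a) * heat s x)"
proof -
  define f where "f b \<xi> = iexp ((x \<bullet> b) * \<xi>) * complex_of_real (exp (- s * \<xi>\<^sup>2))" for b :: 'a and \<xi>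
  have f: "has_bochner_integral lborel (f b) (complex_of_real (sqrt (pi / s) * exp (- (x \<bullet> b)\<^sup>2 / (4 * s))))" for b
    unfolding f_def by (rule fourier_gaussian_real[OF s])
  have "has_bochner_integral lborel (\<lambda>\<xi>. \<Prod>b\<in>Basis. f b (\<xi> \<bullet> b))
     (\<Prod>b\<in>Basis. complex_of_real (sqrt (pi / s) * exp (- (x \<bullet> b)\<^sup>2 / (4 * s))))"
    using lborel_integral_prod[of f] f by (simp add: has_bochner_integral_iff)
  also have "(\<lambda>\<xi>. \<Prod>b\<in>Basis. f b (\<xi> \<bullet> b)) = (\<lambda>\<xi>. iexp (\<xi> \<bullet> x) * complex_of_real (exp (- s * (norm \<xi>)\<^sup>2)))"
  proof
    fix \<xi> :: 'a
    have "(\<Prod>b\<in>Basis. f b (\<xi> \<bullet> b)) = exp (\<i> * complex_of_real (\<Sum>b\<in>Basis. (\<xi> \<bullet> b) * (x \<bullet> b)))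
        * complex_of_real (exp (- s * (\<Sum>b\<in>Basis. (\<xi> \<bullet> b)\<^sup>2)))"
      unfolding f_def prod.distrib
      by (simp add: exp_sum[symmetric] sum_distrib_left mult.commute flip: of_real_prod)
    then show "(\<Prod>b\<in>Basis. f b (\<xi> \<bullet> b)) = iexp (\<xi> \<bullet> x) * complex_of_real (exp (- s * (norm \<xi>)\<^sup>2))"
      by (simp only: norm_sum_sq euclidean_inner[symmetric])
  qed
  also have "(\<Prod>b\<in>Basis. complex_of_real (sqrt (pi / s) * exp (- (x \<bullet> b)\<^sup>2 / (4 * s))))
     = complex_of_real (sqrt (pi / s) ^ DIM('a) * exp (- (norm x)\<^sup>2 / (4 * s)))"
  proof -
    have "- (norm x)\<^sup>2 / (4 * s) = (\<Sum>b\<in>Basis. - (x \<bullet> b)\<^sup>2 / (4 * s))"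
      unfolding norm_sum_sq[symmetric] by (simp add: sum_negf sum_divide_distrib)
    then have "exp (- (norm x)\<^sup>2 / (4 * s)) = (\<Prod>b\<in>Basis. exp (- (x \<bullet> b)\<^sup>2 / (4 * s)))"
      by (simp only: exp_sum finite_Basis)
    then show ?thesis by (simp add: prod.distrib flip: of_real_prod)
  qed
  also have "sqrt (pi / s) ^ DIM('a) * exp (- (norm x)\<^sup>2 / (4 * s)) = (2 * pi) ^ DIM('a) * heat s x"
  proof -
    have "sqrt (pi / s) = (pi / s) powr (1/2)" using s by (simp add: powr_half_sqrt)
    then have 1: "sqrt (pi / s) ^ DIM('a) = (pi / s) powr (real DIM('a) / 2)"
      using s by (simp add: powr_power)
    have "pi / s = (2 * pi)\<^sup>2 * inverse (4 * pi * s)" using s by (simp add: field_simps power2_eq_square)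
    then have "(pi / s) powr (real DIM('a) / 2) = ((2 * pi)\<^sup>2) powr (real DIM('a) / 2) * (inverse (4 * pi * s)) powr (real DIM('a) / 2)"
      by (simp only: powr_mult)
    also have "((2 * pi)\<^sup>2) powr (real DIM('a) / 2) = (2 * pi) ^ DIM('a)"
      by (simp only: power2_powr_half) (simp add: powr_realpow)
    also have "(inverse (4 * pi * s)) powr (real DIM('a) / 2) = (4 * pi * s) powr (- real DIM('a) / 2)"
      using s by (simp add: powr_minus flip: inverse_powr)
    finally show ?thesis unfolding 1 heat_def by (simp only: mult.assoc)
  qed
  finally have *: "has_bochner_integral lborel (\<lambda>\<xi>. iexp (\<xi> \<bullet> x) * complex_of_real (exp (- s * (norm \<xi>)\<^sup>2)))
     (complex_of_real ((2 * pi) ^ DIM('a) * heat s x))" .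
  have "has_bochner_integral lborel (\<lambda>\<xi>. Re (iexp (\<xi> \<bullet> x) * complex_of_real (exp (- s * (norm \<xi>)\<^sup>2))))
     (Re (complex_of_real ((2 * pi) ^ DIM('a) * heat s x)))"
    using has_bochner_integral_bounded_linear[OF bounded_linear_Re *] .
  then show ?thesis
    by (simp only: Re_complex_of_real) (simp add: Re_exp)
qed

lemma heat_pos: "0 < s \<Longrightarrow> 0 < heat s x"
  by (simp add: heat_def)

lemma measurable_heat [measurable (raw)]:
  fixes g :: "'b \<Rightarrow> 'a::euclidean_space"
  assumes [measurable]: "f \<in> borel_measurable M" "g \<in> borel_measurable M"
  shows "(\<lambda>x. heat (f x) (g x)) \<in> borel_measurable M"
  unfolding heat_def by measurable

lemma nn_integral_dilate:
  fixes f :: "'a::euclidean_space \<Rightarrow> ennreal"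
  assumes [measurable]: "f \<in> borel_measurable borel" and c: "0 < c"
  shows "(\<integral>\<^sup>+x. f x \<partial>lborel) = ennreal (c ^ DIM('a)) * (\<integral>\<^sup>+x. f (c *\<^sub>R x) \<partial>lborel)"
proof -
  have "(\<integral>\<^sup>+x. f x \<partial>lborel)
      = (\<integral>\<^sup>+x. f x \<partial>density (distr lborel borel (\<lambda>x::'a. 0 + c *\<^sub>R x)) (\<lambda>_. \<bar>c\<bar> ^ DIM('a)))"
    using lborel_affine[of c "0::'a"] c by simp
  also have "\<dots> = ennreal (c ^ DIM('a)) * (\<integral>\<^sup>+x. f (c *\<^sub>R x) \<partial>lborel)"
    using c by (simp add: nn_integral_density nn_integral_distr nn_integral_cmult)
  finally show ?thesis .
qed

lemma integral_dilate:
  fixes f :: "'a::euclidean_space \<Rightarrow> real"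
  assumes [measurable]: "f \<in> borel_measurable borel" and c: "0 < c"
  shows "(\<integral>x. f x \<partial>lborel) = c ^ DIM('a) * (\<integral>x. f (c *\<^sub>R x) \<partial>lborel)"
proof -
  have "(\<integral>x. f x \<partial>lborel)
      = (\<integral>x. f x \<partial>density (distr lborel borel (\<lambda>x::'a. 0 + c *\<^sub>R x)) (\<lambda>_. ennreal (\<bar>c\<bar> ^ DIM('a))))"
    using lborel_affine[of c "0::'a"] c by simp
  also have "\<dots> = c ^ DIM('a) * (\<integral>x. f (c *\<^sub>R x) \<partial>lborel)"
    using c by (simp add: integral_density integral_distr)
  finally show ?thesis .
qed

text \<open>exp (-|x|^2 / (4 s)) is a Gaussian of the form exp (-s' |x|^2) with s' = 1 / (4 s), so
  its integral is the Fourier formula for s' at frequency 0.\<close>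

lemma heat_total:
  assumes s: "0 < s"
  shows "integrable lborel (heat s :: 'a::euclidean_space \<Rightarrow> real)" "(\<integral>x. heat s (x::'a) \<partial>lborel) = 1"
proof -
  have *: "has_bochner_integral lborel (\<lambda>x::'a. exp (- (1 / (4 * s)) * (norm x)\<^sup>2)) ((2 * pi) ^ DIM('a) * heat (1 / (4 * s)) (0::'a))"
    using fourier_gaussian[of "1 / (4 * s)" "0::'a"] s by simp
  have "has_bochner_integral lborel (heat s :: 'a \<Rightarrow> real)
     ((4 * pi * s) powr (- real DIM('a) / 2) * ((2 * pi) ^ DIM('a) * heat (1 / (4 * s)) (0::'a)))"
    using has_bochner_integral_mult_right[OF *, of "(4 * pi * s) powr (- real DIM('a) / 2)"]
    by (simp add: heat_def[abs_def])
  also have "(4 * pi * s) powr (- real DIM('a) / 2) * ((2 * pi) ^ DIM('a) * heat (1 / (4 * s)) (0::'a)) = 1"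
  proof -
    have "(4 * pi * s) powr (- real DIM('a) / 2) * heat (1 / (4 * s)) (0::'a)
       = ((4 * pi * s) * (pi / s)) powr (- real DIM('a) / 2)"
      using s by (subst powr_mult) (auto simp: heat_def)
    also have "(4 * pi * s) * (pi / s) = (2 * pi) powr 2" using s by (simp add: power2_eq_square)
    also have "\<dots> powr (- real DIM('a) / 2) = inverse ((2 * pi) ^ DIM('a))"
      unfolding powr_powr by (simp add: powr_minus powr_realpow)
    finally have eq: "(4 * pi * s) powr (- real DIM('a) / 2) * heat (1 / (4 * s)) (0::'a) = inverse ((2 * pi) ^ DIM('a))" .
    have "(4 * pi * s) powr (- real DIM('a) / 2) * ((2 * pi) ^ DIM('a) * heat (1 / (4 * s)) (0::'a))
      = ((4 * pi * s) powr (- real DIM('a) / 2) * heat (1 / (4 * s)) (0::'a)) * (2 * pi) ^ DIM('a)"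
      by (simp only: ac_simps)
    also have "\<dots> = 1" unfolding eq by (rule left_inverse) simp
    finally show ?thesis .
  qed
  finally have *: "has_bochner_integral lborel (heat s :: 'a \<Rightarrow> real) 1" .
  from * show "integrable lborel (heat s :: 'a \<Rightarrow> real)" by (rule integrable.intros)
  from * show "(\<integral>x. heat s (x::'a) \<partial>lborel) = 1" by (rule has_bochner_integral_integral_eq)
qed

text \<open>The inequality y / m <= exp (y / m), raised to the power m.\<close>

lemma powr_mult_exp_neg_le:
  fixes m y :: real
  assumes m: "0 < m" and y: "0 \<le> y"
  shows "y powr m * exp (- y) \<le> m powr m"
proof -
  have "y / m \<le> exp (y / m)" using exp_ge_add_one_self[of "y / m"] by linarith
  then have "(y / m) powr m \<le> exp (y / m) powr m"
    using m y by (intro powr_mono2) auto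
  also have "\<dots> = exp y" using m by (simp add: powr_def)
  finally have "m powr m * (y / m) powr m \<le> m powr m * exp y" by (intro mult_left_mono) auto
  moreover have "m powr m * (y / m) powr m = y powr m"
    using m y by (simp flip: powr_mult)
  ultimately show ?thesis by (simp add: exp_minus field_simps)
qed

lemma nn_integral_Cauchy_density: "(\<integral>\<^sup>+x. ennreal (1 / (1 + x\<^sup>2)) \<partial>lborel) < \<infinity>"
proof -
  have "integrable lborel (\<lambda>x::real. 1 / (1 + x\<^sup>2))"
    using integrable_inverse_1_plus_square
    by (simp add: set_integrable_def einterval_def inverse_eq_divide)
  then show ?thesis by (simp add: integrable_iff_bounded)
qed

text \<open>In each of the d coordinates 1 + \<xi>_b^2 <= (1 + |\<xi>|)^2, so the integrand is
  dominated by a product of one-dimensional Cauchy profiles.\<close>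

lemma nn_integral_polynomial_decay:
  "(\<integral>\<^sup>+\<xi>. ennreal (1 / (1 + norm (\<xi>::'a::euclidean_space)) ^ (2 * DIM('a))) \<partial>lborel) < \<infinity>"
proof -
  have "(\<integral>\<^sup>+\<xi>. ennreal (1 / (1 + norm (\<xi>::'a)) ^ (2 * DIM('a))) \<partial>lborel)
     \<le> (\<integral>\<^sup>+\<xi>. (\<Prod>b\<in>(Basis::'a set). ennreal (1 / (1 + (\<xi> \<bullet> b)\<^sup>2))) \<partial>lborel)"
  proof (rule nn_integral_mono)
    fix \<xi> :: 'a
    have "(\<Prod>b\<in>(Basis::'a set). 1 + (\<xi> \<bullet> b)\<^sup>2) \<le> (\<Prod>b\<in>(Basis::'a set). (1 + norm \<xi>)\<^sup>2)"
    proof (intro prod_mono conjI)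
      fix b :: 'a assume "b \<in> Basis"
      then have "\<bar>\<xi> \<bullet> b\<bar>\<^sup>2 \<le> (norm \<xi>)\<^sup>2" by (intro power_mono Basis_le_norm) auto
      then show "1 + (\<xi> \<bullet> b)\<^sup>2 \<le> (1 + norm \<xi>)\<^sup>2"
        by (auto simp: power2_sum intro: add_increasing2)
    qed auto
    also have "\<dots> = (1 + norm \<xi>) ^ (2 * DIM('a))" by (simp add: power_mult)
    finally have "1 / (1 + norm \<xi>) ^ (2 * DIM('a)) \<le> 1 / (\<Prod>b\<in>(Basis::'a set). 1 + (\<xi> \<bullet> b)\<^sup>2)"
      by (intro divide_left_mono mult_pos_pos prod_pos zero_less_power) (auto intro: add_pos_nonneg)
    also have "\<dots> = (\<Prod>b\<in>(Basis::'a set). 1 / (1 + (\<xi> \<bullet> b)\<^sup>2))"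
      by (simp add: prod_dividef)
    finally show "ennreal (1 / (1 + norm \<xi>) ^ (2 * DIM('a))) \<le> (\<Prod>b\<in>Basis. ennreal (1 / (1 + (\<xi> \<bullet> b)\<^sup>2)))"
      by (subst prod_ennreal) (auto intro: ennreal_leI)
  qed
  also have "\<dots> = (\<Prod>b\<in>(Basis::'a set). \<integral>\<^sup>+x. ennreal (1 / (1 + x\<^sup>2)) \<partial>lborel)"
    by (rule nn_integral_lborel_prod) auto
  also have "\<dots> < \<infinity>"
    using nn_integral_Cauchy_density by (simp add: power_less_top_ennreal)
  finally show ?thesis .
qed

text \<open>The stretched exponential absorbs every power of |\<xi>|, in particular |\<xi>|^(2d+j),
  which leaves the integrable factor (1 + |\<xi>|)^(-2d).\<close>

lemma integrable_norm_stretched_exp: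
  fixes t g :: real
  assumes t: "0 < t" and g: "0 < g"
  shows "integrable lborel (\<lambda>\<xi>::'a::euclidean_space. norm \<xi> ^ j * exp (- t * norm \<xi> powr g))"
proof -
  define n where "n = 2 * DIM('a) + j"
  define m where "m = real n / g"
  have n: "0 < n" by (simp add: n_def)
  then have m: "0 < m" using g by (simp add: m_def)
  define C where "C = 2 ^ n * (1 + t powr (- m) * m powr m)"
  have le: "norm (norm \<xi> ^ j * exp (- t * norm \<xi> powr g)) \<le> norm (C * (1 / (1 + norm \<xi>) ^ (2 * DIM('a))))" for \<xi> :: 'a
  proof -
    define y where "y = norm \<xi>"
    have y: "0 \<le> y" by (simp add: y_def)
    have pw: "y ^ n * exp (- t * y powr g) \<le> t powr (- m) * m powr m"
    proof (cases "y = 0")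
      case True then show ?thesis using n by (simp add: zero_power)
    next
      case False
      then have "y ^ n = t powr (- m) * (t * y powr g) powr m"
        using t y g powr_realpow[of y n] by (simp add: powr_mult powr_powr m_def powr_minus)
      then show ?thesis
        using mult_left_mono[OF powr_mult_exp_neg_le[OF m, of "t * y powr g"], of "t powr (- m)"] t y
        by (simp add: mult.assoc)
    qed
    have "y ^ j * (1 + y) ^ (2 * DIM('a)) \<le> (1 + y) ^ n"
      unfolding n_def power_add using y by (subst mult.commute) (intro mult_left_mono power_mono; simp)
    also have "\<dots> \<le> (2 * max 1 y) ^ n" using y by (intro power_mono) auto
    also have "\<dots> = 2 ^ n * max 1 y ^ n" by (simp add: power_mult_distrib)
    also have "\<dots> \<le> 2 ^ n * (1 + y ^ n)" using y by (intro mult_left_mono) (auto simp: max_def)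
    finally have "y ^ j * (1 + y) ^ (2 * DIM('a)) * exp (- t * y powr g) \<le> 2 ^ n * (1 + y ^ n) * exp (- t * y powr g)"
      by (intro mult_right_mono) auto
    also have "\<dots> = 2 ^ n * (exp (- t * y powr g) + y ^ n * exp (- t * y powr g))" by (simp add: algebra_simps)
    also have "\<dots> \<le> C"
      unfolding C_def using pw t by (intro mult_left_mono add_mono) auto
    finally have "y ^ j * exp (- t * y powr g) \<le> C / (1 + y) ^ (2 * DIM('a))"
      using y by (subst pos_le_divide_eq) (auto simp: mult_ac)
    moreover have "0 \<le> C" by (auto simp: C_def)
    ultimately show ?thesis using y by (simp add: y_def)
  qed
  have "integrable lborel (\<lambda>\<xi>::'a. C * (1 / (1 + norm \<xi>) ^ (2 * DIM('a))))"
    using nn_integral_polynomial_decay[where 'a = 'a]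
    by (intro integrable_mult_right integrableI_nonneg) (auto simp: less_top)
  then show ?thesis
    by (rule Bochner_Integration.integrable_bound) (use le in auto)
qed

section \<open>Moment integrals and their scaling laws\<close>

lemma inverse_exp_moment_finite:
  assumes m: "0 < m"
  shows "(\<integral>\<^sup>+\<sigma>\<in>{0<..}. ennreal (\<sigma> powr (- 1 - m) * exp (- 1 / \<sigma>)) \<partial>lborel) < \<infinity>"
proof -
  define C where "C = (1 + m) powr (1 + m)"
  have "(\<integral>\<^sup>+\<sigma>\<in>{0<..}. ennreal (\<sigma> powr (- 1 - m) * exp (- 1 / \<sigma>)) \<partial>lborel)
    \<le> (\<integral>\<^sup>+\<sigma>. ennreal C * indicator {0..1} \<sigma> + ennreal (\<sigma> powr (- 1 - m)) * indicator {1..} \<sigma> \<partial>lborel)"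
  proof (intro nn_integral_mono)
    fix \<sigma> :: real
    have "\<sigma> powr (- 1 - m) * exp (- 1 / \<sigma>) \<le> C" if "0 < \<sigma>"
      using powr_mult_exp_neg_le[of "1 + m" "1 / \<sigma>"] m that
      by (simp add: C_def powr_divide powr_minus_divide[symmetric])
    moreover have "\<sigma> powr (- 1 - m) * exp (- 1 / \<sigma>) \<le> \<sigma> powr (- 1 - m)" if "0 < \<sigma>"
      using that by (intro mult_left_le) auto
    ultimately show "ennreal (\<sigma> powr (- 1 - m) * exp (- 1 / \<sigma>)) * indicator {0<..} \<sigma>
      \<le> ennreal C * indicator {0..1} \<sigma> + ennreal (\<sigma> powr (- 1 - m)) * indicator {1..} \<sigma>"
      by (cases "\<sigma> < 1") (auto split: split_indicator intro: ennreal_leI order_trans[OF ennreal_leI] simp: add_increasing)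
  qed
  also have "\<dots> = ennreal C + (\<integral>\<^sup>+\<sigma>. ennreal (\<sigma> powr (- 1 - m)) * indicator {1..} \<sigma> \<partial>lborel)"
    by (subst nn_integral_add) (auto simp: nn_integral_cmult_indicator)
  also have "(\<integral>\<^sup>+\<sigma>. ennreal (\<sigma> powr (- 1 - m)) * indicator {1..} \<sigma> \<partial>lborel) = ennreal (0 - (- (1 powr (- m)) / m))"
  proof (rule nn_integral_FTC_atLeast)
    show "((\<lambda>x. - (x powr (- m)) / m) has_real_derivative x powr (- 1 - m)) (at x)" if "1 \<le> x" for x
      using that m by (auto intro!: derivative_eq_intros simp: powr_diff powr_minus field_simps)
    show "((\<lambda>x. - (x powr (- m)) / m) \<longlongrightarrow> 0) at_top"
      using tendsto_divide[OF tendsto_minus[OF tendsto_neg_powr[OF _ filterlim_ident, of "- m"]] tendsto_const, of m] m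
      by simp
  qed auto
  finally show ?thesis by (rule order_le_less_trans) simp
qed

text \<open>For m > 0 this is Gamma m, by the substitution u = 1 / \<sigma>. It enters through
  finiteness, positivity and its scaling law.\<close>

definition inv_moment :: "real \<Rightarrow> real" where
  "inv_moment m = enn2real (\<integral>\<^sup>+\<sigma>\<in>{0<..}. ennreal (\<sigma> powr (- 1 - m) * exp (- 1 / \<sigma>)) \<partial>lborel)"

lemma inv_moment:
  assumes m: "0 < m" and b: "0 < b"
  shows "(\<integral>\<^sup>+\<sigma>\<in>{0<..}. ennreal (\<sigma> powr (- 1 - m) * exp (- b / \<sigma>)) \<partial>lborel) = ennreal (b powr (- m) * inv_moment m)"
proof -
  have J: "(\<integral>\<^sup>+\<sigma>\<in>{0<..}. ennreal (\<sigma> powr (- 1 - m) * exp (- 1 / \<sigma>)) \<partial>lborel) = ennreal (inv_moment m)"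
    unfolding inv_moment_def using inverse_exp_moment_finite[OF m] by simp
  have "(\<integral>\<^sup>+\<sigma>\<in>{0<..}. ennreal (\<sigma> powr (- 1 - m) * exp (- b / \<sigma>)) \<partial>lborel)
    = ennreal b * (\<integral>\<^sup>+\<sigma>. ennreal ((b * \<sigma>) powr (- 1 - m) * exp (- b / (b * \<sigma>))) * indicator {0<..} (b * \<sigma>) \<partial>lborel)"
    using nn_integral_dilate[of "\<lambda>\<sigma>. ennreal (\<sigma> powr (- 1 - m) * exp (- b / \<sigma>)) * indicator {0<..} \<sigma>" b] b
    by simp
  also have "(\<integral>\<^sup>+\<sigma>. ennreal ((b * \<sigma>) powr (- 1 - m) * exp (- b / (b * \<sigma>))) * indicator {0<..} (b * \<sigma>) \<partial>lborel)
    = (\<integral>\<^sup>+\<sigma>. ennreal (b powr (- 1 - m)) * (ennreal (\<sigma> powr (- 1 - m) * exp (- 1 / \<sigma>)) * indicator {0<..} \<sigma>) \<partial>lborel)"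
    using b by (intro nn_integral_cong)
       (auto simp: powr_mult zero_less_mult_iff mult.assoc split: split_indicator simp flip: ennreal_mult')
  also have "\<dots> = ennreal (b powr (- 1 - m)) * ennreal (inv_moment m)"
    unfolding J[symmetric] by (intro nn_integral_cmult) measurable
  also have "ennreal b * \<dots> = ennreal (b powr (- m) * inv_moment m)"
  proof -
    have "b * b powr (- 1 - m) = b powr (- m)" using b by (simp add: powr_diff powr_minus field_simps)
    moreover have "0 \<le> inv_moment m" by (simp add: inv_moment_def)
    ultimately show ?thesis using b by (simp flip: ennreal_mult mult.assoc)
  qed
  finally show ?thesis .
qed

lemma inv_moment_pos:
  assumes m: "0 < m"
  shows "0 < inv_moment m"
proof -
  let ?J = "\<integral>\<^sup>+\<sigma>\<in>{0<..}. ennreal (\<sigma> powr (- 1 - m) * exp (- 1 / \<sigma>)) \<partial>lborel"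
  have le: "(\<integral>\<^sup>+\<sigma>. ennreal (2 powr (- 1 - m) * exp (- 1)) * indicator {1..2::real} \<sigma> \<partial>lborel) \<le> ?J"
  proof (intro nn_integral_mono)
    fix \<sigma> :: real
    have "2 powr (- 1 - m) * exp (- 1) \<le> \<sigma> powr (- 1 - m) * exp (- 1 / \<sigma>)" if "1 \<le> \<sigma>" "\<sigma> \<le> 2"
      using that m by (intro mult_mono powr_mono2') auto
    then show "ennreal (2 powr (- 1 - m) * exp (- 1)) * indicator {1..2::real} \<sigma>
      \<le> ennreal (\<sigma> powr (- 1 - m) * exp (- 1 / \<sigma>)) * indicator {0<..} \<sigma>"
      by (auto split: split_indicator intro: ennreal_leI)
  qed
  have eq: "(\<integral>\<^sup>+\<sigma>. ennreal (2 powr (- 1 - m) * exp (- 1)) * indicator {1..2::real} \<sigma> \<partial>lborel)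
     = ennreal (2 powr (- 1 - m) * exp (- 1))"
    by (subst nn_integral_cmult_indicator) auto
  have "0 < ennreal (2 powr (- 1 - m) * exp (- 1))" by simp
  also have "\<dots> \<le> ?J" using le unfolding eq .
  finally have "0 < ?J" .
  then show ?thesis
    unfolding inv_moment_def using inverse_exp_moment_finite[OF m]
    by (simp add: enn2real_positive_iff)
qed

text \<open>For m > 0 this is Gamma ((m + 1) / 2) / 2.\<close>

definition gauss_moment :: "real \<Rightarrow> real" where
  "gauss_moment m = enn2real (\<integral>\<^sup>+v\<in>{0<..}. ennreal (v powr m * exp (- v\<^sup>2)) \<partial>lborel)"

lemma gauss_moment:
  assumes m: "0 < m" and \<sigma>: "0 < \<sigma>"
  shows "(\<integral>\<^sup>+v\<in>{0<..}. ennreal (v powr m * exp (- \<sigma> * v\<^sup>2)) \<partial>lborel)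
    = ennreal (\<sigma> powr (- (m + 1) / 2) * gauss_moment m)"
proof -
  define C where "C = (m/2) powr (m/2) + (m/2 + 1) powr (m/2 + 1)"
  have "(\<integral>\<^sup>+v\<in>{0<..}. ennreal (v powr m * exp (- v\<^sup>2)) \<partial>lborel)
     \<le> (\<integral>\<^sup>+v. ennreal C * ennreal (1 / (1 + v\<^sup>2)) \<partial>lborel)"
  proof (intro nn_integral_mono)
    fix v :: real
    have "v powr m * exp (- v\<^sup>2) \<le> C * (1 / (1 + v\<^sup>2))" if "0 < v"
    proof -
      have 1: "v powr m = (v\<^sup>2) powr (m/2)" "v\<^sup>2 * v powr m = (v\<^sup>2) powr (m/2 + 1)"
        using that power2_powr_half[of v m] by (auto simp: powr_add)
      have "(1 + v\<^sup>2) * (v powr m * exp (- v\<^sup>2)) = v powr m * exp (- v\<^sup>2) + (v\<^sup>2 * v powr m) * exp (- v\<^sup>2)"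
        by (simp add: algebra_simps)
      also have "\<dots> \<le> C" unfolding C_def 1(2) unfolding 1(1)
        using m by (intro add_mono powr_mult_exp_neg_le) auto
      finally show ?thesis by (simp add: pos_le_divide_eq add_pos_nonneg mult.commute)
    qed
    moreover have "0 \<le> C" by (simp add: C_def)
    ultimately show "ennreal (v powr m * exp (- v\<^sup>2)) * indicator {0<..} v \<le> ennreal C * ennreal (1 / (1 + v\<^sup>2))"
      by (auto split: split_indicator simp flip: ennreal_mult intro!: ennreal_leI)
  qed
  also have "\<dots> < \<infinity>"
    using nn_integral_Cauchy_density by (subst nn_integral_cmult) (auto simp: ennreal_mult_less_top)
  finally have J: "(\<integral>\<^sup>+v\<in>{0<..}. ennreal (v powr m * exp (- v\<^sup>2)) \<partial>lborel) = ennreal (gauss_moment m)"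
    by (simp add: gauss_moment_def)
  define b where "b = \<sigma> powr (- 1/2)"
  have b: "0 < b" using \<sigma> by (simp add: b_def)
  have "b\<^sup>2 = b powr 2" using b by simp
  also have "\<dots> = inverse \<sigma>" unfolding b_def powr_powr using \<sigma> by (simp add: powr_minus)
  finally have b2: "\<sigma> * b\<^sup>2 = 1" using \<sigma> by simp
  have "(\<integral>\<^sup>+v\<in>{0<..}. ennreal (v powr m * exp (- \<sigma> * v\<^sup>2)) \<partial>lborel)
    = ennreal b * (\<integral>\<^sup>+v. ennreal ((b * v) powr m * exp (- \<sigma> * (b * v)\<^sup>2)) * indicator {0<..} (b * v) \<partial>lborel)"
    using nn_integral_dilate[of "\<lambda>v. ennreal (v powr m * exp (- \<sigma> * v\<^sup>2)) * indicator {0<..} v" b] b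
    by simp
  also have "(\<integral>\<^sup>+v. ennreal ((b * v) powr m * exp (- \<sigma> * (b * v)\<^sup>2)) * indicator {0<..} (b * v) \<partial>lborel)
    = (\<integral>\<^sup>+v. ennreal (b powr m) * (ennreal (v powr m * exp (- v\<^sup>2)) * indicator {0<..} v) \<partial>lborel)"
  proof (intro nn_integral_cong)
    fix v :: real
    have "\<sigma> * (b * v)\<^sup>2 = v\<^sup>2" using b2 by (simp add: power_mult_distrib mult.assoc[symmetric])
    then show "ennreal ((b * v) powr m * exp (- \<sigma> * (b * v)\<^sup>2)) * indicator {0<..} (b * v)
      = ennreal (b powr m) * (ennreal (v powr m * exp (- v\<^sup>2)) * indicator {0<..} v)"
      using b by (auto simp: powr_mult zero_less_mult_iff mult.assoc split: split_indicator simp flip: ennreal_mult')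
  qed
  also have "\<dots> = ennreal (b powr m) * ennreal (gauss_moment m)"
    unfolding J[symmetric] by (intro nn_integral_cmult) measurable
  also have "ennreal b * \<dots> = ennreal (\<sigma> powr (- (m + 1) / 2) * gauss_moment m)"
  proof -
    have "b * b powr m = \<sigma> powr (- (m + 1) / 2)"
    proof -
      have "b * b powr m = b powr (1 + m)" using b by (simp add: powr_add)
      also have "\<dots> = \<sigma> powr (- (m + 1) / 2)"
        unfolding b_def powr_powr by (rule arg_cong[where f = "\<lambda>x. \<sigma> powr x"]) (simp add: field_simps)
      finally show ?thesis .
    qed
    moreover have "0 \<le> gauss_moment m" by (simp add: gauss_moment_def)
    ultimately show ?thesis using b by (simp flip: ennreal_mult mult.assoc)
  qed
  finally show ?thesis .
qed

lemma gauss_moment_pos: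
  assumes m: "0 < m"
  shows "0 < gauss_moment m"
proof -
  let ?J = "\<integral>\<^sup>+v\<in>{0<..}. ennreal (v powr m * exp (- v\<^sup>2)) \<partial>lborel"
  have fin: "?J = ennreal (gauss_moment m)" using gauss_moment[OF m, of 1] by simp
  have "(\<integral>\<^sup>+v. ennreal (exp (- 4)) * indicator {1..2::real} v \<partial>lborel) \<le> ?J"
  proof (intro nn_integral_mono)
    fix v :: real
    have "exp (- 4) \<le> v powr m * exp (- v\<^sup>2)" if "1 \<le> v" "v \<le> 2"
    proof -
      have "1 \<le> v powr m" using that m by (simp add: ge_one_powr_ge_zero)
      moreover have "v\<^sup>2 \<le> 2\<^sup>2" using that by (intro power_mono) auto
      ultimately have "1 * exp (- 4) \<le> v powr m * exp (- v\<^sup>2)" by (intro mult_mono) auto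
      then show ?thesis by simp
    qed
    then show "ennreal (exp (- 4)) * indicator {1..2::real} v
      \<le> ennreal (v powr m * exp (- v\<^sup>2)) * indicator {0<..} v"
      by (auto split: split_indicator intro: ennreal_leI)
  qed
  then have "ennreal (exp (- 4)) \<le> ennreal (gauss_moment m)"
    unfolding fin by (subst (asm) nn_integral_cmult_indicator) auto
  moreover have "\<not> ennreal (exp (- 4)) \<le> 0" by simp
  ultimately show ?thesis by (cases "gauss_moment m \<le> 0") (auto simp: ennreal_neg)
qed

section \<open>A Stieltjes representation of the stretched exponential\<close>

text \<open>The cut of the principal power meets the closed right half-plane at the origin only, and
  there |z^g| = |z|^g tends to 0.\<close>

lemma continuous_on_stretched_exp_half_plane:
  assumes g: "0 < g"
  shows "continuous_on {z. 0 \<le> Re z} (\<lambda>z. exp (- (z powr complex_of_real g)))"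
proof -
  have "continuous (at z within {z. 0 \<le> Re z}) (\<lambda>z. z powr complex_of_real g)" if z: "0 \<le> Re z" for z
  proof (cases "z = 0")
    case True
    have "((\<lambda>z. norm z powr g) \<longlongrightarrow> norm (0::complex) powr g) (at 0 within {z. 0 \<le> Re z})"
      using g by (intro tendsto_powr' tendsto_intros) auto
    then have "((\<lambda>z. norm (z powr complex_of_real g)) \<longlongrightarrow> 0) (at 0 within {z. 0 \<le> Re z})"
      using g by (simp add: norm_powr_real_powr')
    then have "((\<lambda>z. z powr complex_of_real g) \<longlongrightarrow> 0) (at 0 within {z. 0 \<le> Re z})"
      by (rule tendsto_norm_zero_cancel)
    then show ?thesis using True by (simp add: continuous_within)
  next
    case False
    then have "z \<notin> \<real>\<^sub>\<le>\<^sub>0" using z by (auto simp: complex_nonpos_Reals_iff complex_eq_iff)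
    then have "continuous (at z) (\<lambda>z. z powr complex_of_real g)"
      by (intro continuous_powr_complex continuous_intros) auto
    then show ?thesis by (rule continuous_at_imp_continuous_at_within)
  qed
  then have "continuous_on {z. 0 \<le> Re z} (\<lambda>z. z powr complex_of_real g)"
    by (simp add: continuous_on_eq_continuous_within)
  then show ?thesis by (intro continuous_on_exp continuous_on_minus)
qed

text \<open>Re (z^g) = |z|^g cos (g arg z) with |arg z| <= pi/2, and g < 1 keeps the cosine at or
  above cos (pi g / 2) > 0. This is the decay that permits closing a contour in the
  half-plane.\<close>

lemma norm_stretched_exp_le:
  assumes g: "0 < g" "g < 1" and z: "0 \<le> Re z"
  shows "norm (exp (- (z powr complex_of_real g))) \<le> exp (- (cos (pi * g / 2) * norm z powr g))"
proof (cases "z = 0")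
  case False
  have "\<bar>g * Im (Ln z)\<bar> \<le> pi * g / 2"
    using Re_Ln_pos_le[OF False] z g mult_left_mono[of "\<bar>Im (Ln z)\<bar>" "pi / 2" g] by (simp add: abs_mult)
  moreover have "pi * g / 2 \<le> pi" using g pi_gt_zero by simp
  ultimately have "cos (pi * g / 2) \<le> cos \<bar>g * Im (Ln z)\<bar>"
    by (intro cos_monotone_0_pi_le) auto
  then have "cos (pi * g / 2) \<le> cos (g * Im (Ln z))" by (simp add: abs_if split: if_splits)
  moreover have "Re (z powr complex_of_real g) = norm z powr g * cos (g * Im (Ln z))"
    using False by (simp add: powr_def Re_exp)
  ultimately show ?thesis
    by (simp add: mult.commute mult_left_mono)
qed simp

text \<open>The points i v and -i v have arguments pi/2 and -pi/2, so their g-th powers have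
  arguments pi g / 2 and -pi g / 2; the two boundary values are complex conjugates.\<close>

lemma stretched_exp_imaginary:
  assumes g: "0 < g" "g < 1" and v: "0 < v"
  shows "exp (- ((\<i> * complex_of_real v) powr complex_of_real g))
    = complex_of_real (exp (- (cos (pi * g / 2) * v powr g))) * cis (- (sin (pi * g / 2) * v powr g))"
    and "exp (- ((- (\<i> * complex_of_real v)) powr complex_of_real g))
    = complex_of_real (exp (- (cos (pi * g / 2) * v powr g))) * cis (sin (pi * g / 2) * v powr g)"
proof -
  have 1: "Ln (\<i> * complex_of_real v) = complex_of_real (ln v) + \<i> * complex_of_real (pi / 2)"
    using v by (subst mult.commute, subst Ln_times_of_real) (auto simp: Ln_of_real)
  have 2: "Ln (- (\<i> * complex_of_real v)) = complex_of_real (ln v) - \<i> * complex_of_real (pi / 2)"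
    using v Ln_times_of_real[of v "- \<i>"] by (simp add: mult.commute Ln_of_real)
  have "(\<i> * complex_of_real v) powr complex_of_real g = complex_of_real (v powr g) * cis (pi * g / 2)"
    using v 1 by (simp add: powr_def exp_add cis_conv_exp algebra_simps flip: exp_of_real)
  then have "- ((\<i> * complex_of_real v) powr complex_of_real g)
      = complex_of_real (- (cos (pi * g / 2) * v powr g)) + \<i> * complex_of_real (- (sin (pi * g / 2) * v powr g))"
    by (simp add: complex_eq_iff cis.ctr)
  then show "exp (- ((\<i> * complex_of_real v) powr complex_of_real g))
    = complex_of_real (exp (- (cos (pi * g / 2) * v powr g))) * cis (- (sin (pi * g / 2) * v powr g))"
    by (simp only: exp_add cis_conv_exp exp_of_real)
  have "(- (\<i> * complex_of_real v)) powr complex_of_real g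
     = exp (complex_of_real g * (complex_of_real (ln v) - \<i> * complex_of_real (pi / 2)))"
    using v by (simp add: powr_def 2)
  also have "complex_of_real g * (complex_of_real (ln v) - \<i> * complex_of_real (pi / 2))
     = complex_of_real (g * ln v) + \<i> * complex_of_real (- (pi * g / 2))"
    by (simp add: algebra_simps)
  also have "exp \<dots> = complex_of_real (v powr g) * cis (- (pi * g / 2))"
    using v by (simp only: exp_add cis_conv_exp exp_of_real powr_def) simp
  finally have "(- (\<i> * complex_of_real v)) powr complex_of_real g = complex_of_real (v powr g) * cis (- (pi * g / 2))" .
  then have "- ((- (\<i> * complex_of_real v)) powr complex_of_real g)
      = complex_of_real (- (cos (pi * g / 2) * v powr g)) + \<i> * complex_of_real (sin (pi * g / 2) * v powr g)"
    by (simp add: complex_eq_iff cis.ctr)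
  then show "exp (- ((- (\<i> * complex_of_real v)) powr complex_of_real g))
    = complex_of_real (exp (- (cos (pi * g / 2) * v powr g))) * cis (sin (pi * g / 2) * v powr g)"
    by (simp only: exp_add cis_conv_exp exp_of_real)
qed

text \<open>Cauchy's theorem for F(z) 2 z / (z^2 - \<rho>^2) on the triangle with vertices -i R, i
  R, R. The zero of F removes the pole at \<rho>, and the pole at -\<rho> lies outside. On the
  slanted sides the rational factor is O(1/R) and the length is O(R), so they contribute O(b (R /
  2)). On the imaginary axis the factor becomes the real kernel 2 v / (v^2 + \<rho>^2).\<close>

lemma half_plane_symmetric_integral_tendsto:
  fixes F :: "complex \<Rightarrow> complex"
  assumes cont: "continuous_on {z. 0 \<le> Re z} F"
    and hol: "F holomorphic_on {z. 0 < Re z}"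
    and decay: "\<And>z. 0 \<le> Re z \<Longrightarrow> norm (F z) \<le> b (norm z)"
    and b: "antimono_on {1..} b" "(b \<longlongrightarrow> 0) at_top"
    and zero: "F (complex_of_real \<rho>) = 0" and \<rho>: "0 < \<rho>"
  shows "((\<lambda>R. integral {-R..R} (\<lambda>v. F (\<i> * complex_of_real v) * complex_of_real (2 * v / (v\<^sup>2 + \<rho>\<^sup>2)))) \<longlongrightarrow> 0) at_top"
proof -
  let ?r = "complex_of_real \<rho>"
  \<comment> \<open>The quotient is filled in at \<rho> by the derivative and is continuous there;
    continuity at a finite exceptional set is all that the cofinite form of Cauchy's theorem
    asks.\<close>
  define f where "f z = (if z = ?r then deriv F ?r else F z / (z - ?r)) * (2 * z / (z + ?r))" for z
  have Fd: "(F has_field_derivative deriv F z) (at z)" if "0 < Re z" for z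
    using hol that by (intro holomorphic_derivI[OF hol]) (auto intro: open_halfspace_Re_gt)
  have nz: "z + ?r \<noteq> 0" if "0 \<le> Re z" for z
    using that \<rho> by (auto simp: complex_eq_iff)
  have "continuous (at z within {z. 0 \<le> Re z}) (\<lambda>z. if z = ?r then deriv F ?r else F z / (z - ?r))"
    if z: "0 \<le> Re z" for z
  proof (cases "z = ?r")
    case True
    have "((\<lambda>y. (F y - F ?r) / (y - ?r)) \<longlongrightarrow> deriv F ?r) (at ?r)"
      using Fd[of ?r] \<rho> by (simp add: has_field_derivative_iff)
    then have "((\<lambda>y. if y = ?r then deriv F ?r else F y / (y - ?r)) \<longlongrightarrow> deriv F ?r) (at ?r)"
      by (rule Lim_transform_eventually) (auto simp: zero eventually_at_filter)
    then have "continuous (at ?r) (\<lambda>y. if y = ?r then deriv F ?r else F y / (y - ?r))"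
      by (simp add: isCont_def)
    then show ?thesis unfolding True by (rule continuous_at_imp_continuous_at_within)
  next
    case False
    have "continuous (at z within {z. 0 \<le> Re z}) (\<lambda>z. F z / (z - ?r))"
      using cont z False by (intro continuous_intros) (auto simp: continuous_on_eq_continuous_within)
    moreover have "\<forall>\<^sub>F y in at z within {z. 0 \<le> Re z}. F y / (y - ?r) = (if y = ?r then deriv F ?r else F y / (y - ?r))"
      using False by (intro eventually_mono[OF eventually_neq_at_within[of ?r z]]) auto
    ultimately show ?thesis using False
      unfolding continuous_within by (auto intro: Lim_transform_eventually)
  qed
  then have contf: "continuous_on {z. 0 \<le> Re z} f"
    unfolding f_def using nz by (intro continuous_intros) (auto simp: continuous_on_eq_continuous_within)
  have diff: "f field_differentiable at z" if "0 < Re z" "z \<noteq> ?r" for z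
  proof -
    have "(\<lambda>z. F z / (z - ?r) * (2 * z / (z + ?r))) field_differentiable at z"
      using Fd[OF that(1)] nz[of z] that
      by (intro derivative_intros field_differentiable_divide field_differentiable_mult)
         (auto simp: field_differentiable_def)
    then obtain D where D: "((\<lambda>z. F z / (z - ?r) * (2 * z / (z + ?r))) has_field_derivative D) (at z)"
      by (auto simp: field_differentiable_def)
    have "(f has_field_derivative D) (at z)"
      by (rule has_field_derivative_transform_within_open[OF D, of "- {?r}"]) (use that in \<open>auto simp: f_def\<close>)
    then show ?thesis by (auto simp: field_differentiable_def)
  qed
  have bound: "norm (integral {-R..R} (\<lambda>v. F (\<i> * complex_of_real v) * complex_of_real (2 * v / (v\<^sup>2 + \<rho>\<^sup>2)))) \<le> 64 * b (R / 2)"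
    if R: "2 \<le> R" "4 * \<rho> \<le> R" for R
  proof -
    define a0 a1 a2 where "a0 = - (\<i> * complex_of_real R)" and "a1 = \<i> * complex_of_real R" and "a2 = complex_of_real R"
    have hull: "convex hull {a0, a1, a2} \<subseteq> {z. 0 \<le> Re z}"
      using R by (intro hull_minimal convex_halfspace_Re_ge) (auto simp: a0_def a1_def a2_def)
    have seg: "closed_segment u w \<subseteq> {z. 0 \<le> Re z}" if "u \<in> {a0, a1, a2}" "w \<in> {a0, a1, a2}" for u w
      using that R by (intro closed_segment_subset convex_halfspace_Re_ge) (auto simp: a0_def a1_def a2_def)
    have int: "interior (convex hull {a0, a1, a2}) \<subseteq> {z. 0 < Re z}"
    proof -
      have "interior {z. 0 \<le> Re z} = {z. 0 < Re z}"
        using interior_halfspace_ge[of "1::complex" 0] by simp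
      then show ?thesis using interior_mono[OF hull] by simp
    qed
    have "(f has_contour_integral 0) (linepath a0 a1 +++ linepath a1 a2 +++ linepath a2 a0)"
      by (rule Cauchy_theorem_triangle_cofinite[of _ _ _ _ "{?r}"])
         (use contf continuous_on_subset hull int diff in auto)
    then have ci0: "contour_integral (linepath a0 a1 +++ linepath a1 a2 +++ linepath a2 a0) f = 0"
      by (rule contour_integral_unique)
    have cint: "f contour_integrable_on linepath u w" if "u \<in> {a0, a1, a2}" "w \<in> {a0, a1, a2}" for u w
      by (rule contour_integrable_continuous_linepath) (rule continuous_on_subset[OF contf seg[OF that]])
    have sum0: "contour_integral (linepath a0 a1) f + (contour_integral (linepath a1 a2) f + contour_integral (linepath a2 a0) f) = 0"
      using ci0 cint by (simp add: contour_integral_join contour_integrable_joinI valid_path_join)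
    \<comment> \<open>With |z| >= R/2 and R >= 4 \<rho> one has \<rho> <= |z|/2, so that |z -
      \<rho>| and |z + \<rho>| are both at least |z|/2.\<close>
    have fb: "norm (f z) \<le> b (R / 2) * (16 / R)" if z: "0 \<le> Re z" "R / 2 \<le> norm z" for z
    proof -
      have nr: "\<rho> \<le> norm z / 2" using z R by linarith
      have zr: "z \<noteq> ?r" using nr \<rho> by auto
      have 1: "norm z / 2 \<le> norm (z - ?r)" "norm z / 2 \<le> norm (z + ?r)"
        using norm_triangle_ineq2[of z ?r] norm_diff_ineq[of z ?r] nr \<rho> by auto
      have zpos: "0 < norm z" using z R by linarith
      have b0: "norm (F z) \<le> b (R / 2)"
      proof -
        have "b (norm z) \<le> b (R / 2)" using b(1) z(2) R by (auto simp: monotone_on_def)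
        then show ?thesis using decay[OF z(1)] by linarith
      qed
      have "norm (f z) = norm (F z) / norm (z - ?r) * (2 * norm z / norm (z + ?r))"
        using zr by (simp add: f_def norm_mult norm_divide)
      also have "\<dots> \<le> b (R / 2) / (norm z / 2) * (2 * norm z / (norm z / 2))"
        using b0 1 zpos order_trans[OF norm_ge_zero b0] by (intro mult_mono frac_le) auto
      also have "\<dots> = b (R / 2) * (8 / norm z)" using zpos by (simp add: field_simps)
      also have "\<dots> \<le> b (R / 2) * (16 / R)"
        using order_trans[OF norm_ge_zero b0] z(2) R zpos
        by (intro mult_left_mono) (auto simp: field_simps)
      finally show ?thesis .
    qed
    have far: "R / 2 \<le> norm z" if z: "z \<in> closed_segment u a2" "u = a0 \<or> u = a1" for z u
    proof -
      obtain t where t: "0 \<le> t" "t \<le> 1" "z = (1 - t) *\<^sub>R u + t *\<^sub>R a2"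
        using z(1) by (auto simp: closed_segment_def)
      have "Re z = t * R" "\<bar>Im z\<bar> = (1 - t) * R"
        using t z(2) R by (auto simp: a0_def a1_def a2_def abs_mult)
      then have "R \<le> 2 * norm z"
        using abs_Re_le_cmod[of z] abs_Im_le_cmod[of z] by (simp add: algebra_simps)
      then show ?thesis by simp
    qed
    have bpos: "0 \<le> b (R / 2)"
      using order_trans[OF norm_ge_zero decay[of "complex_of_real (R/2)"]] R by simp
    have len: "norm (a2 - u) \<le> 2 * R" "norm (u - a2) \<le> 2 * R" if "u = a0 \<or> u = a1" for u
      using that R norm_triangle_ineq4[of a2 u] norm_triangle_ineq4[of u a2]
      by (auto simp: a0_def a1_def a2_def norm_mult)
    have fs: "norm (f z) \<le> b (R / 2) * (16 / R)" if "z \<in> closed_segment u a2" "u = a0 \<or> u = a1" for z u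
      using fb[OF _ far[OF that]] seg[of u a2] that by auto
    have c1: "norm (contour_integral (linepath a1 a2) f) \<le> 32 * b (R / 2)"
    proof -
      have "norm (contour_integral (linepath a1 a2) f) \<le> b (R / 2) * (16 / R) * norm (a2 - a1)"
        using bpos R by (intro contour_integral_bound_linepath cint fs[of _ a1]) auto
      also have "\<dots> \<le> b (R / 2) * (16 / R) * (2 * R)"
        using bpos R len by (intro mult_left_mono) auto
      finally show ?thesis using R by simp
    qed
    have c2: "norm (contour_integral (linepath a2 a0) f) \<le> 32 * b (R / 2)"
    proof -
      have "norm (contour_integral (linepath a2 a0) f) \<le> b (R / 2) * (16 / R) * norm (a0 - a2)"
        using bpos R by (intro contour_integral_bound_linepath cint fs[of _ a0])
          (auto simp: closed_segment_commute)
      also have "\<dots> \<le> b (R / 2) * (16 / R) * (2 * R)"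
        using bpos R len by (intro mult_left_mono) auto
      finally show ?thesis using R by simp
    qed
    have eqf: "f (\<i> * complex_of_real v) * \<i> = F (\<i> * complex_of_real v) * complex_of_real (2 * v / (v\<^sup>2 + \<rho>\<^sup>2))" for v
    proof -
      have ne: "\<i> * complex_of_real v \<noteq> ?r" using \<rho> by (auto simp: complex_eq_iff)
      have pos: "v\<^sup>2 + \<rho>\<^sup>2 \<noteq> 0" using \<rho> by (simp add: sum_power2_eq_zero_iff)
      have "(\<i> * complex_of_real v - ?r) * (\<i> * complex_of_real v + ?r) = - complex_of_real (v\<^sup>2 + \<rho>\<^sup>2)"
        by (simp add: algebra_simps power2_eq_square)
      then have "f (\<i> * complex_of_real v) * \<i> = F (\<i> * complex_of_real v) * (2 * (\<i> * complex_of_real v) * \<i>) / (- complex_of_real (v\<^sup>2 + \<rho>\<^sup>2))"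
        using ne unfolding f_def by (simp flip: times_divide_times_eq)
      also have "2 * (\<i> * complex_of_real v) * \<i> = - complex_of_real (2 * v)" by simp
      finally show ?thesis by (simp del: of_real_add of_real_power)
    qed
    define I where "I = integral {-R..R} (\<lambda>v. F (\<i> * complex_of_real v) * complex_of_real (2 * v / (v\<^sup>2 + \<rho>\<^sup>2)))"
    have "continuous_on {-R..R} (\<lambda>v. f (\<i> * complex_of_real v) * \<i>)"
      by (intro continuous_intros continuous_on_compose2[OF contf]) auto
    then have "((\<lambda>v. f (\<i> * complex_of_real v) * \<i>) has_integral I) {-R..R}"
      unfolding I_def eqf by (intro integrable_integral integrable_continuous_interval)
    \<comment> \<open>The affine map x -> 2 R x - R carries the unit interval, over which
      \<open>linepath\<close> is parametrized, onto [-R, R].\<close>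
    then have "((\<lambda>x. f (\<i> * complex_of_real ((2 * R) *\<^sub>R x + (- R))) * \<i>) has_integral (I /\<^sub>R (2 * R) ^ DIM(real)))
       (cbox ((- R - (- R)) /\<^sub>R (2 * R)) ((R - (- R)) /\<^sub>R (2 * R)))"
      using R by (intro has_integral_affinity') auto
    moreover have "cbox ((- R - (- R)) /\<^sub>R (2 * R)) ((R - (- R)) /\<^sub>R (2 * R)) = {0..1}"
      using R by simp
    moreover have "I /\<^sub>R (2 * R) ^ DIM(real) = I / complex_of_real (2 * R)"
    proof -
      have "I /\<^sub>R (2 * R) ^ DIM(real) = complex_of_real (inverse (2 * R)) * I"
        unfolding DIM_real power_one_right scaleR_conv_of_real ..
      also have "\<dots> = I / complex_of_real (2 * R)"
        unfolding of_real_inverse divide_inverse by (rule mult.commute)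
      finally show ?thesis .
    qed
    moreover have "(2 * R) *\<^sub>R x + (- R) = 2 * R * x - R" for x by simp
    ultimately have "((\<lambda>x. f (\<i> * complex_of_real (2 * R * x - R)) * \<i>) has_integral (I / complex_of_real (2 * R))) {0..1}"
      by (simp only:)
    from has_integral_mult_left[OF this, of "complex_of_real (2 * R)"]
    have "((\<lambda>x. f (\<i> * complex_of_real (2 * R * x - R)) * \<i> * complex_of_real (2 * R)) has_integral I) {0..1}"
      using R by simp
    also have "(\<lambda>x. f (\<i> * complex_of_real (2 * R * x - R)) * \<i> * complex_of_real (2 * R)) = (\<lambda>x. f (linepath a0 a1 x) * (a1 - a0))"
    proof
      fix x
      have "linepath a0 a1 x = \<i> * complex_of_real (2 * R * x - R)" "a1 - a0 = \<i> * complex_of_real (2 * R)"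
        by (auto simp: linepath_def a0_def a1_def scaleR_conv_of_real algebra_simps)
      then show "f (\<i> * complex_of_real (2 * R * x - R)) * \<i> * complex_of_real (2 * R) = f (linepath a0 a1 x) * (a1 - a0)"
        by (simp add: mult.assoc)
    qed
    finally have "(f has_contour_integral I) (linepath a0 a1)"
      by (simp add: has_contour_integral_linepath)
    then have "contour_integral (linepath a0 a1) f = I" by (rule contour_integral_unique)
    then have "I = - (contour_integral (linepath a1 a2) f + contour_integral (linepath a2 a0) f)"
      using sum0 by (simp only: eq_neg_iff_add_eq_0)
    then have "norm I = norm (contour_integral (linepath a1 a2) f + contour_integral (linepath a2 a0) f)"
      by (simp only: norm_minus_cancel)
    then have "norm I \<le> 32 * b (R / 2) + 32 * b (R / 2)"
      using c1 c2 norm_triangle_ineq[of "contour_integral (linepath a1 a2) f" "contour_integral (linepath a2 a0) f"] by linarith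
    then show ?thesis by (simp add: I_def)
  qed
  have "filterlim (\<lambda>R::real. R / 2) at_top at_top" by real_asymp
  then have "((\<lambda>R. 64 * b (R / 2)) \<longlongrightarrow> 64 * 0) at_top"
    by (intro tendsto_mult tendsto_const filterlim_compose[OF b(2)])
  then have lim: "((\<lambda>R. 64 * b (R / 2)) \<longlongrightarrow> 0) at_top" by simp
  show ?thesis
  proof (rule Lim_null_comparison[OF _ lim])
    show "\<forall>\<^sub>F R in at_top. norm (integral {-R..R} (\<lambda>v. F (\<i> * complex_of_real v) * complex_of_real (2 * v / (v\<^sup>2 + \<rho>\<^sup>2)))) \<le> 64 * b (R / 2)"
      using eventually_ge_at_top[of "max 2 (4 * \<rho>)"] by eventually_elim (use bound in auto)
  qed
qed

text \<open>For v > 0 this is minus the imaginary part of exp (-(i v)^g), the boundary value on the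
  upper half of the imaginary axis.\<close>

definition osc :: "real \<Rightarrow> real \<Rightarrow> real" where
  "osc g v = exp (- (cos (pi * g / 2) * v powr g)) * sin (sin (pi * g / 2) * v powr g)"

lemma cos_pos_sin_bounds:
  assumes "0 < g" "g < 1"
  shows "0 < cos (pi * g / 2)" "cos (pi * g / 2) \<le> 1" "0 < sin (pi * g / 2)" "sin (pi * g / 2) \<le> 1"
proof -
  have "0 < pi * g / 2" "pi * g / 2 < pi / 2" using assms by auto
  then show "0 < cos (pi * g / 2)" "0 < sin (pi * g / 2)"
    by (auto intro!: cos_gt_zero sin_gt_zero2)
qed auto

text \<open>The first and third bounds describe v near 0, which decides the behaviour of
  \<open>theta\<close> at infinity; the second gives integrability for large v.\<close>

lemma osc_bounds:
  assumes g: "0 < g" "g < 1"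
  shows "\<bar>osc g v\<bar> \<le> v powr g"
    and "\<bar>osc g v\<bar> \<le> exp (- (cos (pi * g / 2) * v powr g))"
    and "sin (pi * g / 2) * v powr g - 2 * v powr (2 * g) \<le> osc g v"
proof -
  define c s y where "c = cos (pi * g / 2)" and "s = sin (pi * g / 2)" and "y = v powr g"
  have cs: "0 < c" "c \<le> 1" "0 < s" "s \<le> 1"
    using cos_pos_sin_bounds[OF g] by (auto simp: c_def s_def)
  have y: "0 \<le> y" by (simp add: y_def)
  have cy: "0 \<le> c * y" "c * y \<le> y" "0 \<le> s * y" "s * y \<le> y"
    using cs y by (auto intro: mult_left_le_one_le)
  have sy: "\<bar>sin (s * y)\<bar> \<le> y"
    using abs_sin_x_le_abs_x[of "s * y"] cy by simp
  have e: "0 < exp (- (c * y))" "exp (- (c * y)) \<le> 1" "1 - exp (- (c * y)) \<le> y"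
    using cy exp_ge_add_one_self[of "- (c * y)"] by auto
  show "\<bar>osc g v\<bar> \<le> v powr g"
    using mult_mono[OF e(2) sy] by (simp add: osc_def c_def s_def y_def abs_mult)
  show "\<bar>osc g v\<bar> \<le> exp (- (cos (pi * g / 2) * v powr g))"
    by (simp add: osc_def abs_mult mult_left_le)
  have "\<bar>sin (s * y) - s * y\<bar> \<le> (s * y)\<^sup>2 / 2"
    using Maclaurin_sin_bound[of "s * y" 2] by (simp add: numeral_2_eq_2 sin_coeff_def)
  moreover have "(s * y)\<^sup>2 \<le> y\<^sup>2" using cy by (intro power_mono) auto
  ultimately have 1: "s * y - y\<^sup>2 \<le> sin (s * y)" unfolding abs_le_iff by linarith
  have "\<bar>(1 - exp (- (c * y))) * sin (s * y)\<bar> \<le> y * y"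
    using e sy y by (auto simp: abs_mult intro!: mult_mono)
  then have "s * y - 2 * y\<^sup>2 \<le> exp (- (c * y)) * sin (s * y)"
    using 1 by (auto simp: algebra_simps power2_eq_square abs_le_iff)
  moreover have "y\<^sup>2 = v powr (2 * g)"
  proof -
    have "y\<^sup>2 = y powr 2" using y by simp
    then show ?thesis by (simp add: y_def powr_powr mult.commute)
  qed
  ultimately show "sin (pi * g / 2) * v powr g - 2 * v powr (2 * g) \<le> osc g v"
    by (simp add: osc_def c_def s_def y_def)
qed

lemma measurable_osc [measurable]: "osc g \<in> borel_measurable borel"
  unfolding osc_def by measurable

lemma integrable_osc_weight:
  assumes g: "0 < g" "g < 1"
  shows "integrable lborel (\<lambda>v. indicator {0<..} v * (v * exp (- (cos (pi * g / 2) * v powr g))))"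
proof (rule Bochner_Integration.integrable_bound)
  show "integrable lborel (\<lambda>v::real. norm v ^ 1 * exp (- cos (pi * g / 2) * norm v powr g))"
    using g by (intro integrable_norm_stretched_exp cos_pos_sin_bounds)
  show "AE v in lborel. norm (indicator {0<..} v * (v * exp (- (cos (pi * g / 2) * v powr g))))
      \<le> norm (norm v ^ 1 * exp (- cos (pi * g / 2) * norm v powr g))"
    by (intro AE_I2) (simp add: indicator_def mult_nonpos_nonneg)
qed simp

lemma stieltjes_integrable:
  assumes g: "0 < g" "g < 1" and \<rho>: "0 < \<rho>"
  shows "integrable lborel (\<lambda>v. indicator {0<..} v * (v / (v\<^sup>2 + \<rho>\<^sup>2) * osc g v))"
proof (rule Bochner_Integration.integrable_bound)
  show "integrable lborel (\<lambda>v. 1 / \<rho>\<^sup>2 * (indicator {0<..} v * (v * exp (- (cos (pi * g / 2) * v powr g)))))"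
    using integrable_osc_weight[OF g] by (rule integrable_mult_right)
  have "norm (v / (v\<^sup>2 + \<rho>\<^sup>2) * osc g v) \<le> 1 / \<rho>\<^sup>2 * (v * exp (- (cos (pi * g / 2) * v powr g)))" if "0 < v" for v
  proof -
    have "v / (v\<^sup>2 + \<rho>\<^sup>2) \<le> v / \<rho>\<^sup>2" using that \<rho> by (intro divide_left_mono mult_pos_pos) (auto intro: add_nonneg_pos)
    then have "v / (v\<^sup>2 + \<rho>\<^sup>2) * \<bar>osc g v\<bar> \<le> v / \<rho>\<^sup>2 * exp (- (cos (pi * g / 2) * v powr g))"
      using that osc_bounds(2)[OF g] by (intro mult_mono) auto
    then show ?thesis using that by (simp add: abs_mult)
  qed
  then show "AE v in lborel. norm (indicator {0<..} v * (v / (v\<^sup>2 + \<rho>\<^sup>2) * osc g v))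
      \<le> norm (1 / \<rho>\<^sup>2 * (indicator {0<..} v * (v * exp (- (cos (pi * g / 2) * v powr g)))))"
    by (auto split: split_indicator)
qed simp

text \<open>A rational function with its pole at -2 \<rho> is subtracted from exp (-z^g). This
  creates the zero at \<rho> and keeps the decay at infinity, which subtracting a constant would
  destroy, and its own integral along the imaginary axis is an elementary arctangent. As the whole
  integral tends to 0, the wanted one equals the elementary one in the limit.\<close>

theorem stieltjes_stretched_exp:
  assumes g: "0 < g" "g < 1" and \<rho>: "0 < \<rho>"
  shows "(\<integral>v. indicator {0<..} v * (v / (v\<^sup>2 + \<rho>\<^sup>2) * osc g v) \<partial>lborel) = pi / 2 * exp (- (\<rho> powr g))"
proof -
  define c where "c = cos (pi * g / 2)"
  have c: "0 < c" using cos_pos_sin_bounds[OF g] by (simp add: c_def)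
  \<comment> \<open>Determined by F(\<rho>) = exp (-\<rho>^g) - K / (3 \<rho>) = 0.\<close>
  define K where "K = 3 * \<rho> * exp (- (\<rho> powr g))"
  have K: "0 < K" using \<rho> by (simp add: K_def)
  define F where "F z = exp (- (z powr complex_of_real g)) - complex_of_real K / (complex_of_real (2 * \<rho>) + z)" for z
  define b where "b y = exp (- (c * y powr g)) + 2 * K / (2 * \<rho> + y)" for y
  \<comment> \<open>The primitive of \<open>w\<close> below, by partial fractions. Its limit at
    infinity is pi / (6 \<rho>), and K pi / (6 \<rho>) is the value claimed.\<close>
  define A where "A R = 2 / (3 * \<rho>) * arctan (R / (2 * \<rho>)) - 1 / (3 * \<rho>) * arctan (R / \<rho>)" for R
  have nz: "complex_of_real (2 * \<rho>) + z \<noteq> 0" if "0 \<le> Re z" for z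
    using that \<rho> by (auto simp: complex_eq_iff)
  have lim: "((\<lambda>R. integral {-R..R} (\<lambda>v. F (\<i> * complex_of_real v) * complex_of_real (2 * v / (v\<^sup>2 + \<rho>\<^sup>2)))) \<longlongrightarrow> 0) at_top"
  proof (rule half_plane_symmetric_integral_tendsto[OF _ _ _ _ _ _ \<rho>])
    show "continuous_on {z. 0 \<le> Re z} F"
      unfolding F_def using nz g
      by (intro continuous_on_diff continuous_on_stretched_exp_half_plane continuous_intros) auto
    show "F holomorphic_on {z. 0 < Re z}"
      unfolding F_def using nz
      by (intro holomorphic_intros) (auto simp: complex_nonpos_Reals_iff intro: less_imp_le)
    show "norm (F z) \<le> b (norm z)" if "0 \<le> Re z" for z
    proof -
      have n1: "2 * \<rho> \<le> norm (complex_of_real (2 * \<rho>) + z)"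
        using that \<rho> by (intro order_trans[OF _ complex_Re_le_cmod]) auto
      have n2: "norm z \<le> norm (complex_of_real (2 * \<rho>) + z)"
        unfolding cmod_def using that \<rho> by (auto intro!: power_mono)
      have d0: "0 < (2 * \<rho> + norm z) / 2" using \<rho> by (simp add: add_pos_nonneg)
      have le: "(2 * \<rho> + norm z) / 2 \<le> norm (complex_of_real (2 * \<rho>) + z)" using add_mono[OF n1 n2] by simp
      then have "K / norm (complex_of_real (2 * \<rho>) + z) \<le> K / ((2 * \<rho> + norm z) / 2)"
        using K by (intro divide_left_mono mult_pos_pos d0 less_le_trans[OF d0 le]) auto
      then have le2: "norm (complex_of_real K / (complex_of_real (2 * \<rho>) + z)) \<le> 2 * K / (2 * \<rho> + norm z)"
        using K by (simp add: norm_divide mult.commute)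
      have "norm (F z) \<le> norm (exp (- (z powr complex_of_real g))) + norm (complex_of_real K / (complex_of_real (2 * \<rho>) + z))"
        unfolding F_def by (rule norm_triangle_ineq4)
      also have "\<dots> \<le> b (norm z)"
        unfolding b_def c_def by (rule add_mono[OF norm_stretched_exp_le[OF g that] le2])
      finally show ?thesis .
    qed
    show "antimono_on {1..} b"
    proof (rule monotone_onI)
      fix x y :: real assume xy: "x \<in> {1..}" "y \<in> {1..}" "x \<le> y"
      have "x powr g \<le> y powr g" using xy g by (intro powr_mono2) auto
      then show "b y \<le> b x" unfolding b_def
        using c K \<rho> xy by (intro add_mono divide_left_mono mult_pos_pos) auto
    qed
    have "((\<lambda>y. exp (- (c * y powr g))) \<longlongrightarrow> 0) at_top"
    proof (rule filterlim_compose[OF exp_at_bot])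
      have "filterlim (\<lambda>y. c * y powr g) at_top at_top"
        using c g by real_asymp
      then show "filterlim (\<lambda>y. - (c * y powr g)) at_bot at_top"
        by (simp add: filterlim_uminus_at_top)
    qed
    moreover have "((\<lambda>y. 2 * K / (2 * \<rho> + y)) \<longlongrightarrow> 0) at_top" by real_asymp
    ultimately show "(b \<longlongrightarrow> 0) at_top" unfolding b_def by (auto intro: tendsto_add_zero)
    have "exp (- complex_of_real (\<rho> powr g)) = complex_of_real (exp (- (\<rho> powr g)))"
      by (metis exp_of_real of_real_minus)
    then show "F (complex_of_real \<rho>) = 0"
      using \<rho> by (simp add: F_def K_def powr_of_real exp_of_real flip: of_real_add)
  qed
  define u where "u v = v / (v\<^sup>2 + \<rho>\<^sup>2) * osc g v" for v
  define w where "w v = v\<^sup>2 / ((v\<^sup>2 + \<rho>\<^sup>2) * (v\<^sup>2 + 4 * \<rho>\<^sup>2))" for v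
  have pos: "0 < v\<^sup>2 + \<rho>\<^sup>2" "0 < v\<^sup>2 + 4 * \<rho>\<^sup>2" for v using \<rho> by (auto intro: add_nonneg_pos)
  have contu: "continuous_on {0..R} u" for R
    unfolding u_def osc_def using pos(1) g
    by (intro continuous_intros continuous_on_powr') (auto simp: less_imp_neq[symmetric])
  have hw: "(w has_integral A R) {0..R}" if "0 \<le> R" for R
  proof -
    have "(w has_integral (A R - A 0)) {0..R}"
    proof (rule fundamental_theorem_of_calculus[OF that])
      fix x
      have "(A has_real_derivative (2 / (3 * \<rho>) * (inverse (1 + (x / (2 * \<rho>))\<^sup>2) * (1 / (2 * \<rho>))) - 1 / (3 * \<rho>) * (inverse (1 + (x / \<rho>)\<^sup>2) * (1 / \<rho>)))) (at x within {0..R})"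
        unfolding A_def
        by (intro DERIV_diff DERIV_cmult DERIV_chain2[OF DERIV_arctan] DERIV_cdivide DERIV_ident)
      also have "2 / (3 * \<rho>) * (inverse (1 + (x / (2 * \<rho>))\<^sup>2) * (1 / (2 * \<rho>))) - 1 / (3 * \<rho>) * (inverse (1 + (x / \<rho>)\<^sup>2) * (1 / \<rho>)) = w x"
      proof -
        have e: "1 + (x / (2 * \<rho>))\<^sup>2 = (x\<^sup>2 + 4 * \<rho>\<^sup>2) / (4 * \<rho>\<^sup>2)" "1 + (x / \<rho>)\<^sup>2 = (x\<^sup>2 + \<rho>\<^sup>2) / \<rho>\<^sup>2"
          using \<rho> by (auto simp: field_simps)
        have gen: "2 / (3 * \<rho>) * (inverse (P / (4 * \<rho>\<^sup>2)) * (1 / (2 * \<rho>))) - 1 / (3 * \<rho>) * (inverse (Q / \<rho>\<^sup>2) * (1 / \<rho>))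
            = (4 * Q - P) / (3 * (Q * P))" if "P \<noteq> 0" "Q \<noteq> 0" for P Q
          using \<rho> that by (simp add: field_simps power2_eq_square)
        have "2 / (3 * \<rho>) * (inverse (1 + (x / (2 * \<rho>))\<^sup>2) * (1 / (2 * \<rho>))) - 1 / (3 * \<rho>) * (inverse (1 + (x / \<rho>)\<^sup>2) * (1 / \<rho>))
          = (4 * (x\<^sup>2 + \<rho>\<^sup>2) - (x\<^sup>2 + 4 * \<rho>\<^sup>2)) / (3 * ((x\<^sup>2 + \<rho>\<^sup>2) * (x\<^sup>2 + 4 * \<rho>\<^sup>2)))"
          unfolding e by (rule gen) (use pos[of x] in auto)
        also have "4 * (x\<^sup>2 + \<rho>\<^sup>2) - (x\<^sup>2 + 4 * \<rho>\<^sup>2) = 3 * x\<^sup>2" by simp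
        also have "3 * x\<^sup>2 / (3 * ((x\<^sup>2 + \<rho>\<^sup>2) * (x\<^sup>2 + 4 * \<rho>\<^sup>2))) = w x"
          unfolding w_def by (rule mult_divide_mult_cancel_left) simp
        finally show ?thesis .
      qed
      finally show "(A has_vector_derivative w x) (at x within {0..R})"
        by (simp add: has_real_derivative_iff_has_vector_derivative)
    qed
    then show ?thesis by (simp add: A_def)
  qed
  \<comment> \<open>The kernel 2 v / (v^2 + \<rho>^2) is odd, so the contributions of v and -v
    combine into F(i v) - F(-i v), which is purely imaginary: the exponential yields
    \<open>osc\<close>, the rational part yields \<open>w\<close>.\<close>
  have fold: "integral {-R..R} (\<lambda>v. F (\<i> * complex_of_real v) * complex_of_real (2 * v / (v\<^sup>2 + \<rho>\<^sup>2)))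
    = - 4 * \<i> * complex_of_real (integral {0..R} u - K * A R)" if R: "0 \<le> R" for R
  proof -
    define \<psi> where "\<psi> v = F (\<i> * complex_of_real v) * complex_of_real (2 * v / (v\<^sup>2 + \<rho>\<^sup>2))" for v
    have "continuous_on UNIV (\<lambda>v. F (\<i> * complex_of_real v))"
      unfolding F_def using nz g
      by (intro continuous_intros continuous_on_compose2[OF continuous_on_stretched_exp_half_plane]) auto
    then have cont\<psi>: "continuous_on UNIV \<psi>"
      unfolding \<psi>_def using pos(1) by (intro continuous_intros) (auto simp: less_imp_neq[symmetric])
    have int\<psi>: "\<psi> integrable_on {x..y}" for x y
      by (intro integrable_continuous_interval continuous_on_subset[OF cont\<psi>]) auto
    have "integral {-R..R} \<psi> = integral {-R..0} \<psi> + integral {0..R} \<psi>"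
      using R int\<psi> by (intro Henstock_Kurzweil_Integration.integral_combine[symmetric]) auto
    also have "integral {-R..0} \<psi> = integral {0..R} (\<lambda>v. \<psi> (- v))"
      using Henstock_Kurzweil_Integration.integral_reflect_real[of R 0 "\<lambda>v. \<psi> (- v)"] by simp
    also have "integral {0..R} (\<lambda>v. \<psi> (- v)) + integral {0..R} \<psi> = integral {0..R} (\<lambda>v. \<psi> (- v) + \<psi> v)"
    proof (rule Henstock_Kurzweil_Integration.integral_add[symmetric])
      show "(\<lambda>v. \<psi> (- v)) integrable_on {0..R}"
        by (intro integrable_continuous_interval continuous_on_compose2[OF cont\<psi>] continuous_intros) auto
    qed (rule int\<psi>)
    also have "\<dots> = integral {0..R} (\<lambda>v. - 4 * \<i> * complex_of_real (u v - K * w v))"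
    proof (rule Henstock_Kurzweil_Integration.integral_cong)
      fix v assume v: "v \<in> {0..R}"
      show "\<psi> (- v) + \<psi> v = - 4 * \<i> * complex_of_real (u v - K * w v)"
      proof (cases "v = 0")
        case True then show ?thesis by (simp add: \<psi>_def u_def w_def)
      next
        case False
        then have v: "0 < v" using v by simp
        have 1: "exp (- ((\<i> * complex_of_real v) powr complex_of_real g)) - exp (- ((- (\<i> * complex_of_real v)) powr complex_of_real g))
          = - 2 * \<i> * complex_of_real (osc g v)"
          unfolding stretched_exp_imaginary[OF g v] osc_def
          by (simp add: complex_eq_iff)
        have "(complex_of_real (2 * \<rho>) + \<i> * complex_of_real v) * (complex_of_real (2 * \<rho>) - \<i> * complex_of_real v) = complex_of_real (v\<^sup>2 + 4 * \<rho>\<^sup>2)"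
          by (simp add: complex_eq_iff power2_eq_square)
        then have 2: "complex_of_real K / (complex_of_real (2 * \<rho>) + \<i> * complex_of_real v) - complex_of_real K / (complex_of_real (2 * \<rho>) - \<i> * complex_of_real v)
          = - 2 * \<i> * complex_of_real (K * v / (v\<^sup>2 + 4 * \<rho>\<^sup>2))"
          using nz[of "\<i> * complex_of_real v"] nz[of "- (\<i> * complex_of_real v)"]
          by (simp add: diff_frac_eq algebra_simps del: of_real_add)
        have 3: "F (\<i> * complex_of_real v) - F (- (\<i> * complex_of_real v))
          = - 2 * \<i> * complex_of_real (osc g v - K * v / (v\<^sup>2 + 4 * \<rho>\<^sup>2))"
          using 1 2 unfolding F_def by (simp add: algebra_simps del: of_real_add)
        have "\<psi> (- v) + \<psi> v = (F (\<i> * complex_of_real v) - F (- (\<i> * complex_of_real v))) * complex_of_real (2 * v / (v\<^sup>2 + \<rho>\<^sup>2))"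
        proof -
          have "complex_of_real (2 * (- v) / ((- v)\<^sup>2 + \<rho>\<^sup>2)) = - complex_of_real (2 * v / (v\<^sup>2 + \<rho>\<^sup>2))"
            by simp
          moreover have "\<i> * complex_of_real (- v) = - (\<i> * complex_of_real v)" by simp
          ultimately show ?thesis
            unfolding \<psi>_def by (simp only: left_diff_distrib mult_minus_right uminus_add_conv_diff)
        qed
        also have "\<dots> = - 4 * \<i> * complex_of_real ((osc g v - K * v / (v\<^sup>2 + 4 * \<rho>\<^sup>2)) * (v / (v\<^sup>2 + \<rho>\<^sup>2)))"
        proof -
          have "2 * v / (v\<^sup>2 + \<rho>\<^sup>2) = 2 * (v / (v\<^sup>2 + \<rho>\<^sup>2))" by simp
          then show ?thesis unfolding 3 by (simp only: of_real_mult of_real_numeral) (simp only: mult_ac, simp)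
        qed
        also have "(osc g v - K * v / (v\<^sup>2 + 4 * \<rho>\<^sup>2)) * (v / (v\<^sup>2 + \<rho>\<^sup>2)) = u v - K * w v"
          unfolding u_def w_def by (simp add: algebra_simps power2_eq_square)
        finally show ?thesis .
      qed
    qed
    also have "\<dots> = - 4 * \<i> * complex_of_real (integral {0..R} u - K * A R)"
    proof (rule integral_unique)
      have "(u has_integral integral {0..R} u) {0..R}"
        by (intro integrable_integral integrable_continuous_interval contu)
      then have "((\<lambda>v. u v - K * w v) has_integral (integral {0..R} u - K * A R)) {0..R}"
        by (intro has_integral_diff has_integral_mult_right hw R)
      then show "((\<lambda>v. - 4 * \<i> * complex_of_real (u v - K * w v)) has_integral - 4 * \<i> * complex_of_real (integral {0..R} u - K * A R)) {0..R}"
        by (intro has_integral_mult_right has_integral_of_real)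
    qed
    finally show ?thesis by (simp add: \<psi>_def)
  qed
  have "((\<lambda>R. - 4 * \<i> * complex_of_real (integral {0..R} u - K * A R)) \<longlongrightarrow> 0) at_top"
    using lim by (rule Lim_transform_eventually) (rule eventually_mono[OF eventually_ge_at_top[of 0] fold])
  then have "((\<lambda>R. 1/4 * norm (- 4 * \<i> * complex_of_real (integral {0..R} u - K * A R))) \<longlongrightarrow> 1/4 * norm (0::complex)) at_top"
    by (intro tendsto_intros)
  then have "((\<lambda>R. \<bar>integral {0..R} u - K * A R\<bar>) \<longlongrightarrow> 0) at_top"
    by (simp only: norm_mult norm_of_real) simp
  then have "((\<lambda>R. integral {0..R} u - K * A R) \<longlongrightarrow> 0) at_top"
    by (simp add: tendsto_rabs_zero_iff)
  moreover have "(A \<longlongrightarrow> pi / (6 * \<rho>)) at_top"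
  proof -
    have 1: "filterlim (\<lambda>R. R / (2 * \<rho>)) at_top at_top" "filterlim (\<lambda>R. R / \<rho>) at_top at_top"
      using \<rho> by real_asymp+
    have "(A \<longlongrightarrow> 2 / (3 * \<rho>) * (pi / 2) - 1 / (3 * \<rho>) * (pi / 2)) at_top"
      unfolding A_def using \<rho>
      by (intro tendsto_intros filterlim_compose[OF tendsto_arctan_at_top] 1) auto
    then show ?thesis using \<rho> by (simp add: field_simps)
  qed
  ultimately have "((\<lambda>R. (integral {0..R} u - K * A R) + K * A R) \<longlongrightarrow> 0 + K * (pi / (6 * \<rho>))) at_top"
    by (intro tendsto_intros)
  then have lim1: "((\<lambda>R. integral {0..R} u) \<longlongrightarrow> pi / 2 * exp (- (\<rho> powr g))) at_top"
    using \<rho> by (simp add: K_def)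
  have int: "set_integrable lborel {0<..} u"
    using stieltjes_integrable[OF g \<rho>] by (simp add: set_integrable_def u_def)
  \<comment> \<open>The contour argument gives an improper integral; absolute integrability
    identifies it with the Lebesgue integral.\<close>
  have "((\<lambda>R. LBINT v:{0<..R}. u v) \<longlongrightarrow> (LBINT v:{0<..}. u v)) at_top"
    unfolding set_lebesgue_integral_def
  proof (rule integral_dominated_convergence_at_top[where w = "\<lambda>v. norm (indicator {0<..} v *\<^sub>R u v)"])
    show "AE v in lborel. ((\<lambda>R. indicator {0<..R} v *\<^sub>R u v) \<longlongrightarrow> indicator {0<..} v *\<^sub>R u v) at_top"
    proof (rule AE_I2)
      fix v :: real
      have "\<forall>\<^sub>F R in at_top. indicator {0<..} v *\<^sub>R u v = indicator {0<..R} v *\<^sub>R u v"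
        using eventually_ge_at_top[of v] by eventually_elim (auto split: split_indicator)
      then show "((\<lambda>R. indicator {0<..R} v *\<^sub>R u v) \<longlongrightarrow> indicator {0<..} v *\<^sub>R u v) at_top"
        by (rule Lim_transform_eventually[OF tendsto_const])
    qed
    show "\<forall>\<^sub>F R in at_top. AE v in lborel. norm (indicator {0<..R} v *\<^sub>R u v) \<le> norm (indicator {0<..} v *\<^sub>R u v)"
      by (auto split: split_indicator)
    show "integrable lborel (\<lambda>v. norm (indicator {0<..} v *\<^sub>R u v))"
      using int by (simp add: set_integrable_def)
    show "(\<lambda>v. indicator {0<..} v *\<^sub>R u v) \<in> borel_measurable lborel"
      using int by (simp add: set_integrable_def borel_measurable_integrable)
    show "(\<lambda>v. indicator {0<..R} v *\<^sub>R u v) \<in> borel_measurable lborel" for R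
      unfolding u_def by measurable
  qed
  moreover have "(LBINT v:{0<..R}. u v) = integral {0..R} u" for R
  proof -
    have "set_integrable lborel {0..R} u"
      by (intro borel_integrable_atLeastAtMost' contu)
    then have "(LBINT v:{0..R}. u v) = integral {0..R} u"
      by (rule set_borel_integral_eq_integral)
    moreover have "(LBINT v:{0<..R}. u v) = (LBINT v:{0..R}. u v)"
      unfolding set_lebesgue_integral_def
      by (intro Bochner_Integration.integral_cong refl) (auto simp: u_def split: split_indicator)
    ultimately show ?thesis by simp
  qed
  ultimately have "((\<lambda>R. integral {0..R} u) \<longlongrightarrow> (LBINT v:{0<..}. u v)) at_top" by simp
  from tendsto_unique[OF _ this lim1] show ?thesis
    by (simp add: set_lebesgue_integral_def u_def)
qed

section \<open>The stable kernel as a mixture of Gaussians\<close>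

lemma has_bochner_integral_gauss_moment:
  assumes m: "0 < m" and \<sigma>: "0 < \<sigma>"
  shows "has_bochner_integral lborel (\<lambda>v. indicator {0<..} v * (v powr m * exp (- \<sigma> * v\<^sup>2)))
    (\<sigma> powr (- (m + 1) / 2) * gauss_moment m)"
proof (rule has_bochner_integral_nn_integral)
  have "(\<integral>\<^sup>+v. ennreal (indicator {0<..} v * (v powr m * exp (- \<sigma> * v\<^sup>2))) \<partial>lborel)
     = (\<integral>\<^sup>+v\<in>{0<..}. ennreal (v powr m * exp (- \<sigma> * v\<^sup>2)) \<partial>lborel)"
    by (intro nn_integral_cong) (auto split: split_indicator)
  then show "(\<integral>\<^sup>+v. ennreal (indicator {0<..} v * (v powr m * exp (- \<sigma> * v\<^sup>2))) \<partial>lborel)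
     = ennreal (\<sigma> powr (- (m + 1) / 2) * gauss_moment m)"
    using gauss_moment[OF m \<sigma>] by simp
  show "0 \<le> \<sigma> powr (- (m + 1) / 2) * gauss_moment m"
    by (simp add: gauss_moment_def)
qed auto

text \<open>In the Stieltjes formula 1 / (v^2 + \<rho>^2) is written as the integral of exp
  (-\<sigma> (v^2 + \<rho>^2)) over \<sigma> > 0. Exchanging the integrals leaves this function as
  the weight of exp (-\<sigma> \<rho>^2).\<close>

definition theta :: "real \<Rightarrow> real \<Rightarrow> real" where
  "theta g \<sigma> = 2 / pi * (\<integral>v. indicator {0<..} v * (v * exp (- \<sigma> * v\<^sup>2) * osc g v) \<partial>lborel)"

lemma measurable_theta [measurable]: "theta g \<in> borel_measurable borel"
  unfolding theta_def by measurable

lemma theta_integrand_integrable: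
  assumes g: "0 < g" "g < 1" and \<sigma>: "0 \<le> \<sigma>"
  shows "integrable lborel (\<lambda>v. indicator {0<..} v * (v * exp (- \<sigma> * v\<^sup>2) * osc g v))"
    and "\<bar>\<integral>v. indicator {0<..} v * (v * exp (- \<sigma> * v\<^sup>2) * osc g v) \<partial>lborel\<bar>
      \<le> (\<integral>v. indicator {0<..} v * (v * exp (- (cos (pi * g / 2) * v powr g))) \<partial>lborel)"
proof -
  have le: "norm (indicator {0<..} v * (v * exp (- \<sigma> * v\<^sup>2) * osc g v))
     \<le> indicator {0<..} v * (v * exp (- (cos (pi * g / 2) * v powr g)))" for v
  proof -
    have "v * exp (- \<sigma> * v\<^sup>2) * \<bar>osc g v\<bar> \<le> v * exp (- (cos (pi * g / 2) * v powr g))" if "0 < v"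
    proof (rule mult_mono)
      show "v * exp (- \<sigma> * v\<^sup>2) \<le> v" using that \<sigma> by (intro mult_left_le) auto
    qed (use that osc_bounds(2)[OF g] in auto)
    then show ?thesis by (auto simp: abs_mult split: split_indicator)
  qed
  show *: "integrable lborel (\<lambda>v. indicator {0<..} v * (v * exp (- \<sigma> * v\<^sup>2) * osc g v))"
    by (rule Bochner_Integration.integrable_bound[OF integrable_osc_weight[OF g]])
       (simp, rule AE_I2, rule order_trans[OF le], simp)
  show "\<bar>\<integral>v. indicator {0<..} v * (v * exp (- \<sigma> * v\<^sup>2) * osc g v) \<partial>lborel\<bar>
      \<le> (\<integral>v. indicator {0<..} v * (v * exp (- (cos (pi * g / 2) * v powr g))) \<partial>lborel)"
    using le by (intro order_trans[OF integral_abs_bound] integral_mono integrable_abs * integrable_osc_weight[OF g]) auto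
qed

lemma theta_bounded:
  assumes g: "0 < g" "g < 1"
  shows "\<exists>M. \<forall>\<sigma>\<ge>0. \<bar>theta g \<sigma>\<bar> \<le> M"
proof (intro exI allI impI)
  show "\<bar>theta g \<sigma>\<bar> \<le> 2 / pi * (\<integral>v. indicator {0<..} v * (v * exp (- (cos (pi * g / 2) * v powr g))) \<partial>lborel)" if "0 \<le> \<sigma>" for \<sigma>
    using mult_left_mono[OF theta_integrand_integrable(2)[OF g that], of "2 / pi"]
    by (simp add: theta_def abs_mult)
qed

text \<open>As \<sigma> grows the Gaussian concentrates at v = 0, where \<open>osc g v\<close> is
  sin (pi g / 2) v^g up to a multiple of v^(2g). The Gaussian moments of orders 1 + g and 1 + 2g
  scale with the powers -1 - g/2 and -1 - g of \<sigma>.\<close>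

lemma theta_decay:
  assumes g: "0 < g" "g < 1" and \<sigma>: "0 < \<sigma>"
  shows "\<bar>theta g \<sigma>\<bar> \<le> 2 / pi * gauss_moment (1 + g) * \<sigma> powr (- 1 - g / 2)"
    and "2 / pi * (sin (pi * g / 2) * gauss_moment (1 + g) * \<sigma> powr (- 1 - g / 2)
      - 2 * gauss_moment (1 + 2 * g) * \<sigma> powr (- 1 - g)) \<le> theta g \<sigma>"
proof -
  define f where "f v = indicator {0<..} v * (v * exp (- \<sigma> * v\<^sup>2) * osc g v)" for v
  define f1 where "f1 v = indicator {0<..} v * (v powr (1 + g) * exp (- \<sigma> * v\<^sup>2))" for v
  define f2 where "f2 v = indicator {0<..} v * (v powr (1 + 2 * g) * exp (- \<sigma> * v\<^sup>2))" for v
  have e: "- (1 + g + 1) / 2 = - 1 - g / 2" "- (1 + 2 * g + 1) / 2 = - 1 - g"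
    by (auto simp: field_simps)
  have f1: "has_bochner_integral lborel f1 (\<sigma> powr (- 1 - g / 2) * gauss_moment (1 + g))"
    using has_bochner_integral_gauss_moment[of "1 + g" \<sigma>] g \<sigma> unfolding f1_def e by simp
  have f2: "has_bochner_integral lborel f2 (\<sigma> powr (- 1 - g) * gauss_moment (1 + 2 * g))"
    using has_bochner_integral_gauss_moment[of "1 + 2 * g" \<sigma>] g \<sigma> unfolding f2_def e by simp
  have f: "integrable lborel f"
    unfolding f_def using theta_integrand_integrable(1)[OF g] \<sigma> by simp
  have le1: "\<bar>f v\<bar> \<le> f1 v" for v
  proof -
    have "v * exp (- \<sigma> * v\<^sup>2) * \<bar>osc g v\<bar> \<le> v * exp (- \<sigma> * v\<^sup>2) * v powr g" if "0 < v"
      using that osc_bounds(1)[OF g, of v] by (intro mult_left_mono) auto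
    then show ?thesis
      by (auto simp: f_def f1_def abs_mult powr_add algebra_simps split: split_indicator)
  qed
  have "\<bar>\<integral>v. f v \<partial>lborel\<bar> \<le> (\<integral>v. f1 v \<partial>lborel)"
    using le1 f1 f by (intro order_trans[OF integral_abs_bound] integral_mono) (auto dest: integrable.intros)
  also have "\<dots> = \<sigma> powr (- 1 - g / 2) * gauss_moment (1 + g)"
    using f1 by (rule has_bochner_integral_integral_eq)
  finally have 1: "\<bar>\<integral>v. f v \<partial>lborel\<bar> \<le> \<sigma> powr (- 1 - g / 2) * gauss_moment (1 + g)" .
  show "\<bar>theta g \<sigma>\<bar> \<le> 2 / pi * gauss_moment (1 + g) * \<sigma> powr (- 1 - g / 2)"
    using mult_left_mono[OF 1, of "2 / pi"]
    by (simp add: theta_def f_def abs_mult mult_ac)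
  define s where "s = sin (pi * g / 2)"
  have le2: "s * f1 v - 2 * f2 v \<le> f v" for v
  proof -
    have "v * exp (- \<sigma> * v\<^sup>2) * (s * v powr g - 2 * v powr (2 * g)) \<le> v * exp (- \<sigma> * v\<^sup>2) * osc g v" if "0 < v"
      using that osc_bounds(3)[OF g, of v] by (intro mult_left_mono) (auto simp: s_def)
    then show ?thesis
      by (auto simp: f_def f1_def f2_def powr_add algebra_simps split: split_indicator)
  qed
  have f12: "has_bochner_integral lborel (\<lambda>v. s * f1 v - 2 * f2 v)
     (s * (\<sigma> powr (- 1 - g / 2) * gauss_moment (1 + g)) - 2 * (\<sigma> powr (- 1 - g) * gauss_moment (1 + 2 * g)))"
    by (intro has_bochner_integral_diff has_bochner_integral_mult_right f1 f2)
  have "s * (\<sigma> powr (- 1 - g / 2) * gauss_moment (1 + g)) - 2 * (\<sigma> powr (- 1 - g) * gauss_moment (1 + 2 * g))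
     = (\<integral>v. s * f1 v - 2 * f2 v \<partial>lborel)"
    using f12 by (rule has_bochner_integral_integral_eq[symmetric])
  also have "\<dots> \<le> (\<integral>v. f v \<partial>lborel)"
    using le2 f12 f by (intro integral_mono) (auto dest: integrable.intros)
  finally show "2 / pi * (sin (pi * g / 2) * gauss_moment (1 + g) * \<sigma> powr (- 1 - g / 2)
      - 2 * gauss_moment (1 + 2 * g) * \<sigma> powr (- 1 - g)) \<le> theta g \<sigma>"
    unfolding theta_def f_def s_def by (intro mult_left_mono) (auto simp: mult_ac)
qed

lemma theta_integrable:
  assumes g: "0 < g" "g < 1"
  shows "integrable lborel (\<lambda>\<sigma>. indicator {0<..} \<sigma> * theta g \<sigma>)"
proof -
  obtain M where M: "\<And>\<sigma>. 0 \<le> \<sigma> \<Longrightarrow> \<bar>theta g \<sigma>\<bar> \<le> M" using theta_bounded[OF g] by blast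
  have M0: "0 \<le> M" using M[of 0] by simp
  define C where "C = 2 / pi * gauss_moment (1 + g)"
  have C0: "0 \<le> C" by (simp add: C_def gauss_moment_def)
  have m: "0 < g / 2" using g by simp
  \<comment> \<open>For \<sigma> > 1 the factor exp 1 exp (-1/\<sigma>) is at least 1, so the power
    tail is majorized by the integrand of the inverse moment, whose integrability is already
    known.\<close>
  define h where "h \<sigma> = M * indicator {0..1} \<sigma> + C * (exp 1 * (indicator {0<..} \<sigma> * (\<sigma> powr (- 1 - g / 2) * exp (- 1 / \<sigma>))))" for \<sigma>
  have "integrable lborel (\<lambda>\<sigma>. indicator {0<..} \<sigma> * (\<sigma> powr (- 1 - g / 2) * exp (- 1 / \<sigma>)))"
  proof (rule integrableI_nonneg)
    have "(\<integral>\<^sup>+\<sigma>. ennreal (indicator {0<..} \<sigma> * (\<sigma> powr (- 1 - g / 2) * exp (- 1 / \<sigma>))) \<partial>lborel)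
      = (\<integral>\<^sup>+\<sigma>\<in>{0<..}. ennreal (\<sigma> powr (- 1 - g / 2) * exp (- 1 / \<sigma>)) \<partial>lborel)"
      by (intro nn_integral_cong) (auto split: split_indicator)
    then show "(\<integral>\<^sup>+\<sigma>. ennreal (indicator {0<..} \<sigma> * (\<sigma> powr (- 1 - g / 2) * exp (- 1 / \<sigma>))) \<partial>lborel) < \<infinity>"
      using inverse_exp_moment_finite[OF m] by simp
  qed auto
  then have h: "integrable lborel h"
    unfolding h_def by (intro Bochner_Integration.integrable_add integrable_mult_right) auto
  have le: "\<bar>theta g \<sigma>\<bar> \<le> h \<sigma>" if "0 < \<sigma>" for \<sigma>
  proof (cases "\<sigma> \<le> 1")
    case True
    then show ?thesis using M[of \<sigma>] that C0 by (simp add: h_def add_increasing2)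
  next
    case False
    have "exp (-1) \<le> exp (- 1 / \<sigma>)" using False by simp
    then have "1 \<le> exp 1 * exp (- 1 / \<sigma>)" by (simp add: exp_minus field_simps)
    then have "C * \<sigma> powr (- 1 - g / 2) * 1 \<le> C * \<sigma> powr (- 1 - g / 2) * (exp 1 * exp (- 1 / \<sigma>))"
      using C0 by (intro mult_left_mono) auto
    then show ?thesis
      using theta_decay(1)[OF g that] False by (simp add: h_def C_def mult_ac)
  qed
  show ?thesis
    by (rule Bochner_Integration.integrable_bound[OF h])
       (use le in \<open>auto split: split_indicator intro: order_trans[OF _ abs_ge_self]\<close>)
qed

lemma integrable_pair_product:
  fixes f :: "'b \<Rightarrow> real" and h :: "'c \<Rightarrow> real"
  assumes "sigma_finite_measure M" "sigma_finite_measure N" and f: "integrable M f" and h: "integrable N h"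
  shows "integrable (M \<Otimes>\<^sub>M N) (\<lambda>(x, y). f x * h y)"
proof -
  interpret pair_sigma_finite M N using assms(1,2) by (simp add: pair_sigma_finite_def)
  have [measurable]: "f \<in> borel_measurable M" "h \<in> borel_measurable N" using f h by auto
  show ?thesis
  proof (rule Fubini_integrable)
    show "integrable M (\<lambda>x. \<integral>y. norm (case (x, y) of (x, y) \<Rightarrow> f x * h y) \<partial>N)"
      using f h by (simp add: abs_mult)
    show "AE x in M. integrable N (\<lambda>y. case (x, y) of (x, y) \<Rightarrow> f x * h y)"
      using h by simp
  qed measurable
qed

lemma has_bochner_integral_exp_decay:
  assumes b: "0 < (b::real)"
  shows "has_bochner_integral lborel (\<lambda>\<sigma>. indicator {0<..} \<sigma> * exp (- \<sigma> * b)) (1 / b)"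
proof (rule has_bochner_integral_nn_integral)
  have "(\<integral>\<^sup>+\<sigma>. ennreal (indicator {0<..} \<sigma> * exp (- \<sigma> * b)) \<partial>lborel)
     = (\<integral>\<^sup>+\<sigma>. ennreal (exp (- \<sigma> * b)) * indicator {0..} \<sigma> \<partial>lborel)"
    by (intro nn_integral_cong_AE, use AE_lborel_singleton[of 0] in eventually_elim)
       (auto split: split_indicator)
  also have "\<dots> = ennreal (0 - (- exp (- 0 * b) / b))"
  proof (rule nn_integral_FTC_atLeast)
    show "((\<lambda>x. - exp (- x * b) / b) \<longlongrightarrow> 0) at_top" using b by real_asymp
    show "((\<lambda>x. - exp (- x * b) / b) has_real_derivative exp (- x * b)) (at x)" for x
      using b by (auto intro!: derivative_eq_intros)
  qed auto
  finally show "(\<integral>\<^sup>+\<sigma>. ennreal (indicator {0<..} \<sigma> * exp (- \<sigma> * b)) \<partial>lborel) = ennreal (1 / b)" by simp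
qed (use b in auto)

text \<open>Fubini is licensed by integrating \<sigma> out of the absolute value first, which leaves
  the absolute value of the integrable Stieltjes integrand.\<close>

lemma theta_laplace:
  assumes g: "0 < g" "g < 1" and \<rho>: "0 < \<rho>"
  shows "(\<integral>\<sigma>. indicator {0<..} \<sigma> * (exp (- \<sigma> * \<rho>\<^sup>2) * theta g \<sigma>) \<partial>lborel) = exp (- (\<rho> powr g))"
proof -
  define f where "f = (\<lambda>v \<sigma>. indicator {0<..} v * (v * osc g v) * (indicator {0<..} \<sigma> * exp (- \<sigma> * (v\<^sup>2 + \<rho>\<^sup>2))) :: real)"
  have pos: "0 < v\<^sup>2 + \<rho>\<^sup>2" for v using \<rho> by (auto intro: add_nonneg_pos)
  note ex = has_bochner_integral_exp_decay[OF pos]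
  have inner: "(\<integral>\<sigma>. f v \<sigma> \<partial>lborel) = indicator {0<..} v * (v / (v\<^sup>2 + \<rho>\<^sup>2) * osc g v)" for v
    unfolding f_def using has_bochner_integral_integral_eq[OF ex[of v]] by simp
  have int: "integrable (lborel \<Otimes>\<^sub>M lborel) (\<lambda>(v, \<sigma>). f v \<sigma>)"
  proof (rule lborel_pair.Fubini_integrable)
    show "(\<lambda>(v, \<sigma>). f v \<sigma>) \<in> borel_measurable (lborel \<Otimes>\<^sub>M lborel)"
      unfolding f_def by measurable
    have "(\<integral>\<sigma>. norm (f v \<sigma>) \<partial>lborel) = norm (indicator {0<..} v * (v / (v\<^sup>2 + \<rho>\<^sup>2) * osc g v))" for v
    proof -
      have "norm (f v \<sigma>) = \<bar>indicator {0<..} v * (v * osc g v)\<bar> * (indicator {0<..} \<sigma> * exp (- \<sigma> * (v\<^sup>2 + \<rho>\<^sup>2)))" for \<sigma>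
        unfolding f_def by (simp add: abs_mult)
      then show ?thesis
        using has_bochner_integral_integral_eq[OF ex[of v]] pos[of v] by (simp add: abs_mult)
    qed
    then show "integrable lborel (\<lambda>v. \<integral>\<sigma>. norm (case (v, \<sigma>) of (v, \<sigma>) \<Rightarrow> f v \<sigma>) \<partial>lborel)"
      using integrable_norm[OF stieltjes_integrable[OF g \<rho>]] by simp
    show "AE v in lborel. integrable lborel (\<lambda>\<sigma>. case (v, \<sigma>) of (v, \<sigma>) \<Rightarrow> f v \<sigma>)"
      unfolding f_def using integrable.intros[OF ex] by simp
  qed
  have "(\<integral>\<sigma>. indicator {0<..} \<sigma> * (exp (- \<sigma> * \<rho>\<^sup>2) * theta g \<sigma>) \<partial>lborel) = (\<integral>\<sigma>. 2 / pi * (\<integral>v. f v \<sigma> \<partial>lborel) \<partial>lborel)"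
  proof (intro Bochner_Integration.integral_cong refl)
    fix \<sigma> :: real
    have "(\<integral>v. f v \<sigma> \<partial>lborel) = (\<integral>v. (indicator {0<..} \<sigma> * exp (- \<sigma> * \<rho>\<^sup>2)) * (indicator {0<..} v * (v * exp (- \<sigma> * v\<^sup>2) * osc g v)) \<partial>lborel)"
      unfolding f_def by (intro Bochner_Integration.integral_cong refl) (simp add: distrib_left exp_add[symmetric] mult_exp_exp algebra_simps)
    also have "\<dots> = (indicator {0<..} \<sigma> * exp (- \<sigma> * \<rho>\<^sup>2)) * (\<integral>v. indicator {0<..} v * (v * exp (- \<sigma> * v\<^sup>2) * osc g v) \<partial>lborel)"
      by simp
    finally show "indicator {0<..} \<sigma> * (exp (- \<sigma> * \<rho>\<^sup>2) * theta g \<sigma>) = 2 / pi * (\<integral>v. f v \<sigma> \<partial>lborel)"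
      by (simp add: theta_def)
  qed
  also have "\<dots> = 2 / pi * (\<integral>v. (\<integral>\<sigma>. f v \<sigma> \<partial>lborel) \<partial>lborel)"
    using lborel_pair.Fubini_integral[OF int] by simp
  also have "\<dots> = exp (- (\<rho> powr g))"
    unfolding inner stieltjes_stretched_exp[OF g \<rho>] by simp
  finally show ?thesis .
qed

section \<open>The isotropic stable kernel: Gaussian mixture, tail and modulus of continuity\<close>

text \<open>The inverse Fourier transform of exp (-t |\<xi>|^g), in cosine form because the
  transform is even. It serves two indices: g = \<alpha> for the given process and g = \<alpha> / 2
  for the subordinated semigroup.\<close>

definition stable_kernel :: "real \<Rightarrow> real \<Rightarrow> 'a::euclidean_space \<Rightarrow> real" where
  "stable_kernel g t x = (\<integral>\<xi>. cos (\<xi> \<bullet> x) * exp (- t * norm \<xi> powr g) \<partial>lborel) / (2 * pi) ^ DIM('a)"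

lemma stable_kernel_integrable:
  assumes "0 < t" "0 < g"
  shows "integrable lborel (\<lambda>\<xi>::'a::euclidean_space. cos (\<xi> \<bullet> x) * exp (- t * norm \<xi> powr g))"
proof (rule Bochner_Integration.integrable_bound)
  show "integrable lborel (\<lambda>\<xi>::'a. norm \<xi> ^ 0 * exp (- t * norm \<xi> powr g))"
    using assms by (rule integrable_norm_stretched_exp)
qed (auto simp: abs_mult mult_left_le_one_le)

text \<open>In the variable y = |x|^2 / (4 s) the kernel is a constant times |x|^(-d) y^(d/2) exp
  (-y), and the last two factors are bounded.\<close>

lemma heat_bounded:
  fixes x :: "'a::euclidean_space"
  assumes x: "x \<noteq> 0"
  shows "\<exists>H. \<forall>s>0. heat s x \<le> H"
proof -
  define d where "d = real DIM('a) / 2"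
  have d: "0 < d" by (simp add: d_def)
  have "heat s x \<le> (pi * (norm x)\<^sup>2) powr (- d) * d powr d" if s: "0 < s" for s
  proof -
    define y where "y = (norm x)\<^sup>2 / (4 * s)"
    have y: "0 < y" using x s by (simp add: y_def)
    have "4 * pi * s = (pi * (norm x)\<^sup>2) * inverse y" using x s by (simp add: y_def)
    then have "(4 * pi * s) powr (- d) = (pi * (norm x)\<^sup>2) powr (- d) * inverse y powr (- d)"
      by (simp only: powr_mult)
    also have "inverse y powr (- d) = y powr d" using y by (simp add: powr_minus inverse_powr[symmetric])
    finally have "heat s x = (pi * (norm x)\<^sup>2) powr (- d) * (y powr d * exp (- y))"
      by (simp add: heat_def d_def y_def)
    then show ?thesis
      using powr_mult_exp_neg_le[OF d, of y] y by (simp add: mult_left_mono)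
  qed
  then show ?thesis by blast
qed

text \<open>Boundedness of \<open>theta\<close> near 0 does not make the double integral in
  (\<sigma>, \<xi>) absolutely convergent in dimension two and above. Hence \<sigma> is replaced by
  \<sigma> + e before Fubini, and e tends to 0 afterwards, dominated on one side by
  \<open>theta\<close> times the supremum of the heat kernel at the fixed x \<noteq> 0 and on the
  other by exp (-|\<xi>|^g).\<close>

lemma stable_kernel_mixture:
  fixes x :: "'a::euclidean_space"
  assumes g: "0 < g" "g < 1" and x: "x \<noteq> 0"
  shows "integrable lborel (\<lambda>\<sigma>. indicator {0<..} \<sigma> * theta g \<sigma> * heat \<sigma> x)"
    and "stable_kernel g 1 x = (\<integral>\<sigma>. indicator {0<..} \<sigma> * theta g \<sigma> * heat \<sigma> x \<partial>lborel)"
proof -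
  define P :: real where "P = (2 * pi) ^ DIM('a)"
  have P: "0 < P" by (simp add: P_def)
  obtain H where H: "\<And>s. 0 < s \<Longrightarrow> heat s x \<le> H" using heat_bounded[OF x] by blast
  have H0: "0 \<le> H" using H[of 1] heat_pos[of 1 x] by simp
  define th where "th \<sigma> = indicator {0<..} \<sigma> * theta g \<sigma>" for \<sigma>
  have [measurable]: "th \<in> borel_measurable borel" unfolding th_def by measurable
  have thi: "integrable lborel th" unfolding th_def by (rule theta_integrable[OF g])
  have reg: "(\<integral>\<sigma>. th \<sigma> * heat (\<sigma> + e) x \<partial>lborel)
    = (\<integral>\<xi>. cos (\<xi> \<bullet> x) * exp (- (norm \<xi> powr g)) * exp (- e * (norm \<xi>)\<^sup>2) \<partial>lborel) / P" if e: "0 < e" for e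
  proof -
    define f where "f = (\<lambda>\<sigma> \<xi>::'a. th \<sigma> * (cos (\<xi> \<bullet> x) * exp (- (\<sigma> + e) * (norm \<xi>)\<^sup>2)))"
    have eint: "integrable lborel (\<lambda>\<xi>::'a. exp (- e * (norm \<xi>)\<^sup>2))"
      using fourier_gaussian[OF e, of "0::'a"] by (simp add: has_bochner_integral_iff)
    have int: "integrable (lborel \<Otimes>\<^sub>M lborel) (\<lambda>(\<sigma>, \<xi>). f \<sigma> \<xi>)"
    proof (rule Bochner_Integration.integrable_bound[OF integrable_pair_product[OF _ _ thi eint]])
      show "(\<lambda>(\<sigma>, \<xi>). f \<sigma> \<xi>) \<in> borel_measurable (lborel \<Otimes>\<^sub>M lborel)"
        unfolding f_def by measurable
      have "\<bar>f \<sigma> \<xi>\<bar> \<le> \<bar>th \<sigma> * exp (- e * (norm \<xi>)\<^sup>2)\<bar>" for \<sigma> \<xi>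
      proof (cases "0 < \<sigma>")
        case True
        have "\<bar>cos (\<xi> \<bullet> x) * exp (- (\<sigma> + e) * (norm \<xi>)\<^sup>2)\<bar> \<le> 1 * exp (- e * (norm \<xi>)\<^sup>2)"
          unfolding abs_mult using mult_right_mono[of e "\<sigma> + e" "(norm \<xi>)\<^sup>2"] True
          by (intro mult_mono) (auto simp: algebra_simps)
        then show ?thesis
          unfolding f_def abs_mult by (intro mult_left_mono) (auto simp: abs_mult)
      qed (auto simp: f_def th_def)
      then show "AE z in lborel \<Otimes>\<^sub>M lborel. norm (case z of (\<sigma>, \<xi>) \<Rightarrow> f \<sigma> \<xi>)
          \<le> norm (case z of (\<sigma>, \<xi>) \<Rightarrow> th \<sigma> * exp (- e * (norm \<xi>)\<^sup>2))"
        by (auto simp: case_prod_beta')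
    qed (unfold_locales)
    have "(\<integral>\<xi>. f \<sigma> \<xi> \<partial>lborel) = P * (th \<sigma> * heat (\<sigma> + e) x)" for \<sigma>
    proof (cases "0 < \<sigma>")
      case True
      then have "0 < \<sigma> + e" using e by simp
      from has_bochner_integral_integral_eq[OF fourier_gaussian[OF this, of x]]
      show ?thesis unfolding f_def by (simp add: P_def)
    qed (simp add: f_def th_def)
    then have "P * (\<integral>\<sigma>. th \<sigma> * heat (\<sigma> + e) x \<partial>lborel) = (\<integral>\<sigma>. (\<integral>\<xi>. f \<sigma> \<xi> \<partial>lborel) \<partial>lborel)" by simp
    also have "\<dots> = (\<integral>\<xi>. (\<integral>\<sigma>. f \<sigma> \<xi> \<partial>lborel) \<partial>lborel)"
      by (rule lborel_pair.Fubini_integral[OF int, symmetric])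
    also have "\<dots> = (\<integral>\<xi>. cos (\<xi> \<bullet> x) * exp (- (norm \<xi> powr g)) * exp (- e * (norm \<xi>)\<^sup>2) \<partial>lborel)"
    proof (rule integral_cong_AE)
      show "(\<lambda>\<xi>. \<integral>\<sigma>. f \<sigma> \<xi> \<partial>lborel) \<in> borel_measurable lborel"
        unfolding f_def by measurable
      show "AE \<xi> in lborel. (\<integral>\<sigma>. f \<sigma> \<xi> \<partial>lborel) = cos (\<xi> \<bullet> x) * exp (- (norm \<xi> powr g)) * exp (- e * (norm \<xi>)\<^sup>2)"
        using AE_lborel_singleton[of "0::'a"]
      proof eventually_elim
        case (elim \<xi>)
        have "(\<integral>\<sigma>. f \<sigma> \<xi> \<partial>lborel) = (\<integral>\<sigma>. (cos (\<xi> \<bullet> x) * exp (- e * (norm \<xi>)\<^sup>2)) * (indicator {0<..} \<sigma> * (exp (- \<sigma> * (norm \<xi>)\<^sup>2) * theta g \<sigma>)) \<partial>lborel)"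
          unfolding f_def th_def by (intro Bochner_Integration.integral_cong refl) (simp add: distrib_right exp_add exp_diff exp_minus field_simps)
        also have "\<dots> = cos (\<xi> \<bullet> x) * exp (- e * (norm \<xi>)\<^sup>2) * exp (- (norm \<xi> powr g))"
          using theta_laplace[OF g, of "norm \<xi>"] elim by simp
        finally show ?case by (simp add: mult_ac)
      qed
    qed measurable
    finally show ?thesis using P by (simp add: field_simps)
  qed
  define \<epsilon> where "\<epsilon> n = inverse (real (Suc n))" for n
  have \<epsilon>: "0 < \<epsilon> n" for n by (simp add: \<epsilon>_def)
  have \<epsilon>0: "\<epsilon> \<longlonglongrightarrow> 0" unfolding \<epsilon>_def by (rule LIMSEQ_inverse_real_of_nat)
  have lim0: "(\<lambda>n. heat (\<sigma> + \<epsilon> n) x) \<longlonglongrightarrow> heat \<sigma> x" if "0 < \<sigma>" for \<sigma>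
  proof -
    have "isCont (\<lambda>s. heat s x) \<sigma>"
      unfolding heat_def using that by (intro continuous_intros) auto
    moreover have "(\<lambda>n. \<sigma> + \<epsilon> n) \<longlonglongrightarrow> \<sigma>"
      using tendsto_add[OF tendsto_const[of \<sigma>] \<epsilon>0] by simp
    ultimately show ?thesis by (rule isCont_tendsto_compose)
  qed
  \<comment> \<open>e = 0 is included so that the same bound gives the integrability of the
    limit.\<close>
  have bd: "norm (th \<sigma> * heat (\<sigma> + e) x) \<le> norm (H * th \<sigma>)" if "0 \<le> e" for \<sigma> e
  proof (cases "0 < \<sigma>")
    case True
    then have "\<bar>heat (\<sigma> + e) x\<bar> \<le> H"
      using H[of "\<sigma> + e"] heat_pos[of "\<sigma> + e" x] that by simp
    then have "\<bar>th \<sigma>\<bar> * \<bar>heat (\<sigma> + e) x\<bar> \<le> \<bar>th \<sigma>\<bar> * H" by (intro mult_left_mono) auto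
    then show ?thesis using H0 by (simp add: abs_mult mult_ac)
  qed (simp add: th_def)
  have lim1: "(\<lambda>n. \<integral>\<sigma>. th \<sigma> * heat (\<sigma> + \<epsilon> n) x \<partial>lborel) \<longlonglongrightarrow> (\<integral>\<sigma>. th \<sigma> * heat \<sigma> x \<partial>lborel)"
  proof (rule integral_dominated_convergence[where w = "\<lambda>\<sigma>. norm (H * th \<sigma>)"])
    show "AE \<sigma> in lborel. (\<lambda>n. th \<sigma> * heat (\<sigma> + \<epsilon> n) x) \<longlonglongrightarrow> th \<sigma> * heat \<sigma> x"
    proof (rule AE_I2)
      fix \<sigma> show "(\<lambda>n. th \<sigma> * heat (\<sigma> + \<epsilon> n) x) \<longlonglongrightarrow> th \<sigma> * heat \<sigma> x"
      proof (cases "0 < \<sigma>")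
        case True
        then show ?thesis by (intro tendsto_mult tendsto_const lim0)
      qed (simp add: th_def)
    qed
    show "AE \<sigma> in lborel. norm (th \<sigma> * heat (\<sigma> + \<epsilon> n) x) \<le> norm (H * th \<sigma>)" for n
      using bd[of "\<epsilon> n"] \<epsilon>[of n] by simp
    show "integrable lborel (\<lambda>\<sigma>. norm (H * th \<sigma>))" using thi by simp
  qed measurable
  have lim2: "(\<lambda>n. (\<integral>\<xi>. cos (\<xi> \<bullet> x) * exp (- (norm \<xi> powr g)) * exp (- \<epsilon> n * (norm \<xi>)\<^sup>2) \<partial>lborel) / P)
    \<longlonglongrightarrow> (\<integral>\<xi>. cos (\<xi> \<bullet> x) * exp (- (norm \<xi> powr g)) \<partial>lborel) / P"
  proof (intro tendsto_divide tendsto_const integral_dominated_convergence[where w = "\<lambda>\<xi>. norm \<xi> ^ 0 * exp (- 1 * norm \<xi> powr g)"])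
    show "AE \<xi> in lborel. (\<lambda>n. cos (\<xi> \<bullet> x) * exp (- (norm \<xi> powr g)) * exp (- \<epsilon> n * (norm \<xi>)\<^sup>2)) \<longlonglongrightarrow> cos (\<xi> \<bullet> x) * exp (- (norm \<xi> powr g))"
    proof (rule AE_I2)
      fix \<xi> :: 'a
      have "(\<lambda>n. cos (\<xi> \<bullet> x) * exp (- (norm \<xi> powr g)) * exp (- \<epsilon> n * (norm \<xi>)\<^sup>2)) \<longlonglongrightarrow> cos (\<xi> \<bullet> x) * exp (- (norm \<xi> powr g)) * exp (- 0 * (norm \<xi>)\<^sup>2)"
        by (intro tendsto_mult tendsto_const tendsto_exp tendsto_minus \<epsilon>0)
      then show "(\<lambda>n. cos (\<xi> \<bullet> x) * exp (- (norm \<xi> powr g)) * exp (- \<epsilon> n * (norm \<xi>)\<^sup>2)) \<longlonglongrightarrow> cos (\<xi> \<bullet> x) * exp (- (norm \<xi> powr g))"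
        by simp
    qed
    show "AE \<xi> in lborel. norm (cos (\<xi> \<bullet> x) * exp (- (norm \<xi> powr g)) * exp (- \<epsilon> n * (norm \<xi>)\<^sup>2)) \<le> norm \<xi> ^ 0 * exp (- 1 * norm \<xi> powr g)" for n
    proof (rule AE_I2)
      fix \<xi> :: 'a
      have "\<bar>cos (\<xi> \<bullet> x)\<bar> * exp (- (norm \<xi> powr g)) * exp (- \<epsilon> n * (norm \<xi>)\<^sup>2) \<le> 1 * exp (- (norm \<xi> powr g)) * 1"
        using \<epsilon>[of n] by (intro mult_mono) auto
      then show "norm (cos (\<xi> \<bullet> x) * exp (- (norm \<xi> powr g)) * exp (- \<epsilon> n * (norm \<xi>)\<^sup>2)) \<le> norm \<xi> ^ 0 * exp (- 1 * norm \<xi> powr g)"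
        by (simp add: abs_mult)
    qed
    show "integrable lborel (\<lambda>\<xi>::'a. norm \<xi> ^ 0 * exp (- 1 * norm \<xi> powr g))"
      using g by (intro integrable_norm_stretched_exp) auto
  qed (use P in auto)
  show "integrable lborel (\<lambda>\<sigma>. indicator {0<..} \<sigma> * theta g \<sigma> * heat \<sigma> x)"
    using bd[of 0] by (intro Bochner_Integration.integrable_bound[OF integrable_mult_right[OF thi, of H]])
      (auto simp: th_def)
  show "stable_kernel g 1 x = (\<integral>\<sigma>. indicator {0<..} \<sigma> * theta g \<sigma> * heat \<sigma> x \<partial>lborel)"
    using LIMSEQ_unique[OF lim1] lim2 unfolding reg[OF \<epsilon>]
    by (simp add: stable_kernel_def P_def th_def)
qed

lemma divide_powr_minus: "0 < c \<Longrightarrow> (a / c) powr (- m) = a powr (- m) * c powr m" for a c m :: real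
proof -
  assume c: "0 < c"
  then have "inverse c powr (- m) = c powr m" by (simp add: powr_minus inverse_powr[symmetric])
  then show ?thesis unfolding divide_inverse powr_mult by simp
qed

text \<open>The exponent keeps a free b in place of |x|^2 / 4, because the modulus of continuity
  uses a smaller b that serves x and x + h at once.\<close>

lemma has_bochner_integral_heat_moment:
  fixes x :: "'a::euclidean_space"
  assumes k: "0 < k" and b: "0 < b"
  shows "has_bochner_integral lborel
     (\<lambda>\<sigma>. indicator {0<..} \<sigma> * (\<sigma> powr (- 1 - k) * ((4 * pi * \<sigma>) powr (- real DIM('a) / 2) * exp (- b / \<sigma>))))
     ((4 * pi) powr (- real DIM('a) / 2) * (b powr (- (k + real DIM('a) / 2)) * inv_moment (k + real DIM('a) / 2)))"
proof -
  define m where "m = k + real DIM('a) / 2"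
  have m: "0 < m" using k by (simp add: m_def add_pos_nonneg)
  have "has_bochner_integral lborel (\<lambda>\<sigma>. indicator {0<..} \<sigma> * (\<sigma> powr (- 1 - m) * exp (- b / \<sigma>))) (b powr (- m) * inv_moment m)"
  proof (rule has_bochner_integral_nn_integral)
    have "(\<integral>\<^sup>+\<sigma>. ennreal (indicator {0<..} \<sigma> * (\<sigma> powr (- 1 - m) * exp (- b / \<sigma>))) \<partial>lborel)
      = (\<integral>\<^sup>+\<sigma>\<in>{0<..}. ennreal (\<sigma> powr (- 1 - m) * exp (- b / \<sigma>)) \<partial>lborel)"
      by (intro nn_integral_cong) (auto split: split_indicator)
    then show "(\<integral>\<^sup>+\<sigma>. ennreal (indicator {0<..} \<sigma> * (\<sigma> powr (- 1 - m) * exp (- b / \<sigma>))) \<partial>lborel) = ennreal (b powr (- m) * inv_moment m)"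
      using inv_moment[OF m b] by simp
    show "0 \<le> b powr (- m) * inv_moment m" by (simp add: inv_moment_def)
  qed auto
  from has_bochner_integral_mult_right[OF this, of "(4 * pi) powr (- real DIM('a) / 2)"]
  have "has_bochner_integral lborel (\<lambda>\<sigma>. (4 * pi) powr (- real DIM('a) / 2) * (indicator {0<..} \<sigma> * (\<sigma> powr (- 1 - m) * exp (- b / \<sigma>))))
    ((4 * pi) powr (- real DIM('a) / 2) * (b powr (- m) * inv_moment m))" by simp
  also have "(\<lambda>\<sigma>. (4 * pi) powr (- real DIM('a) / 2) * (indicator {0<..} \<sigma> * (\<sigma> powr (- 1 - m) * exp (- b / \<sigma>))))
     = (\<lambda>\<sigma>. indicator {0<..} \<sigma> * (\<sigma> powr (- 1 - k) * ((4 * pi * \<sigma>) powr (- real DIM('a) / 2) * exp (- b / \<sigma>))))"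
  proof
    fix \<sigma> :: real
    have "\<sigma> powr (- 1 - m) = \<sigma> powr (- 1 - k) * \<sigma> powr (- real DIM('a) / 2)"
      unfolding m_def powr_add[symmetric] by (rule arg_cong[where f = "\<lambda>y. \<sigma> powr y"]) simp
    moreover have "(4 * pi * \<sigma>) powr (- real DIM('a) / 2) = (4 * pi) powr (- real DIM('a) / 2) * \<sigma> powr (- real DIM('a) / 2)"
      by (rule powr_mult)
    ultimately show "(4 * pi) powr (- real DIM('a) / 2) * (indicator {0<..} \<sigma> * (\<sigma> powr (- 1 - m) * exp (- b / \<sigma>)))
      = indicator {0<..} \<sigma> * (\<sigma> powr (- 1 - k) * ((4 * pi * \<sigma>) powr (- real DIM('a) / 2) * exp (- b / \<sigma>)))"
      by (simp only: mult_ac)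
  qed
  finally show ?thesis by (simp add: m_def)
qed

lemma has_bochner_integral_heat_power:
  fixes k :: real
  assumes k: "0 < k"
  shows "\<exists>W>0. \<forall>x::'a::euclidean_space. x \<noteq> 0 \<longrightarrow>
    has_bochner_integral lborel (\<lambda>\<sigma>. indicator {0<..} \<sigma> * (\<sigma> powr (- 1 - k) * heat \<sigma> x)) (W * norm x powr (- real DIM('a) - 2 * k))"
proof (intro exI conjI allI impI)
  define m where "m = k + real DIM('a) / 2"
  have m: "0 < m" using k by (simp add: m_def add_pos_nonneg)
  show "0 < (4 * pi) powr (- real DIM('a) / 2) * (4 powr m * inv_moment m)"
    using inv_moment_pos[OF m] by simp
  fix x :: 'a assume x: "x \<noteq> 0"
  define b where "b = (norm x)\<^sup>2 / 4"
  have b: "0 < b" using x by (simp add: b_def)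
  have "b powr (- m) = (norm x)\<^sup>2 powr (- m) * 4 powr m"
    unfolding b_def by (rule divide_powr_minus) simp
  also have "(norm x)\<^sup>2 powr (- m) = norm x powr (- 2 * m)"
    using power2_powr_half[of "norm x" "- 2 * m"] by simp
  also have "- 2 * m = - real DIM('a) - 2 * k" by (simp add: m_def)
  finally have bm: "b powr (- m) = norm x powr (- real DIM('a) - 2 * k) * 4 powr m" .
  have "(\<lambda>\<sigma>. indicator {0<..} \<sigma> * (\<sigma> powr (- 1 - k) * ((4 * pi * \<sigma>) powr (- real DIM('a) / 2) * exp (- b / \<sigma>))))
    = (\<lambda>\<sigma>. indicator {0<..} \<sigma> * (\<sigma> powr (- 1 - k) * heat \<sigma> x))"
    by (simp add: heat_def b_def fun_eq_iff)
  then show "has_bochner_integral lborel (\<lambda>\<sigma>. indicator {0<..} \<sigma> * (\<sigma> powr (- 1 - k) * heat \<sigma> x))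
     ((4 * pi) powr (- real DIM('a) / 2) * (4 powr m * inv_moment m) * norm x powr (- real DIM('a) - 2 * k))"
    using has_bochner_integral_heat_moment[OF k b, where 'a = 'a] bm
    by (simp only: m_def[symmetric]) (simp only: mult_ac)
qed

text \<open>Integrating the two-term lower bound for \<open>theta\<close> against the heat kernel
  gives A W1 |x|^(-d-g) - B W2 |x|^(-d-2g). R is the radius beyond which the second term is at most
  half of the first.\<close>

lemma stable_kernel_tail_lower:
  assumes g: "0 < g" "g < 1"
  shows "\<exists>R c. 1 \<le> R \<and> 0 < c \<and> (\<forall>x::'a::euclidean_space. R \<le> norm x \<longrightarrow> c * norm x powr (- real DIM('a) - g) \<le> stable_kernel g 1 x)"
proof -
  define A where "A = 2 / pi * (sin (pi * g / 2) * gauss_moment (1 + g))"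
  define B where "B = 2 / pi * (2 * gauss_moment (1 + 2 * g))"
  have A: "0 < A" unfolding A_def using cos_pos_sin_bounds[OF g] gauss_moment_pos[of "1 + g"] g by simp
  have B: "0 < B" unfolding B_def using gauss_moment_pos[of "1 + 2 * g"] g by simp
  obtain W1 where W1: "0 < W1" "\<And>x::'a. x \<noteq> 0 \<Longrightarrow>
    has_bochner_integral lborel (\<lambda>\<sigma>. indicator {0<..} \<sigma> * (\<sigma> powr (- 1 - g/2) * heat \<sigma> x)) (W1 * norm x powr (- real DIM('a) - 2 * (g/2)))"
    using has_bochner_integral_heat_power[of "g/2", where 'a = 'a] g by auto
  obtain W2 where W2: "0 < W2" "\<And>x::'a. x \<noteq> 0 \<Longrightarrow>
    has_bochner_integral lborel (\<lambda>\<sigma>. indicator {0<..} \<sigma> * (\<sigma> powr (- 1 - g) * heat \<sigma> x)) (W2 * norm x powr (- real DIM('a) - 2 * g))"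
    using has_bochner_integral_heat_power[of g, where 'a = 'a] g by auto
  define R where "R = max 1 ((2 * B * W2 / (A * W1)) powr (1 / g))"
  have low: "A * W1 / 2 * norm x powr (- real DIM('a) - g) \<le> stable_kernel g 1 x" if x: "R \<le> norm x" for x :: 'a
  proof -
    have n1: "1 \<le> norm x" using x by (simp add: R_def)
    then have x0: "x \<noteq> 0" by auto
    have "has_bochner_integral lborel
       (\<lambda>\<sigma>. A * (indicator {0<..} \<sigma> * (\<sigma> powr (- 1 - g/2) * heat \<sigma> x)) - B * (indicator {0<..} \<sigma> * (\<sigma> powr (- 1 - g) * heat \<sigma> x)))
       (A * (W1 * norm x powr (- real DIM('a) - 2 * (g/2))) - B * (W2 * norm x powr (- real DIM('a) - 2 * g)))" (is "has_bochner_integral _ ?f ?I")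
      by (intro has_bochner_integral_diff has_bochner_integral_mult_right W1(2) W2(2) x0)
    moreover have "?f \<sigma> \<le> indicator {0<..} \<sigma> * theta g \<sigma> * heat \<sigma> x" for \<sigma>
    proof (cases "0 < \<sigma>")
      case True
      have "(A * \<sigma> powr (- 1 - g/2) - B * \<sigma> powr (- 1 - g)) * heat \<sigma> x \<le> theta g \<sigma> * heat \<sigma> x"
        using theta_decay(2)[OF g True] heat_pos[OF True, of x]
        by (intro mult_right_mono) (auto simp: A_def B_def algebra_simps)
      then show ?thesis using True by (simp add: algebra_simps)
    qed simp
    ultimately have "?I \<le> stable_kernel g 1 x"
      unfolding stable_kernel_mixture(2)[OF g x0]
      by (subst has_bochner_integral_integral_eq[symmetric]) (auto intro!: integral_mono stable_kernel_mixture(1)[OF g x0] dest: integrable.intros)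
    moreover have "B * (W2 * norm x powr (- real DIM('a) - 2 * g)) \<le> A * W1 / 2 * norm x powr (- real DIM('a) - g)"
    proof -
      have "2 * B * W2 / (A * W1) = ((2 * B * W2 / (A * W1)) powr (1 / g)) powr g"
        using A B W1 W2 g by (simp add: powr_powr)
      also have "\<dots> \<le> norm x powr g"
        using x g by (intro powr_mono2) (auto simp: R_def)
      finally have "2 * B * W2 \<le> A * W1 * norm x powr g"
        using A W1 by (simp add: field_simps)
      then have "2 * B * W2 * norm x powr (- real DIM('a) - 2 * g) \<le> A * W1 * norm x powr g * norm x powr (- real DIM('a) - 2 * g)"
        by (intro mult_right_mono) auto
      also have "\<dots> = A * W1 * norm x powr (- real DIM('a) - g)"
      proof -
        have "g + (- real DIM('a) - 2 * g) = - real DIM('a) - g" by simp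
        then show ?thesis by (simp only: mult.assoc powr_add[symmetric])
      qed
      finally show ?thesis by simp
    qed
    ultimately show ?thesis by simp
  qed
  show ?thesis
    using low A W1 by (intro exI[of _ R] exI[of _ "A * W1 / 2"]) (auto simp: R_def)
qed

lemma exp_neg_diff_le: "\<bar>exp (- a) - exp (- b)\<bar> \<le> \<bar>a - b\<bar> * exp (- min a b)" for a b :: real
proof -
  have *: "exp (- a) - exp (- b) \<le> (b - a) * exp (- a)" if "a \<le> b" for a b :: real
  proof -
    have "1 - exp (a - b) \<le> b - a" using exp_ge_add_one_self[of "a - b"] by linarith
    then have "(1 - exp (a - b)) * exp (- a) \<le> (b - a) * exp (- a)" by (intro mult_right_mono) auto
    then show ?thesis by (simp add: left_diff_distrib flip: exp_add)
  qed
  show ?thesis using *[of a b] *[of b a] by (cases "a \<le> b") (auto simp: abs_if min_def)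
qed

text \<open>For |x| < 2 L the Fourier integral is Lipschitz and the decay factor is bounded below.
  For |x| >= 2 L increments are taken inside the mixture: an increment of the heat kernel costs a
  factor |h| |x| / \<sigma>, and the result is |h| |x|^(-d-g-1), better than the claimed decay by
  one power.\<close>

lemma stable_kernel_Lipschitz:
  assumes g: "0 < g" "g < 1" and L: "0 < L"
  shows "\<exists>C>0. \<forall>(x::'a::euclidean_space) h. norm h \<le> L \<longrightarrow>
    \<bar>stable_kernel g 1 (x + h) - stable_kernel g 1 x\<bar> \<le> C * norm h * (1 + norm x) powr (- real DIM('a) - g)"
proof -
  define e where "e = real DIM('a) + g"
  have e: "0 < e" using g by (simp add: e_def add_nonneg_pos)
  define T where "T = 2 / pi * gauss_moment (1 + g)"
  have T: "0 \<le> T" by (simp add: T_def gauss_moment_def)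
  define M where "M = (\<integral>\<xi>. norm (\<xi>::'a) ^ 1 * exp (- 1 * norm \<xi> powr g) \<partial>lborel) / (2 * pi) ^ DIM('a)"
  have Mi: "integrable lborel (\<lambda>\<xi>::'a. norm \<xi> ^ 1 * exp (- 1 * norm \<xi> powr g))"
    using g by (intro integrable_norm_stretched_exp) auto
  have M: "0 \<le> M" unfolding M_def by (intro divide_nonneg_pos integral_nonneg_AE) auto
  have near: "\<bar>stable_kernel g 1 (x + h) - stable_kernel g 1 x\<bar> \<le> M * norm h" for x h :: 'a
  proof -
    have i: "integrable lborel (\<lambda>\<xi>::'a. cos (\<xi> \<bullet> y) * exp (- 1 * norm \<xi> powr g))" for y
      using g by (intro stable_kernel_integrable) auto
    have "\<bar>(\<integral>\<xi>. cos (\<xi> \<bullet> (x + h)) * exp (- 1 * norm \<xi> powr g) \<partial>lborel) - (\<integral>\<xi>. cos (\<xi> \<bullet> x) * exp (- 1 * norm \<xi> powr g) \<partial>lborel)\<bar>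
      = \<bar>\<integral>\<xi>. cos (\<xi> \<bullet> (x + h)) * exp (- 1 * norm \<xi> powr g) - cos (\<xi> \<bullet> x) * exp (- 1 * norm \<xi> powr g) \<partial>lborel\<bar>"
      by (subst Bochner_Integration.integral_diff[OF i i]) simp
    also have "\<dots> \<le> (\<integral>\<xi>. \<bar>cos (\<xi> \<bullet> (x + h)) * exp (- 1 * norm \<xi> powr g) - cos (\<xi> \<bullet> x) * exp (- 1 * norm \<xi> powr g)\<bar> \<partial>lborel)"
      by (rule integral_abs_bound)
    also have "\<dots> \<le> (\<integral>\<xi>. norm h * (norm (\<xi>::'a) ^ 1 * exp (- 1 * norm \<xi> powr g)) \<partial>lborel)"
    proof (rule integral_mono)
      show "integrable lborel (\<lambda>\<xi>. \<bar>cos (\<xi> \<bullet> (x + h)) * exp (- 1 * norm \<xi> powr g) - cos (\<xi> \<bullet> x) * exp (- 1 * norm \<xi> powr g)\<bar>)"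
        using Bochner_Integration.integrable_diff[OF i i] by (rule integrable_abs)
      show "integrable lborel (\<lambda>\<xi>::'a. norm h * (norm \<xi> ^ 1 * exp (- 1 * norm \<xi> powr g)))"
        using Mi by (rule integrable_mult_right)
      fix \<xi> :: 'a
      have "\<bar>cos (\<xi> \<bullet> (x + h)) - cos (\<xi> \<bullet> x)\<bar> \<le> \<bar>\<xi> \<bullet> (x + h) - \<xi> \<bullet> x\<bar>"
      proof -
        have "\<bar>cos a - cos b\<bar> \<le> \<bar>a - b\<bar>" for a b :: real
        proof -
          have "\<bar>cos a - cos b\<bar> = 2 * (\<bar>sin ((a + b) / 2)\<bar> * \<bar>sin ((b - a) / 2)\<bar>)"
            by (simp add: cos_diff_cos abs_mult)
          also have "\<dots> \<le> 2 * (1 * \<bar>(b - a) / 2\<bar>)"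
            by (intro mult_left_mono mult_mono abs_sin_x_le_abs_x) auto
          finally show ?thesis by simp
        qed
        then show ?thesis .
      qed
      also have "\<dots> \<le> norm \<xi> * norm h"
        using Cauchy_Schwarz_ineq2[of \<xi> h] by (simp add: inner_add_right)
      finally have "\<bar>cos (\<xi> \<bullet> (x + h)) - cos (\<xi> \<bullet> x)\<bar> * exp (- 1 * norm \<xi> powr g) \<le> norm \<xi> * norm h * exp (- 1 * norm \<xi> powr g)"
        by (intro mult_right_mono) auto
      then show "\<bar>cos (\<xi> \<bullet> (x + h)) * exp (- 1 * norm \<xi> powr g) - cos (\<xi> \<bullet> x) * exp (- 1 * norm \<xi> powr g)\<bar>
         \<le> norm h * (norm \<xi> ^ 1 * exp (- 1 * norm \<xi> powr g))"
        by (simp add: abs_mult mult_ac flip: left_diff_distrib)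
    qed
    also have "\<dots> = M * norm h * (2 * pi) ^ DIM('a)" unfolding M_def by simp
    finally show ?thesis
      unfolding stable_kernel_def by (simp add: divide_le_eq abs_divide flip: diff_divide_distrib)
  qed
  \<comment> \<open>The factor 1/\<sigma> from the increment of the exponent joins \<sigma>^(-1-g/2)
    from \<open>theta\<close> to \<sigma>^(-1-k).\<close>
  define k where "k = 1 + g / 2"
  have k: "0 < k" using g by (simp add: k_def)
  define Z where "Z = (4 * pi) powr (- real DIM('a) / 2) * inv_moment (k + real DIM('a) / 2) * 16 powr (k + real DIM('a) / 2)"
  have Z: "0 \<le> Z" by (simp add: Z_def inv_moment_def)
  have far: "\<bar>stable_kernel g 1 (x + h) - stable_kernel g 1 x\<bar> \<le> T * Z * norm h * norm x powr (- e - 1)"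
    if x: "2 * L \<le> norm x" and h: "norm h \<le> L" for x h :: 'a
  proof -
    have x0: "x \<noteq> 0" using x L by auto
    have xh: "norm x / 2 \<le> norm (x + h)" using norm_diff_ineq[of x h] x h by linarith
    then have xh0: "x + h \<noteq> 0" using x0 by auto
    \<comment> \<open>b / \<sigma> is the heat exponent of a point of norm |x|/2; as |x + h| >=
      |x|/2, it lies below the exponents of both x and x + h.\<close>
    define b where "b = (norm x)\<^sup>2 / 16"
    have b: "0 < b" using x0 by (simp add: b_def)
    define f where "f \<sigma> = indicator {0<..} \<sigma> * (\<sigma> powr (- 1 - k) * ((4 * pi * \<sigma>) powr (- real DIM('a) / 2) * exp (- b / \<sigma>)))" for \<sigma>
    have f: "has_bochner_integral lborel f ((4 * pi) powr (- real DIM('a) / 2) * (b powr (- (k + real DIM('a) / 2)) * inv_moment (k + real DIM('a) / 2)))"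
      unfolding f_def by (rule has_bochner_integral_heat_moment[OF k b])
    have le: "\<bar>indicator {0<..} \<sigma> * theta g \<sigma> * heat \<sigma> (x + h) - indicator {0<..} \<sigma> * theta g \<sigma> * heat \<sigma> x\<bar>
       \<le> T * norm h * norm x * f \<sigma>" for \<sigma>
    proof (cases "0 < \<sigma>")
      case True
      define A B where "A = (norm (x + h))\<^sup>2 / (4 * \<sigma>)" and "B = (norm x)\<^sup>2 / (4 * \<sigma>)"
      have "(norm x / 2)\<^sup>2 \<le> (norm (x + h))\<^sup>2" using xh by (intro power_mono) auto
      then have "b / \<sigma> \<le> A" unfolding A_def b_def using True by (simp add: field_simps power_divide)
      moreover have "b / \<sigma> \<le> B" unfolding B_def b_def using True by (simp add: field_simps)
      ultimately have m: "b / \<sigma> \<le> min A B" by simp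
      have d: "\<bar>A - B\<bar> \<le> norm h * norm x / \<sigma>"
      proof -
        have "\<bar>norm (x + h) - norm x\<bar> \<le> norm h"
          using norm_triangle_ineq3[of "x + h" x] by simp
        moreover have "norm (x + h) + norm x \<le> 4 * norm x"
          using norm_triangle_ineq[of x h] x h L by linarith
        ultimately have "\<bar>norm (x + h) - norm x\<bar> * (norm (x + h) + norm x) \<le> norm h * (4 * norm x)"
          by (intro mult_mono) auto
        moreover have "\<bar>(norm (x + h))\<^sup>2 - (norm x)\<^sup>2\<bar> = \<bar>norm (x + h) - norm x\<bar> * (norm (x + h) + norm x)"
        proof -
          have "(norm (x + h))\<^sup>2 - (norm x)\<^sup>2 = (norm (x + h) - norm x) * (norm (x + h) + norm x)"
            by (simp add: power2_eq_square algebra_simps)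
          then show ?thesis
            by (simp only: abs_mult abs_of_nonneg[OF add_nonneg_nonneg[OF norm_ge_zero norm_ge_zero]])
        qed
        ultimately have "\<bar>(norm (x + h))\<^sup>2 - (norm x)\<^sup>2\<bar> / (4 * \<sigma>) \<le> norm h * (4 * norm x) / (4 * \<sigma>)"
          using True by (intro divide_right_mono) auto
        then show ?thesis using True by (simp add: A_def B_def flip: diff_divide_distrib)
      qed
      have ex: "\<bar>exp (- A) - exp (- B)\<bar> \<le> norm h * norm x / \<sigma> * exp (- b / \<sigma>)"
        using exp_neg_diff_le[of A B] mult_mono[OF d, of "exp (- min A B)" "exp (- b / \<sigma>)"] m True by simp
      have heq: "heat \<sigma> (x + h) - heat \<sigma> x = (4 * pi * \<sigma>) powr (- real DIM('a) / 2) * (exp (- A) - exp (- B))"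
        by (simp add: heat_def A_def B_def right_diff_distrib)
      have hd: "\<bar>heat \<sigma> (x + h) - heat \<sigma> x\<bar> \<le> (4 * pi * \<sigma>) powr (- real DIM('a) / 2) * (norm h * norm x / \<sigma> * exp (- b / \<sigma>))"
        unfolding heq abs_mult abs_of_nonneg[OF powr_ge_zero] by (intro mult_left_mono ex powr_ge_zero)
      have th: "\<bar>theta g \<sigma>\<bar> \<le> T * \<sigma> powr (- 1 - g / 2)"
        using theta_decay(1)[OF g True] by (simp add: T_def)
      have "\<bar>theta g \<sigma> * (heat \<sigma> (x + h) - heat \<sigma> x)\<bar>
        \<le> (T * \<sigma> powr (- 1 - g / 2)) * ((4 * pi * \<sigma>) powr (- real DIM('a) / 2) * (norm h * norm x / \<sigma> * exp (- b / \<sigma>)))"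
        unfolding abs_mult using th hd T by (intro mult_mono) auto
      also have "\<dots> = T * norm h * norm x * (\<sigma> powr (- 1 - g / 2) / \<sigma> * ((4 * pi * \<sigma>) powr (- real DIM('a) / 2) * exp (- b / \<sigma>)))"
        by simp
      also have "\<sigma> powr (- 1 - g / 2) / \<sigma> = \<sigma> powr (- 1 - k)"
      proof -
        have "- 1 - k = (- 1 - g / 2) - 1" by (simp add: k_def)
        then show ?thesis using True by (simp only: powr_diff[of \<sigma> "- 1 - g / 2" 1]) simp
      qed
      finally show ?thesis using True by (simp add: f_def right_diff_distrib)
    qed (simp add: f_def)
    have "\<bar>stable_kernel g 1 (x + h) - stable_kernel g 1 x\<bar> \<le> (\<integral>\<sigma>. T * norm h * norm x * f \<sigma> \<partial>lborel)"
      unfolding stable_kernel_mixture(2)[OF g x0] stable_kernel_mixture(2)[OF g xh0]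
        Bochner_Integration.integral_diff[OF stable_kernel_mixture(1)[OF g xh0] stable_kernel_mixture(1)[OF g x0], symmetric]
      using le f stable_kernel_mixture(1)[OF g x0] stable_kernel_mixture(1)[OF g xh0]
      by (intro order_trans[OF integral_abs_bound] integral_mono) (auto dest: integrable.intros)
    also have "\<dots> = T * norm h * norm x * ((4 * pi) powr (- real DIM('a) / 2) * (b powr (- (k + real DIM('a) / 2)) * inv_moment (k + real DIM('a) / 2)))"
      using has_bochner_integral_integral_eq[OF f] by simp
    also have "b powr (- (k + real DIM('a) / 2)) = 16 powr (k + real DIM('a) / 2) * norm x powr (- e - 2)"
    proof -
      have "b powr (- (k + real DIM('a) / 2)) = (norm x)\<^sup>2 powr (- (k + real DIM('a) / 2)) * 16 powr (k + real DIM('a) / 2)"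
        unfolding b_def by (rule divide_powr_minus) simp
      also have "(norm x)\<^sup>2 powr (- (k + real DIM('a) / 2)) = norm x powr (- e - 2)"
      proof -
        have "- (k + real DIM('a) / 2) = (- e - 2) / 2" by (simp add: k_def e_def field_simps)
        then show ?thesis by (simp only: power2_powr_half abs_norm_cancel)
      qed
      finally show ?thesis by simp
    qed
    also have "T * norm h * norm x * ((4 * pi) powr (- real DIM('a) / 2) * (16 powr (k + real DIM('a) / 2) * norm x powr (- e - 2) * inv_moment (k + real DIM('a) / 2)))
      = T * Z * norm h * (norm x * norm x powr (- e - 2))"
      by (simp add: Z_def)
    also have "norm x * norm x powr (- e - 2) = norm x powr (- e - 1)"
    proof -
      have "1 + (- e - 2) = - e - 1" by simp
      then show ?thesis by (simp only: powr_mult_base[OF norm_ge_zero])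
    qed
    finally show ?thesis .
  qed
  define C where "C = M * (1 + 2 * L) powr e + T * Z / L * (2 + 1 / L) powr e + 1"
  have C: "0 < C" unfolding C_def using M T Z L by (intro add_nonneg_pos add_nonneg_nonneg) auto
  show ?thesis
  proof (rule exI[of _ C], intro conjI allI impI C)
    fix x h :: 'a assume h: "norm h \<le> L"
    show "\<bar>stable_kernel g 1 (x + h) - stable_kernel g 1 x\<bar> \<le> C * norm h * (1 + norm x) powr (- real DIM('a) - g)"
    proof (cases "2 * L \<le> norm x")
      case False
      have "1 = (1 + norm x) powr e * (1 + norm x) powr (- e)" using add_pos_nonneg[of 1 "norm x"] by (simp flip: powr_add)
      also have "\<dots> \<le> (1 + 2 * L) powr e * (1 + norm x) powr (- e)"
        using False e by (intro mult_right_mono powr_mono2) auto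
      finally have "M * norm h * 1 \<le> M * norm h * ((1 + 2 * L) powr e * (1 + norm x) powr (- e))"
        using M by (intro mult_left_mono) auto
      also have "\<dots> = (M * (1 + 2 * L) powr e) * norm h * (1 + norm x) powr (- e)" by simp
      also have "\<dots> \<le> C * norm h * (1 + norm x) powr (- e)"
        unfolding C_def using T Z L by (intro mult_right_mono) auto
      finally show ?thesis using near[of x h] by (simp add: e_def)
    next
      case True
      then have nx: "0 < norm x" using L by linarith
      have "norm x powr (- e - 1) = norm x powr (- e) / norm x"
        using nx by (simp add: powr_diff)
      also have "\<dots> \<le> norm x powr (- e) / L"
        using nx L True by (intro divide_left_mono) auto
      also have "norm x powr (- e) \<le> (2 + 1 / L) powr e * (1 + norm x) powr (- e)"
      proof -
        have "1 \<le> norm x / L" using True L by (simp add: field_simps)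
        moreover have "(2 + 1 / L) * norm x = 2 * norm x + norm x / L" by (simp add: algebra_simps)
        ultimately have "1 + norm x \<le> (2 + 1 / L) * norm x" using nx by linarith
        then have "((2 + 1 / L) * norm x) powr (- e) \<le> (1 + norm x) powr (- e)"
          using e nx by (intro powr_mono2') (auto intro: add_pos_nonneg)
        then have "(2 + 1 / L) powr e * ((2 + 1 / L) powr (- e) * norm x powr (- e)) \<le> (2 + 1 / L) powr e * (1 + norm x) powr (- e)"
          by (intro mult_left_mono) (auto simp: powr_mult)
        moreover have "(2 + 1 / L) powr e * (2 + 1 / L) powr (- e) = 1"
        proof -
          have "2 + 1 / L \<noteq> 0" using L by (simp add: field_simps)
          then show ?thesis by (simp flip: powr_add)
        qed
        ultimately show ?thesis by (simp flip: mult.assoc)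
      qed
      finally have "norm x powr (- e - 1) \<le> (2 + 1 / L) powr e * (1 + norm x) powr (- e) / L"
        using L by (simp add: divide_right_mono)
      then have "T * Z * norm h * norm x powr (- e - 1) \<le> T * Z * norm h * ((2 + 1 / L) powr e * (1 + norm x) powr (- e) / L)"
        using T Z by (intro mult_left_mono) auto
      also have "\<dots> = (T * Z / L * (2 + 1 / L) powr e) * norm h * (1 + norm x) powr (- e)" by simp
      also have "\<dots> \<le> C * norm h * (1 + norm x) powr (- e)"
        unfolding C_def using M T Z L by (intro mult_right_mono) auto
      finally show ?thesis using far[OF True h] by (simp add: e_def)
    qed
  qed
qed

section \<open>Fourier inversion and subordination\<close>

text \<open>The error function times sqrt pi / 2.\<close>

definition gauss_primitive :: "real \<Rightarrow> real" where
  "gauss_primitive u = (LBINT y=0..u. exp (- y\<^sup>2))"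

lemma gauss_primitive_deriv: "(gauss_primitive has_real_derivative exp (- x\<^sup>2)) (at x)"
proof -
  define a b where "a = min 0 x - 1" and "b = max 0 x + 1"
  have "((\<lambda>u. LBINT y=(0::real)..u. exp (- y\<^sup>2)) has_vector_derivative exp (- x\<^sup>2)) (at x within {a..b})"
    by (rule interval_integral_FTC2) (auto simp: a_def b_def intro!: continuous_intros)
  moreover have "at x within {a..b} = at x"
    by (rule at_within_Icc_at) (auto simp: a_def b_def)
  ultimately show ?thesis
    unfolding gauss_primitive_def[abs_def]
    by (simp add: has_real_derivative_iff_has_vector_derivative zero_ereal_def)
qed

lemma gauss_primitive_top: "(gauss_primitive \<longlongrightarrow> sqrt pi / 2) at_top"
proof -
  have l1: "((\<lambda>y. \<integral>x. indicator {..y} x *\<^sub>R (indicator {0..} x *\<^sub>R exp (- x\<^sup>2)) \<partial>lborel) \<longlongrightarrow> (\<integral>x. indicator {0..} x *\<^sub>R exp (- x\<^sup>2) \<partial>(lborel :: real measure))) at_top"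
    using gaussian_moment_0 by (intro tendsto_integral_at_top) (auto simp: has_bochner_integral_iff)
  have e1: "(\<integral>x. indicator {0..} x *\<^sub>R exp (- x\<^sup>2) \<partial>(lborel :: real measure)) = sqrt pi / 2"
    using gaussian_moment_0 by (rule has_bochner_integral_integral_eq)
  have ev: "\<forall>\<^sub>F y in at_top. (\<integral>x. indicator {..y} x *\<^sub>R (indicator {0..} x *\<^sub>R exp (- x\<^sup>2)) \<partial>lborel) = gauss_primitive y"
    using eventually_ge_at_top[of 0]
  proof eventually_elim
    case (elim y)
    have "gauss_primitive y = (LBINT x:{0..y}. exp (- x\<^sup>2))"
      unfolding gauss_primitive_def zero_ereal_def using elim by (rule interval_integral_Icc)
    also have "\<dots> = (\<integral>x. indicator {..y} x *\<^sub>R (indicator {0..} x *\<^sub>R exp (- x\<^sup>2)) \<partial>lborel)"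
      unfolding set_lebesgue_integral_def
      by (intro Bochner_Integration.integral_cong refl) (auto split: split_indicator)
    finally show ?case ..
  qed
  show ?thesis using Lim_transform_eventually[OF l1 ev] unfolding e1 .
qed

lemma gauss_primitive_minus: "gauss_primitive (- u) = - gauss_primitive u"
proof -
  have "((\<lambda>u. gauss_primitive (- u) + gauss_primitive u) has_real_derivative 0) (at x)" for x
  proof -
    have "((\<lambda>u. gauss_primitive (- u) + gauss_primitive u) has_real_derivative (exp (- (- x)\<^sup>2) * (- 1) + exp (- x\<^sup>2))) (at x)"
      by (intro DERIV_add DERIV_chain2[OF gauss_primitive_deriv] gauss_primitive_deriv DERIV_minus DERIV_ident)
    then show ?thesis by simp
  qed
  then have "gauss_primitive (- u) + gauss_primitive u = gauss_primitive (- 0) + gauss_primitive 0"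
    by (intro DERIV_isconst_all[of "\<lambda>u. gauss_primitive (- u) + gauss_primitive u"]) auto
  moreover have "gauss_primitive 0 = 0" by (simp add: gauss_primitive_def zero_ereal_def)
  ultimately show ?thesis by simp
qed

lemma gauss_primitive_bot: "(gauss_primitive \<longlongrightarrow> - (sqrt pi / 2)) at_bot"
proof -
  have "((\<lambda>u. - gauss_primitive (- u)) \<longlongrightarrow> - (sqrt pi / 2)) at_bot"
    by (intro tendsto_minus filterlim_compose[OF gauss_primitive_top] filterlim_uminus_at_top_at_bot)
  then show ?thesis by (simp add: gauss_primitive_minus)
qed

text \<open>The density of the one-half stable subordinator at time t, which is the weight in
  \<open>mu_meas\<close>.\<close>

definition mu_dens :: "real \<Rightarrow> real \<Rightarrow> real" where
  "mu_dens t s = indicator {0<..} s * (t / (2 * sqrt pi) * exp (- t\<^sup>2 / (4 * s)) * s powr (- 3 / 2))"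

lemma measurable_mu_dens [measurable]: "mu_dens t \<in> borel_measurable borel"
  unfolding mu_dens_def by measurable

lemma mu_dens_nonneg: "0 < t \<Longrightarrow> 0 \<le> mu_dens t s"
  by (simp add: mu_dens_def)

text \<open>An explicit primitive. The squares of A and B are l s + t^2 / (4 s) minus, respectively
  plus, t a. So exp (-t a) and exp (t a) bring both Gaussians to the same exponential; in the
  difference the a-terms of A' and B' cancel and the remaining ones add up to the density.\<close>

lemma mu_dens_laplace:
  assumes t: "0 < t" and l: "0 \<le> l"
  shows "has_bochner_integral lborel (\<lambda>s. mu_dens t s * exp (- s * l)) (exp (- t * sqrt l))"
proof -
  define a where "a = sqrt l"
  have a: "0 \<le> a" "a\<^sup>2 = l" using l by (auto simp: a_def)
  define A where "A s = a * sqrt s - t / (2 * sqrt s)" for s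
  define B where "B s = a * sqrt s + t / (2 * sqrt s)" for s
  define F where "F s = (exp (- t * a) * gauss_primitive (A s) - exp (t * a) * gauss_primitive (B s)) / sqrt pi" for s
  define f where "f s = t / (2 * sqrt pi) * exp (- t\<^sup>2 / (4 * s)) * s powr (- 3 / 2) * exp (- s * l)" for s
  have dF: "(F has_real_derivative f s) (at s)" if s: "0 < s" for s
  proof -
    define r where "r = sqrt s"
    have r: "0 < r" "r\<^sup>2 = s" using s by (auto simp: r_def)
    have dS: "(sqrt has_real_derivative 1 / (2 * r)) (at s)"
      by (rule DERIV_cong[OF DERIV_real_sqrt[OF s]]) (simp add: r_def inverse_eq_divide)
    have dQ: "((\<lambda>s. t / (2 * sqrt s)) has_real_derivative - t / (4 * r ^ 3)) (at s)"
      by (rule DERIV_cong[OF DERIV_divide[OF DERIV_const DERIV_cmult[OF dS]]])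
         (use r in \<open>auto simp: r_def[symmetric] field_simps power3_eq_cube\<close>)
    have dA: "(A has_real_derivative (a / (2 * r) + t / (4 * r ^ 3))) (at s)"
      unfolding A_def by (rule DERIV_cong[OF DERIV_diff[OF DERIV_cmult[OF dS] dQ]]) simp
    have dB: "(B has_real_derivative (a / (2 * r) - t / (4 * r ^ 3))) (at s)"
      unfolding B_def by (rule DERIV_cong[OF DERIV_add[OF DERIV_cmult[OF dS] dQ]]) simp
    have A2: "(A s)\<^sup>2 = l * s + t\<^sup>2 / (4 * s) - t * a"
    proof -
      have "(A s)\<^sup>2 = a\<^sup>2 * r\<^sup>2 + t\<^sup>2 / (4 * r\<^sup>2) - t * a"
        unfolding A_def r_def[symmetric] using r(1) by (simp add: field_simps power2_eq_square)
      then show ?thesis using r a by simp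
    qed
    have B2: "(B s)\<^sup>2 = l * s + t\<^sup>2 / (4 * s) + t * a"
    proof -
      have "(B s)\<^sup>2 = a\<^sup>2 * r\<^sup>2 + t\<^sup>2 / (4 * r\<^sup>2) + t * a"
        unfolding B_def r_def[symmetric] using r(1) by (simp add: field_simps power2_eq_square)
      then show ?thesis using r a by simp
    qed
    have "(F has_real_derivative ((exp (- t * a) * (exp (- (A s)\<^sup>2) * (a / (2 * r) + t / (4 * r ^ 3)))
       - exp (t * a) * (exp (- (B s)\<^sup>2) * (a / (2 * r) - t / (4 * r ^ 3)))) / sqrt pi)) (at s)"
      unfolding F_def
      by (intro DERIV_cdivide DERIV_diff DERIV_cmult DERIV_chain2[OF gauss_primitive_deriv] dA dB)
    also have "(exp (- t * a) * (exp (- (A s)\<^sup>2) * (a / (2 * r) + t / (4 * r ^ 3)))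
       - exp (t * a) * (exp (- (B s)\<^sup>2) * (a / (2 * r) - t / (4 * r ^ 3)))) / sqrt pi = f s"
    proof -
      define Z where "Z = exp (- (l * s + t\<^sup>2 / (4 * s)))"
      have 1: "exp (- t * a) * exp (- (A s)\<^sup>2) = Z" "exp (t * a) * exp (- (B s)\<^sup>2) = Z"
        unfolding A2 B2 Z_def mult_exp_exp by (simp_all add: algebra_simps)
      have "(exp (- t * a) * (exp (- (A s)\<^sup>2) * (a / (2 * r) + t / (4 * r ^ 3)))
       - exp (t * a) * (exp (- (B s)\<^sup>2) * (a / (2 * r) - t / (4 * r ^ 3)))) / sqrt pi
        = (Z * (a / (2 * r) + t / (4 * r ^ 3)) - Z * (a / (2 * r) - t / (4 * r ^ 3))) / sqrt pi"
        unfolding mult.assoc[symmetric] 1 ..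
      also have "\<dots> = Z * (t / (2 * r ^ 3)) / sqrt pi"
        using r(1) by (simp add: field_simps)
      also have "Z * (t / (2 * r ^ 3)) / sqrt pi = f s"
      proof -
        have r3: "r ^ 3 = s powr (3 / 2)"
          using s by (simp add: r_def powr_half_sqrt[symmetric] powr_power)
        have "s powr (- 3 / 2) = 1 / s powr (3 / 2)" using powr_minus_divide[of s "3/2"] by simp
        moreover have "Z = exp (- t\<^sup>2 / (4 * s)) * exp (- s * l)"
          unfolding Z_def mult_exp_exp by (simp add: algebra_simps)
        ultimately show ?thesis unfolding f_def r3 by (simp add: mult_ac)
      qed
      finally show ?thesis .
    qed
    finally show ?thesis .
  qed
  have f0: "0 \<le> f s" for s using t by (simp add: f_def)
  have alg: "(X * (- (w / 2)) - Y * (w / 2)) / w = - (X + Y) / 2" "(X * (w / 2) - Y * (w / 2)) / w = (X - Y) / 2"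
    if "w \<noteq> 0" for X Y w :: real
    using that by (simp_all add: field_simps)
  have spi: "sqrt pi \<noteq> 0" by simp
  have bot: "(F \<longlongrightarrow> - (exp (- t * a) + exp (t * a)) / 2) (at_right 0)"
  proof -
    have 1: "filterlim A at_bot (at_right 0)" "filterlim B at_top (at_right 0)"
      unfolding A_def B_def using t a(1) by real_asymp+
    have "(F \<longlongrightarrow> (exp (- t * a) * (- (sqrt pi / 2)) - exp (t * a) * (sqrt pi / 2)) / sqrt pi) (at_right 0)"
      unfolding F_def
      by (intro tendsto_divide tendsto_diff tendsto_mult tendsto_const filterlim_compose[OF gauss_primitive_bot 1(1)]
          filterlim_compose[OF gauss_primitive_top 1(2)]) auto
    then show ?thesis unfolding alg(1)[OF spi] .
  qed
  \<comment> \<open>For a = 0 the arguments A and B tend to 0 and no longer to infinity; the two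
    terms of \<open>F\<close> then cancel, in agreement with the general formula.\<close>
  have top: "(F \<longlongrightarrow> (exp (- t * a) - exp (t * a)) / 2) at_top"
  proof (cases "a = 0")
    case True
    have "filterlim A (nhds 0) at_top" "filterlim B (nhds 0) at_top"
      unfolding A_def B_def True using t by real_asymp+
    moreover have "isCont gauss_primitive 0" by (rule DERIV_isCont[OF gauss_primitive_deriv])
    ultimately have "((\<lambda>s. gauss_primitive (A s)) \<longlongrightarrow> gauss_primitive 0) at_top" "((\<lambda>s. gauss_primitive (B s)) \<longlongrightarrow> gauss_primitive 0) at_top"
      by (auto intro: isCont_tendsto_compose)
    then have "(F \<longlongrightarrow> (exp (- t * a) * gauss_primitive 0 - exp (t * a) * gauss_primitive 0) / sqrt pi) at_top"
      unfolding F_def by (intro tendsto_divide tendsto_diff tendsto_mult tendsto_const) auto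
    then show ?thesis using True by simp
  next
    case False
    then have a0: "0 < a" using a by simp
    have 1: "filterlim A at_top at_top" "filterlim B at_top at_top"
      unfolding A_def B_def using t a0 by real_asymp+
    have "(F \<longlongrightarrow> (exp (- t * a) * (sqrt pi / 2) - exp (t * a) * (sqrt pi / 2)) / sqrt pi) at_top"
      unfolding F_def
      by (intro tendsto_divide tendsto_diff tendsto_mult tendsto_const filterlim_compose[OF gauss_primitive_top 1(1)]
          filterlim_compose[OF gauss_primitive_top 1(2)]) auto
    then show ?thesis unfolding alg(2)[OF spi] .
  qed
  have int: "set_integrable lborel (einterval 0 \<infinity>) f"
    and val: "(LBINT s=0..\<infinity>. f s) = (exp (- t * a) - exp (t * a)) / 2 - (- (exp (- t * a) + exp (t * a)) / 2)"
  proof -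
    have *: "((F \<circ> real_of_ereal) \<longlongrightarrow> - (exp (- t * a) + exp (t * a)) / 2) (at_right 0)"
      using bot by (simp add: zero_ereal_def ereal_tendsto_simps1)
    have **: "((F \<circ> real_of_ereal) \<longlongrightarrow> (exp (- t * a) - exp (t * a)) / 2) (at_left \<infinity>)"
      using top by (simp add: ereal_tendsto_simps1)
    have cont: "isCont f x" if "0 < ereal x" for x
      unfolding f_def using that by (auto intro!: continuous_intros simp: zero_ereal_def)
    show "set_integrable lborel (einterval 0 \<infinity>) f"
      by (rule interval_integral_FTC_nonneg(1)[OF _ _ _ _ * **]) (use dF cont f0 in \<open>auto simp: zero_ereal_def\<close>)
    show "(LBINT s=0..\<infinity>. f s) = (exp (- t * a) - exp (t * a)) / 2 - (- (exp (- t * a) + exp (t * a)) / 2)"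
      by (rule interval_integral_FTC_nonneg(2)[OF _ _ _ _ * **]) (use dF cont f0 in \<open>auto simp: zero_ereal_def\<close>)
  qed
  have ei: "einterval 0 \<infinity> = {0<..}" by (auto simp: einterval_def zero_ereal_def)
  have eq: "(\<lambda>s. mu_dens t s * exp (- s * l)) = (\<lambda>s. indicator {0<..} s *\<^sub>R f s)"
    by (auto simp: mu_dens_def f_def fun_eq_iff)
  show ?thesis
    unfolding has_bochner_integral_iff eq
    using int val unfolding set_integrable_def interval_lebesgue_integral_def set_lebesgue_integral_def ei
    by (simp add: a_def field_simps)
qed

section \<open>Recovering a density from its characteristic function\<close>

lemma stable_density_props:
  fixes dens :: "real \<Rightarrow> 'a::euclidean_space \<Rightarrow> 'a \<Rightarrow> real"
  assumes d: "stable_transition_density \<alpha> dens" and s: "0 < s"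
  shows "0 \<le> dens s x 0" "continuous_on UNIV (\<lambda>x. dens s x 0)" "integrable lborel (\<lambda>x. dens s x 0)"
    and "(\<integral>x. cos (\<xi> \<bullet> x) * dens s x 0 \<partial>lborel) = exp (- s * norm \<xi> powr \<alpha>)"
    and "(\<integral>x. sin (\<xi> \<bullet> x) * dens s x 0 \<partial>lborel) = 0"
proof -
  show "0 \<le> dens s x 0" and 1: "continuous_on UNIV (\<lambda>x. dens s x 0)" and 2: "integrable lborel (\<lambda>x. dens s x 0)"
    using d s unfolding stable_transition_density_def by blast+
  have ch: "(\<integral>x. iexp (\<xi> \<bullet> x) * complex_of_real (dens s x 0) \<partial>lborel) = complex_of_real (exp (- s * norm \<xi> powr \<alpha>))"
    using d s unfolding stable_transition_density_def by blast
  have [measurable]: "(\<lambda>x. dens s x 0) \<in> borel_measurable borel"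
    using 1 by (rule borel_measurable_continuous_onI)
  have int: "integrable lborel (\<lambda>x. iexp (\<xi> \<bullet> x) * complex_of_real (dens s x 0))"
    by (rule Bochner_Integration.integrable_bound[OF 2]) (auto simp: norm_mult)
  have "(\<integral>x. Re (iexp (\<xi> \<bullet> x) * complex_of_real (dens s x 0)) \<partial>lborel) = exp (- s * norm \<xi> powr \<alpha>)"
    using integral_Re[OF int] ch by simp
  then show "(\<integral>x. cos (\<xi> \<bullet> x) * dens s x 0 \<partial>lborel) = exp (- s * norm \<xi> powr \<alpha>)"
    by (simp add: Re_exp)
  have "(\<integral>x. Im (iexp (\<xi> \<bullet> x) * complex_of_real (dens s x 0)) \<partial>lborel) = 0"
    using integral_Im[OF int] ch by simp
  then show "(\<integral>x. sin (\<xi> \<bullet> x) * dens s x 0 \<partial>lborel) = 0"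
    by (simp add: Im_exp)
qed

text \<open>Fubini with the heat kernel written as a Fourier integral. The cosine of \<xi> . (x - y)
  splits by the addition formula, and the part with the sine transform of D vanishes.\<close>

lemma gaussian_smoothing_fourier:
  fixes D :: "'a::euclidean_space \<Rightarrow> real"
  assumes D: "integrable lborel D" and e: "0 < e"
    and cosD: "\<And>\<xi>. (\<integral>x. cos (\<xi> \<bullet> x) * D x \<partial>lborel) = \<phi> \<xi>"
    and sinD: "\<And>\<xi>. (\<integral>x. sin (\<xi> \<bullet> x) * D x \<partial>lborel) = 0"
  shows "(\<integral>y. D y * heat e (x - y) \<partial>lborel) = (\<integral>\<xi>. cos (\<xi> \<bullet> x) * \<phi> \<xi> * exp (- e * (norm \<xi>)\<^sup>2) \<partial>lborel) / (2 * pi) ^ DIM('a)"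
proof -
  define P :: real where "P = (2 * pi) ^ DIM('a)"
  have P: "0 < P" by (simp add: P_def)
  have [measurable]: "D \<in> borel_measurable borel" using D by auto
  define f where "f = (\<lambda>y \<xi>::'a. D y * (cos (\<xi> \<bullet> (x - y)) * exp (- e * (norm \<xi>)\<^sup>2)))"
  have eint: "integrable lborel (\<lambda>\<xi>::'a. exp (- e * (norm \<xi>)\<^sup>2))"
    using fourier_gaussian[OF e, of "0::'a"] by (simp add: has_bochner_integral_iff)
  have ci: "integrable lborel (\<lambda>y. cos (\<xi> \<bullet> y) * D y)" "integrable lborel (\<lambda>y. sin (\<xi> \<bullet> y) * D y)" for \<xi>
    by (rule Bochner_Integration.integrable_bound[OF D]; auto simp: abs_mult mult_left_le_one_le)+
  have int: "integrable (lborel \<Otimes>\<^sub>M lborel) (\<lambda>(y, \<xi>). f y \<xi>)"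
  proof (rule Bochner_Integration.integrable_bound[OF integrable_pair_product[OF _ _ D eint]])
    show "(\<lambda>(y, \<xi>). f y \<xi>) \<in> borel_measurable (lborel \<Otimes>\<^sub>M lborel)"
      unfolding f_def by measurable
    have "\<bar>f y \<xi>\<bar> \<le> \<bar>D y * exp (- e * (norm \<xi>)\<^sup>2)\<bar>" for y \<xi>
      unfolding f_def abs_mult by (intro mult_left_mono mult_left_le_one_le) auto
    then show "AE z in lborel \<Otimes>\<^sub>M lborel. norm (case z of (y, \<xi>) \<Rightarrow> f y \<xi>)
          \<le> norm (case z of (y, \<xi>) \<Rightarrow> D y * exp (- e * (norm \<xi>)\<^sup>2))"
      by (auto simp: case_prod_beta')
  qed (unfold_locales)
  have "(\<integral>\<xi>. f y \<xi> \<partial>lborel) = P * (D y * heat e (x - y))" for y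
    using has_bochner_integral_integral_eq[OF fourier_gaussian[OF e, of "x - y"]]
    unfolding f_def by (simp add: P_def)
  then have "P * (\<integral>y. D y * heat e (x - y) \<partial>lborel) = (\<integral>y. (\<integral>\<xi>. f y \<xi> \<partial>lborel) \<partial>lborel)" by simp
  also have "\<dots> = (\<integral>\<xi>. (\<integral>y. f y \<xi> \<partial>lborel) \<partial>lborel)"
    by (rule lborel_pair.Fubini_integral[OF int, symmetric])
  also have "\<dots> = (\<integral>\<xi>. cos (\<xi> \<bullet> x) * \<phi> \<xi> * exp (- e * (norm \<xi>)\<^sup>2) \<partial>lborel)"
  proof (intro Bochner_Integration.integral_cong refl)
    fix \<xi> :: 'a
    have "(\<integral>y. f y \<xi> \<partial>lborel) = (\<integral>y. cos (\<xi> \<bullet> x) * exp (- e * (norm \<xi>)\<^sup>2) * (cos (\<xi> \<bullet> y) * D y)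
        + sin (\<xi> \<bullet> x) * exp (- e * (norm \<xi>)\<^sup>2) * (sin (\<xi> \<bullet> y) * D y) \<partial>lborel)"
      unfolding f_def by (intro Bochner_Integration.integral_cong refl) (simp add: inner_diff_right cos_diff algebra_simps)
    also have "\<dots> = cos (\<xi> \<bullet> x) * exp (- e * (norm \<xi>)\<^sup>2) * \<phi> \<xi>"
      using ci by (subst Bochner_Integration.integral_add) (auto simp: cosD sinD)
    finally show "(\<integral>y. f y \<xi> \<partial>lborel) = cos (\<xi> \<bullet> x) * \<phi> \<xi> * exp (- e * (norm \<xi>)\<^sup>2)" by simp
  qed
  finally show ?thesis using P by (simp add: field_simps P_def)
qed

text \<open>Boundedness of \<open>D\<close> is not assumed: it follows from Fatou's lemma, and only then does
  dominated convergence identify the limit of the Gaussian regularizations.\<close>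

lemma fourier_inversion:
  fixes D :: "'a::euclidean_space \<Rightarrow> real"
  assumes D: "integrable lborel D" and cont: "continuous_on UNIV D" and D0: "\<And>x. 0 \<le> D x"
    and cosD: "\<And>\<xi>. (\<integral>x. cos (\<xi> \<bullet> x) * D x \<partial>lborel) = \<phi> \<xi>"
    and sinD: "\<And>\<xi>. (\<integral>x. sin (\<xi> \<bullet> x) * D x \<partial>lborel) = 0"
    and \<phi>: "integrable lborel \<phi>"
  shows "D x = (\<integral>\<xi>. cos (\<xi> \<bullet> x) * \<phi> \<xi> \<partial>lborel) / (2 * pi) ^ DIM('a)"
proof -
  define P :: real where "P = (2 * pi) ^ DIM('a)"
  have P: "0 < P" by (simp add: P_def)
  have [measurable]: "D \<in> borel_measurable borel" "\<phi> \<in> borel_measurable borel" using D \<phi> by auto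
  define C where "C = (\<integral>\<xi>. \<bar>\<phi> \<xi>\<bar> \<partial>lborel) / P"
  define c where "c n = inverse (real (Suc n))" for n
  have c: "0 < c n" for n by (simp add: c_def)
  have c0: "c \<longlonglongrightarrow> 0" unfolding c_def by (rule LIMSEQ_inverse_real_of_nat)
  \<comment> \<open>Smoothing at time c_n^2, with the scale moved into the argument of D: the weight
    \<open>heat 1\<close> stays fixed while D (x - c_n z) converges pointwise.\<close>
  define S where "S x n = (\<integral>z. D (x - c n *\<^sub>R z) * heat 1 z \<partial>lborel)" for x n
  have heat_scale: "c n ^ DIM('a) * heat ((c n)\<^sup>2) (c n *\<^sub>R z) = heat 1 z" for n and z :: 'a
  proof -
    have "(4 * pi * (c n)\<^sup>2) powr (- real DIM('a) / 2) = (4 * pi) powr (- real DIM('a) / 2) * ((c n)\<^sup>2) powr (- real DIM('a) / 2)"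
      by (rule powr_mult)
    also have "((c n)\<^sup>2) powr (- real DIM('a) / 2) = inverse (c n ^ DIM('a))"
      using c[of n] by (simp only: power2_powr_half) (simp add: powr_minus powr_realpow)
    finally have "c n ^ DIM('a) * (4 * pi * (c n)\<^sup>2) powr (- real DIM('a) / 2) = (4 * pi) powr (- real DIM('a) / 2)"
      using c[of n] by simp
    moreover have "(norm (c n *\<^sub>R z))\<^sup>2 / (4 * (c n)\<^sup>2) = (norm z)\<^sup>2 / (4 * 1)"
      using c[of n] by (simp add: power_mult_distrib)
    ultimately show ?thesis unfolding heat_def by (simp add: mult.assoc[symmetric])
  qed
  have S_eq: "S x n = (\<integral>y. D y * heat ((c n)\<^sup>2) (x - y) \<partial>lborel)" for x n
  proof -
    have "(\<integral>y. D y * heat ((c n)\<^sup>2) (x - y) \<partial>lborel) = (\<integral>y. D (x - y) * heat ((c n)\<^sup>2) y \<partial>lborel)"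
    proof -
      have "(\<integral>y. D y * heat ((c n)\<^sup>2) (x - y) \<partial>lborel)
         = (\<integral>y. D y * heat ((c n)\<^sup>2) (x - y) \<partial>density (distr lborel borel (\<lambda>y. x + (-1) *\<^sub>R y)) (\<lambda>_. ennreal (\<bar>-1::real\<bar> ^ DIM('a))))"
        using lborel_affine[of "-1" x] by simp
      also have "\<dots> = (\<integral>y. D (x - y) * heat ((c n)\<^sup>2) y \<partial>lborel)"
        by (simp add: density_1 integral_distr)
      finally show ?thesis .
    qed
    also have "\<dots> = c n ^ DIM('a) * (\<integral>z. D (x - c n *\<^sub>R z) * heat ((c n)\<^sup>2) (c n *\<^sub>R z) \<partial>lborel)"
      using c[of n] by (intro integral_dilate) auto
    also have "\<dots> = (\<integral>z. D (x - c n *\<^sub>R z) * (c n ^ DIM('a) * heat ((c n)\<^sup>2) (c n *\<^sub>R z)) \<partial>lborel)"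
      by (simp flip: integral_mult_right_zero add: mult_ac)
    finally show ?thesis by (simp only: heat_scale S_def)
  qed
  have S_val: "S x n = (\<integral>\<xi>. cos (\<xi> \<bullet> x) * \<phi> \<xi> * exp (- (c n)\<^sup>2 * (norm \<xi>)\<^sup>2) \<partial>lborel) / P" for x n
    unfolding S_eq P_def using c[of n] by (intro gaussian_smoothing_fourier D cosD sinD) auto
  have bd: "norm (cos (\<xi> \<bullet> x) * \<phi> \<xi> * exp (- (c n)\<^sup>2 * (norm \<xi>)\<^sup>2)) \<le> \<bar>\<phi> \<xi>\<bar>" for \<xi> x n
  proof -
    have "\<bar>cos (\<xi> \<bullet> x)\<bar> * \<bar>\<phi> \<xi>\<bar> * exp (- (c n)\<^sup>2 * (norm \<xi>)\<^sup>2) \<le> 1 * \<bar>\<phi> \<xi>\<bar> * 1"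
      by (intro mult_mono) auto
    then show ?thesis by (simp add: abs_mult)
  qed
  have S_le: "S x n \<le> C" for x n
  proof -
    have "\<bar>\<integral>\<xi>. cos (\<xi> \<bullet> x) * \<phi> \<xi> * exp (- (c n)\<^sup>2 * (norm \<xi>)\<^sup>2) \<partial>lborel\<bar> \<le> (\<integral>\<xi>. \<bar>\<phi> \<xi>\<bar> \<partial>lborel)"
    proof (rule order_trans[OF integral_abs_bound integral_mono])
      show "integrable lborel (\<lambda>\<xi>. \<bar>cos (\<xi> \<bullet> x) * \<phi> \<xi> * exp (- (c n)\<^sup>2 * (norm \<xi>)\<^sup>2)\<bar>)"
        by (intro integrable_abs Bochner_Integration.integrable_bound[OF \<phi>]) (use bd in auto)
    qed (use bd \<phi> in auto)
    then show ?thesis unfolding S_val C_def using P by (simp add: divide_right_mono abs_le_iff)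
  qed
  have lim_pt: "(\<lambda>n. D (x - c n *\<^sub>R z) * heat 1 z) \<longlonglongrightarrow> D x * heat 1 z" for x z
  proof -
    have "(\<lambda>n. x - c n *\<^sub>R z) \<longlonglongrightarrow> x - 0 *\<^sub>R z" by (intro tendsto_intros c0)
    then have "(\<lambda>n. D (x - c n *\<^sub>R z)) \<longlonglongrightarrow> D x"
      using cont by (intro isCont_tendsto_compose[of x D]) (auto simp: continuous_on_eq_continuous_at)
    then show ?thesis by (intro tendsto_intros)
  qed
  have hp: "0 \<le> heat 1 z" for z :: 'a using heat_pos[of 1 z] by simp
  have D_le: "D x \<le> C" for x
  proof -
    have Sint: "integrable lborel (\<lambda>z. D (x - c n *\<^sub>R z) * heat 1 z)" for n
    proof (rule Bochner_Integration.integrable_bound)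
      show "integrable lborel (\<lambda>z. D (x - c n *\<^sub>R z) * (4 * pi) powr (- real DIM('a) / 2))"
      proof (intro integrable_mult_left integrableI_nonneg)
        have "(\<integral>\<^sup>+z. ennreal (D (x - z)) \<partial>lborel) = ennreal (c n ^ DIM('a)) * (\<integral>\<^sup>+z. ennreal (D (x - c n *\<^sub>R z)) \<partial>lborel)"
          using c[of n] by (intro nn_integral_dilate) auto
        moreover have "(\<integral>\<^sup>+z. ennreal (D (x - z)) \<partial>lborel) < \<infinity>"
        proof -
          have "(\<integral>\<^sup>+z. ennreal (D z) \<partial>lborel) = (\<integral>\<^sup>+z. ennreal (D z) \<partial>density (distr lborel borel (\<lambda>y. x + (-1) *\<^sub>R y)) (\<lambda>_. \<bar>-1::real\<bar> ^ DIM('a)))"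
            using lborel_affine[of "-1" x] by simp
          also have "\<dots> = (\<integral>\<^sup>+z. ennreal (D (x - z)) \<partial>lborel)"
            by (simp add: density_1 nn_integral_distr)
          finally show ?thesis using D D0 by (simp add: integrable_iff_bounded)
        qed
        ultimately show "(\<integral>\<^sup>+z. ennreal (D (x - c n *\<^sub>R z)) \<partial>lborel) < \<infinity>"
          using c[of n] by (auto simp: ennreal_mult_less_top less_top[symmetric] ennreal_mult_eq_top_iff)
      qed (use D0 in auto)
      have "heat 1 z \<le> (4 * pi) powr (- real DIM('a) / 2)" for z :: 'a
        unfolding heat_def by (simp add: mult_left_le)
      then show "AE z in lborel. norm (D (x - c n *\<^sub>R z) * heat 1 z) \<le> norm (D (x - c n *\<^sub>R z) * (4 * pi) powr (- real DIM('a) / 2))"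
        using D0 hp by (auto simp: abs_mult intro!: mult_left_mono)
    qed simp
    have "ennreal (D x) = (\<integral>\<^sup>+z. ennreal (D x) * ennreal (heat 1 (z::'a)) \<partial>lborel)"
      using heat_total[of 1, where 'a = 'a] hp
      by (subst nn_integral_cmult) (auto simp: nn_integral_eq_integral)
    also have "\<dots> = (\<integral>\<^sup>+z. liminf (\<lambda>n. ennreal (D (x - c n *\<^sub>R z) * heat 1 z)) \<partial>lborel)"
    proof (intro nn_integral_cong)
      fix z :: 'a
      have "(\<lambda>n. ennreal (D (x - c n *\<^sub>R z) * heat 1 z)) \<longlonglongrightarrow> ennreal (D x * heat 1 z)"
        by (intro tendsto_ennrealI lim_pt)
      then show "ennreal (D x) * ennreal (heat 1 z) = liminf (\<lambda>n. ennreal (D (x - c n *\<^sub>R z) * heat 1 z))"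
        using D0 hp by (simp add: lim_imp_Liminf ennreal_mult)
    qed
    also have "\<dots> \<le> liminf (\<lambda>n. \<integral>\<^sup>+z. ennreal (D (x - c n *\<^sub>R z) * heat 1 z) \<partial>lborel)"
      by (rule nn_integral_liminf) measurable
    also have "\<dots> = liminf (\<lambda>n. ennreal (S x n))"
      unfolding S_def using D0 hp Sint by (subst nn_integral_eq_integral) auto
    also have "\<dots> \<le> liminf (\<lambda>n::nat. ennreal C)"
      by (intro Liminf_mono always_eventually allI ennreal_leI S_le)
    also have "\<dots> = ennreal C" by (simp add: Liminf_const)
    finally show ?thesis
      using P by (subst (asm) ennreal_le_iff) (auto simp: C_def intro!: divide_nonneg_pos integral_nonneg_AE)
  qed
  have "S x \<longlonglongrightarrow> (\<integral>z. D x * heat 1 (z::'a) \<partial>lborel)"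
    unfolding S_def[abs_def]
  proof (rule integral_dominated_convergence[where w = "\<lambda>z. C * heat 1 z"])
    show "integrable lborel (\<lambda>z. C * heat 1 (z::'a))" using heat_total[of 1, where 'a = 'a] by simp
    show "AE z in lborel. norm (D (x - c n *\<^sub>R z) * heat 1 z) \<le> C * heat 1 z" for n
      using D0 hp D_le by (auto simp: abs_mult intro!: mult_right_mono)
  qed (auto intro: lim_pt)
  also have "(\<integral>z. D x * heat 1 (z::'a) \<partial>lborel) = D x"
    using heat_total[of 1, where 'a = 'a] by simp
  finally have 1: "S x \<longlonglongrightarrow> D x" .
  have 2: "S x \<longlonglongrightarrow> (\<integral>\<xi>. cos (\<xi> \<bullet> x) * \<phi> \<xi> \<partial>lborel) / P"
    unfolding S_val[abs_def]
  proof (intro tendsto_divide tendsto_const integral_dominated_convergence[where w = "\<lambda>\<xi>. \<bar>\<phi> \<xi>\<bar>"])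
    show "AE \<xi> in lborel. (\<lambda>n. cos (\<xi> \<bullet> x) * \<phi> \<xi> * exp (- (c n)\<^sup>2 * (norm \<xi>)\<^sup>2)) \<longlonglongrightarrow> cos (\<xi> \<bullet> x) * \<phi> \<xi>"
    proof (rule AE_I2)
      fix \<xi> :: 'a
      have "(\<lambda>n. cos (\<xi> \<bullet> x) * \<phi> \<xi> * exp (- (c n)\<^sup>2 * (norm \<xi>)\<^sup>2)) \<longlonglongrightarrow> cos (\<xi> \<bullet> x) * \<phi> \<xi> * exp (- 0\<^sup>2 * (norm \<xi>)\<^sup>2)"
        by (intro tendsto_mult tendsto_const tendsto_exp tendsto_minus tendsto_power c0)
      then show "(\<lambda>n. cos (\<xi> \<bullet> x) * \<phi> \<xi> * exp (- (c n)\<^sup>2 * (norm \<xi>)\<^sup>2)) \<longlonglongrightarrow> cos (\<xi> \<bullet> x) * \<phi> \<xi>" by simp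
    qed
  qed (use bd \<phi> P in auto)
  show ?thesis using LIMSEQ_unique[OF 1 2] by (simp add: P_def)
qed

section \<open>Subordination and the semigroup of index \<alpha> / 2\<close>

lemma measurable_stable_kernel [measurable (raw)]:
  fixes h :: "'b \<Rightarrow> 'a::euclidean_space"
  assumes [measurable]: "f \<in> borel_measurable M" "h \<in> borel_measurable M"
  shows "(\<lambda>x. stable_kernel g (f x) (h x)) \<in> borel_measurable M"
  unfolding stable_kernel_def by measurable

lemma stable_kernel_minus: "stable_kernel g t (- x) = stable_kernel g t x"
  by (simp add: stable_kernel_def)

lemma stable_kernel_bounded:
  assumes "0 < g" "0 < t"
  shows "\<exists>M. \<forall>x::'a::euclidean_space. \<bar>stable_kernel g t x\<bar> \<le> M"
proof (intro exI allI)
  fix x :: 'a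
  have i: "integrable lborel (\<lambda>\<xi>::'a. exp (- t * norm \<xi> powr g))"
    using integrable_norm_stretched_exp[OF assms(2,1), of 0, where 'a = 'a] by simp
  have "\<bar>\<integral>\<xi>. cos (\<xi> \<bullet> x) * exp (- t * norm \<xi> powr g) \<partial>lborel\<bar> \<le> (\<integral>\<xi>. exp (- t * norm (\<xi>::'a) powr g) \<partial>lborel)"
  proof (rule order_trans[OF integral_abs_bound integral_mono])
    show "integrable lborel (\<lambda>\<xi>. \<bar>cos (\<xi> \<bullet> x) * exp (- t * norm \<xi> powr g)\<bar>)"
      using stable_kernel_integrable[OF assms(2,1), of x] by (rule integrable_abs)
    show "\<bar>cos (\<xi> \<bullet> x) * exp (- t * norm \<xi> powr g)\<bar> \<le> exp (- t * norm \<xi> powr g)" for \<xi>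
      by (simp add: abs_mult mult_left_le_one_le)
  qed (rule i)
  then show "\<bar>stable_kernel g t x\<bar> \<le> (\<integral>\<xi>. exp (- t * norm (\<xi>::'a) powr g) \<partial>lborel) / (2 * pi) ^ DIM('a)"
    unfolding stable_kernel_def by (simp add: abs_divide divide_right_mono)
qed

text \<open>The continuity demanded of the density makes the identity hold at every point and not
  only almost everywhere.\<close>

lemma stable_density_eq:
  fixes dens :: "real \<Rightarrow> 'a::euclidean_space \<Rightarrow> 'a \<Rightarrow> real"
  assumes \<alpha>: "0 < \<alpha>" and d: "stable_transition_density \<alpha> dens" and s: "0 < s"
  shows "dens s x 0 = stable_kernel \<alpha> s x"
proof -
  note p = stable_density_props[OF d s]
  have "integrable lborel (\<lambda>\<xi>::'a. exp (- s * norm \<xi> powr \<alpha>))"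
    using integrable_norm_stretched_exp[OF s \<alpha>, of 0, where 'a = 'a] by simp
  from fourier_inversion[OF p(3) p(2) p(1) p(4) p(5) this] show ?thesis
    by (simp add: stable_kernel_def)
qed

lemma sqrt_powr: "0 \<le> y \<Longrightarrow> sqrt (y powr a) = y powr (a / 2)" for a y :: real
  by (simp add: powr_half_sqrt[symmetric] powr_powr)

text \<open>The Laplace formula of \<open>mu_dens\<close> at l = |\<xi>|^\<alpha>, whose square root
  is |\<xi>|^(\<alpha>/2), put under the Fourier integral.\<close>

lemma stable_kernel_subordination:
  fixes x :: "'a::euclidean_space"
  assumes \<alpha>: "0 < \<alpha>" and t: "0 < t"
  shows "stable_kernel (\<alpha> / 2) t x = (\<integral>s. mu_dens t s * stable_kernel \<alpha> s x \<partial>lborel)"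
proof -
  define P :: real where "P = (2 * pi) ^ DIM('a)"
  have P: "0 < P" by (simp add: P_def)
  define f where "f = (\<lambda>(\<xi>::'a) s. cos (\<xi> \<bullet> x) * (mu_dens t s * exp (- s * norm \<xi> powr \<alpha>)))"
  have lap: "has_bochner_integral lborel (\<lambda>s. mu_dens t s * exp (- s * norm \<xi> powr \<alpha>)) (exp (- t * norm \<xi> powr (\<alpha> / 2)))" for \<xi> :: 'a
    using mu_dens_laplace[OF t, of "norm \<xi> powr \<alpha>"] by (simp add: sqrt_powr)
  have int: "integrable (lborel \<Otimes>\<^sub>M lborel) (\<lambda>(\<xi>, s). f \<xi> s)"
  proof (rule lborel_pair.Fubini_integrable)
    show "(\<lambda>(\<xi>, s). f \<xi> s) \<in> borel_measurable (lborel \<Otimes>\<^sub>M lborel)"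
      unfolding f_def by measurable
    have "(\<integral>s. norm (f \<xi> s) \<partial>lborel) = \<bar>cos (\<xi> \<bullet> x) * exp (- t * norm \<xi> powr (\<alpha> / 2))\<bar>" for \<xi>
    proof -
      have "norm (f \<xi> s) = \<bar>cos (\<xi> \<bullet> x)\<bar> * (mu_dens t s * exp (- s * norm \<xi> powr \<alpha>))" for s
        using mu_dens_nonneg[OF t, of s] by (simp add: f_def abs_mult)
      then show ?thesis using has_bochner_integral_integral_eq[OF lap[of \<xi>]] by (simp add: abs_mult)
    qed
    then show "integrable lborel (\<lambda>\<xi>. \<integral>s. norm (case (\<xi>, s) of (\<xi>, s) \<Rightarrow> f \<xi> s) \<partial>lborel)"
      using integrable_abs[OF stable_kernel_integrable[OF t, of "\<alpha> / 2" x]] \<alpha> by simp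
    show "AE \<xi> in lborel. integrable lborel (\<lambda>s. case (\<xi>, s) of (\<xi>, s) \<Rightarrow> f \<xi> s)"
      unfolding f_def using integrable.intros[OF lap] by simp
  qed
  have "P * stable_kernel (\<alpha> / 2) t x = (\<integral>\<xi>. (\<integral>s. f \<xi> s \<partial>lborel) \<partial>lborel)"
    unfolding stable_kernel_def P_def[symmetric] using P has_bochner_integral_integral_eq[OF lap] by (simp add: f_def)
  also have "\<dots> = (\<integral>s. (\<integral>\<xi>. f \<xi> s \<partial>lborel) \<partial>lborel)"
    by (rule lborel_pair.Fubini_integral[OF int, symmetric])
  also have "\<dots> = (\<integral>s. P * (mu_dens t s * stable_kernel \<alpha> s x) \<partial>lborel)"
  proof (intro Bochner_Integration.integral_cong refl)
    fix s
    have "(\<integral>\<xi>. f \<xi> s \<partial>lborel) = (\<integral>\<xi>. mu_dens t s * (cos (\<xi> \<bullet> x) * exp (- s * norm \<xi> powr \<alpha>)) \<partial>lborel)"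
      unfolding f_def by (intro Bochner_Integration.integral_cong refl) simp
    then show "(\<integral>\<xi>. f \<xi> s \<partial>lborel) = P * (mu_dens t s * stable_kernel \<alpha> s x)"
      using P by (simp add: stable_kernel_def P_def)
  qed
  finally show ?thesis using P by simp
qed

lemma q_dens_eq:
  fixes dens :: "real \<Rightarrow> 'a::euclidean_space \<Rightarrow> 'a \<Rightarrow> real"
  assumes \<alpha>: "0 < \<alpha>" and d: "stable_transition_density \<alpha> dens" and t: "0 < t"
  shows "q_dens dens t x = stable_kernel (\<alpha> / 2) t x"
proof -
  have "q_dens dens t x = (\<integral>s. indicator {0<..} s * stable_kernel \<alpha> s x \<partial>mu_meas t)"
    unfolding q_dens_def set_lebesgue_integral_def
    using stable_density_eq[OF \<alpha> d]
    by (intro Bochner_Integration.integral_cong refl) (auto split: split_indicator)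
  also have "\<dots> = (\<integral>s. mu_dens t s * (indicator {0<..} s * stable_kernel \<alpha> s x) \<partial>lborel)"
    unfolding mu_meas_def mu_dens_def[symmetric]
    using mu_dens_nonneg[OF t] by (subst integral_density) auto
  also have "\<dots> = (\<integral>s. mu_dens t s * stable_kernel \<alpha> s x \<partial>lborel)"
    by (intro Bochner_Integration.integral_cong refl) (simp add: mu_dens_def split: split_indicator)
  finally show ?thesis using stable_kernel_subordination[OF \<alpha> t, of x] by simp
qed

text \<open>The cosine integral does not reveal its sign. Nonnegativity is inherited from the given
  densities of index \<alpha>, since the mixing density is nonnegative.\<close>

lemma stable_kernel_nonneg:
  fixes dens :: "real \<Rightarrow> 'a::euclidean_space \<Rightarrow> 'a \<Rightarrow> real"
  assumes \<alpha>: "0 < \<alpha>" and d: "stable_transition_density \<alpha> dens" and t: "0 < t"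
  shows "0 \<le> stable_kernel (\<alpha> / 2) t (x :: 'a)"
  unfolding stable_kernel_subordination[OF \<alpha> t]
proof (intro integral_nonneg_AE AE_I2)
  fix s
  show "0 \<le> mu_dens t s * stable_kernel \<alpha> s x"
  proof (cases "0 < s")
    case True
    then show ?thesis
      using stable_density_props(1)[OF d True, of x] stable_density_eq[OF \<alpha> d True, of x] mu_dens_nonneg[OF t, of s]
      by simp
  qed (simp add: mu_dens_def)
qed

text \<open>Being an inverse transform does not make the kernel integrable. Integrability is again
  inherited from the densities of index \<alpha>, each of mass one, so that the double integral over
  (s, x) is bounded by the mass of \<open>mu_dens t\<close>.\<close>

lemma stable_kernel_fourier:
  fixes dens :: "real \<Rightarrow> 'a::euclidean_space \<Rightarrow> 'a \<Rightarrow> real" and \<xi> :: 'a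
  assumes \<alpha>: "0 < \<alpha>" and d: "stable_transition_density \<alpha> dens" and t: "0 < t"
  shows "integrable lborel (stable_kernel (\<alpha> / 2) t :: 'a \<Rightarrow> real)"
    and "(\<integral>x. cos (\<xi> \<bullet> x) * stable_kernel (\<alpha> / 2) t x \<partial>lborel) = exp (- t * norm \<xi> powr (\<alpha> / 2))"
proof -
  have lap: "has_bochner_integral lborel (\<lambda>s. mu_dens t s * exp (- s * norm \<xi> powr \<alpha>)) (exp (- t * norm \<xi> powr (\<alpha> / 2)))" for \<xi> :: 'a
    using mu_dens_laplace[OF t, of "norm \<xi> powr \<alpha>"] by (simp add: sqrt_powr)
  have mu_int: "integrable lborel (mu_dens t)"
    using integrable.intros[OF lap[of 0]] \<alpha> by simp
  have p: "0 \<le> stable_kernel \<alpha> s x" "integrable lborel (stable_kernel \<alpha> s :: 'a \<Rightarrow> real)"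
    "(\<integral>x. cos (\<xi> \<bullet> x) * stable_kernel \<alpha> s x \<partial>lborel) = exp (- s * norm \<xi> powr \<alpha>)" if "0 < s" for s and x \<xi> :: 'a
    using stable_density_props[OF d that] by (simp_all add: stable_density_eq[OF \<alpha> d that] cong: Bochner_Integration.integrable_cong)
  have int: "integrable (lborel \<Otimes>\<^sub>M lborel) (\<lambda>(s, x). mu_dens t s * (cos (\<xi> \<bullet> x) * stable_kernel \<alpha> s x))" for \<xi> :: 'a
  proof (rule lborel_pair.Fubini_integrable)
    show "(\<lambda>(s, x). mu_dens t s * (cos (\<xi> \<bullet> x) * stable_kernel \<alpha> s x)) \<in> borel_measurable (lborel \<Otimes>\<^sub>M lborel)"
      by measurable
    have i: "integrable lborel (\<lambda>x::'a. cos (\<xi> \<bullet> x) * stable_kernel \<alpha> s x)" if "0 < s" for s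
      by (rule Bochner_Integration.integrable_bound[OF p(2)[OF that]]) (auto simp: abs_mult mult_left_le_one_le)
    have le: "norm (\<integral>x. norm (mu_dens t s * (cos (\<xi> \<bullet> x) * stable_kernel \<alpha> s x)) \<partial>lborel) \<le> norm (mu_dens t s)" for s
    proof (cases "0 < s")
      case True
      have "(\<integral>x. \<bar>cos (\<xi> \<bullet> x) * stable_kernel \<alpha> s x\<bar> \<partial>lborel) \<le> (\<integral>x. stable_kernel \<alpha> s (x::'a) \<partial>lborel)"
        using p(1,2)[OF True] i[OF True]
        by (intro integral_mono integrable_abs) (auto simp: abs_mult mult_left_le_one_le)
      also have "\<dots> = 1" using p(3)[OF True, of 0] \<alpha> by simp
      finally have "\<bar>mu_dens t s\<bar> * (\<integral>x. \<bar>cos (\<xi> \<bullet> x) * stable_kernel \<alpha> s x\<bar> \<partial>lborel) \<le> \<bar>mu_dens t s\<bar> * 1"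
        by (intro mult_left_mono) auto
      moreover have "0 \<le> (\<integral>x. \<bar>cos (\<xi> \<bullet> x) * stable_kernel \<alpha> s x\<bar> \<partial>lborel)"
        by (intro integral_nonneg_AE) auto
      ultimately show ?thesis by (simp add: abs_mult[of "mu_dens t s"])
    qed (simp add: mu_dens_def)
    show "integrable lborel (\<lambda>s. \<integral>x. norm (case (s, x) of (s, x) \<Rightarrow> mu_dens t s * (cos (\<xi> \<bullet> x) * stable_kernel \<alpha> s x)) \<partial>lborel)"
      by (rule Bochner_Integration.integrable_bound[OF mu_int]) (use le in auto)
    show "AE s in lborel. integrable lborel (\<lambda>x. case (s, x) of (s, x) \<Rightarrow> mu_dens t s * (cos (\<xi> \<bullet> x) * stable_kernel \<alpha> s x))"
    proof (rule AE_I2)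
      fix s show "integrable lborel (\<lambda>x. case (s, x) of (s, x) \<Rightarrow> mu_dens t s * (cos (\<xi> \<bullet> x) * stable_kernel \<alpha> s x))"
        using i[of s] by (cases "0 < s") (simp_all add: mu_dens_def)
    qed
  qed
  have eq: "(\<integral>s. mu_dens t s * (cos (\<xi> \<bullet> x) * stable_kernel \<alpha> s x) \<partial>lborel) = cos (\<xi> \<bullet> x) * stable_kernel (\<alpha> / 2) t x" for x \<xi> :: 'a
    unfolding stable_kernel_subordination[OF \<alpha> t] by (simp flip: integral_mult_right_zero add: mult_ac)
  show "integrable lborel (stable_kernel (\<alpha> / 2) t :: 'a \<Rightarrow> real)"
    using lborel_pair.integrable_snd[OF int[of 0]] unfolding eq by simp
  have "(\<integral>x. cos (\<xi> \<bullet> x) * stable_kernel (\<alpha> / 2) t x \<partial>lborel) = (\<integral>s. (\<integral>x. mu_dens t s * (cos (\<xi> \<bullet> x) * stable_kernel \<alpha> s x) \<partial>lborel) \<partial>lborel)"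
    unfolding eq[symmetric] by (rule lborel_pair.Fubini_integral[OF int])
  also have "\<dots> = (\<integral>s. mu_dens t s * exp (- s * norm \<xi> powr \<alpha>) \<partial>lborel)"
  proof (intro Bochner_Integration.integral_cong refl)
    fix s show "(\<integral>x. mu_dens t s * (cos (\<xi> \<bullet> x) * stable_kernel \<alpha> s x) \<partial>lborel) = mu_dens t s * exp (- s * norm \<xi> powr \<alpha>)"
      using p(3)[of s \<xi>] by (cases "0 < s") (simp_all add: mu_dens_def)
  qed
  also have "\<dots> = exp (- t * norm \<xi> powr (\<alpha> / 2))"
    by (rule has_bochner_integral_integral_eq[OF lap])
  finally show "(\<integral>x. cos (\<xi> \<bullet> x) * stable_kernel (\<alpha> / 2) t x \<partial>lborel) = exp (- t * norm \<xi> powr (\<alpha> / 2))" .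
qed

lemma integral_odd_eq_0:
  fixes f :: "'a::euclidean_space \<Rightarrow> real"
  assumes [measurable]: "f \<in> borel_measurable borel" and odd: "\<And>x. f (- x) = - f x"
  shows "(\<integral>x. f x \<partial>lborel) = 0"
proof -
  have "(\<integral>x. f x \<partial>lborel) = (\<integral>x. f x \<partial>density (distr lborel borel (\<lambda>y. 0 + (-1) *\<^sub>R y)) (\<lambda>_. ennreal (\<bar>-1::real\<bar> ^ DIM('a))))"
    using lborel_affine[of "-1" "0::'a"] by simp
  also have "\<dots> = (\<integral>x. f (- x) \<partial>lborel)"
    by (simp add: density_1 integral_distr)
  also have "\<dots> = - (\<integral>x. f x \<partial>lborel)" by (simp add: odd)
  finally show ?thesis by simp
qed

text \<open>For the semigroup law only the kernel at time s is written as a Fourier integral. After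
  Fubini the integral over y is the transform of the kernel at time t, and the exponentials
  multiply.\<close>

theorem stable_kernel_convolution_semigroup:
  fixes dens :: "real \<Rightarrow> 'a::euclidean_space \<Rightarrow> 'a \<Rightarrow> real"
  assumes \<alpha>: "0 < \<alpha>" and d: "stable_transition_density \<alpha> dens"
  shows "convolution_semigroup (stable_kernel (\<alpha> / 2) :: real \<Rightarrow> 'a \<Rightarrow> real)"
proof
  let ?k = "stable_kernel (\<alpha> / 2) :: real \<Rightarrow> 'a \<Rightarrow> real"
  note nn = stable_kernel_nonneg[OF \<alpha> d]
  note four = stable_kernel_fourier[OF \<alpha> d]
  have a2: "0 < \<alpha> / 2" using \<alpha> by simp
  show "(\<lambda>(t, x). ?k t x) \<in> borel_measurable borel"
  proof -
    have "(\<lambda>z. ?k (fst z) (snd z)) \<in> borel_measurable (borel \<Otimes>\<^sub>M borel)" by measurable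
    then show ?thesis by (simp add: borel_prod case_prod_beta')
  qed
  show "0 \<le> ?k t x" if "0 < t" for t x by (rule nn[OF that])
  show "(\<integral>\<^sup>+x. ennreal (?k t x) \<partial>lborel) = 1" if "0 < t" for t
    using four(1)[OF that] four(2)[OF that, of 0] nn[OF that] \<alpha> by (simp add: nn_integral_eq_integral)
  show "?k t (- x) = ?k t x" if "0 < t" for t x by (rule stable_kernel_minus)
  show "\<exists>M. \<forall>x. ?k t x \<le> M" if "0 < t" for t
    using stable_kernel_bounded[OF a2 that, where 'a = 'a] by (auto simp: abs_le_iff)
  show "(\<integral>\<^sup>+y. ennreal (?k s (x - y)) * ennreal (?k t y) \<partial>lborel) = ennreal (?k (s + t) x)"
    if s: "0 < s" and t: "0 < t" for s t x
  proof -
    define P :: real where "P = (2 * pi) ^ DIM('a)"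
    have P: "0 < P" by (simp add: P_def)
    obtain M where M: "\<And>x. \<bar>?k s x\<bar> \<le> M" using stable_kernel_bounded[OF a2 s, where 'a = 'a] by blast
    have M0: "0 \<le> M" using order_trans[OF abs_ge_zero M] .
    have i1: "integrable lborel (\<lambda>y. ?k s (x - y) * ?k t y)"
    proof (rule Bochner_Integration.integrable_bound[OF integrable_mult_right[OF four(1)[OF t], of M]])
      show "AE y in lborel. norm (?k s (x - y) * ?k t y) \<le> norm (M * ?k t y)"
        using M M0 by (auto simp: abs_mult intro!: mult_right_mono)
    qed measurable
    define f where "f = (\<lambda>y \<xi>::'a. ?k t y * (cos (\<xi> \<bullet> (x - y)) * exp (- s * norm \<xi> powr (\<alpha> / 2))))"
    have eint: "integrable lborel (\<lambda>\<xi>::'a. exp (- s * norm \<xi> powr (\<alpha> / 2)))"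
      using integrable_norm_stretched_exp[OF s a2, of 0, where 'a = 'a] by simp
    have int: "integrable (lborel \<Otimes>\<^sub>M lborel) (\<lambda>(y, \<xi>). f y \<xi>)"
    proof (rule Bochner_Integration.integrable_bound[OF integrable_pair_product[OF _ _ four(1)[OF t] eint]])
      show "(\<lambda>(y, \<xi>). f y \<xi>) \<in> borel_measurable (lborel \<Otimes>\<^sub>M lborel)"
        unfolding f_def by measurable
      have "\<bar>f y \<xi>\<bar> \<le> \<bar>?k t y * exp (- s * norm \<xi> powr (\<alpha> / 2))\<bar>" for y \<xi>
        unfolding f_def abs_mult by (intro mult_left_mono mult_left_le_one_le) auto
      then show "AE z in lborel \<Otimes>\<^sub>M lborel. norm (case z of (y, \<xi>) \<Rightarrow> f y \<xi>)
          \<le> norm (case z of (y, \<xi>) \<Rightarrow> ?k t y * exp (- s * norm \<xi> powr (\<alpha> / 2)))"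
        by (auto simp: case_prod_beta')
    qed (unfold_locales)
    have ci: "integrable lborel (\<lambda>y. cos (\<xi> \<bullet> y) * ?k t y)" "integrable lborel (\<lambda>y. sin (\<xi> \<bullet> y) * ?k t y)" for \<xi>
      by (rule Bochner_Integration.integrable_bound[OF four(1)[OF t]]; auto simp: abs_mult mult_left_le_one_le)+
    have sin0: "(\<integral>y. sin (\<xi> \<bullet> y) * ?k t y \<partial>lborel) = 0" for \<xi>
      by (rule integral_odd_eq_0) (auto simp: stable_kernel_minus)
    have "P * (\<integral>y. ?k s (x - y) * ?k t y \<partial>lborel) = (\<integral>y. (\<integral>\<xi>. f y \<xi> \<partial>lborel) \<partial>lborel)"
    proof -
      have "(\<integral>\<xi>. f y \<xi> \<partial>lborel) = P * (?k s (x - y) * ?k t y)" for y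
        using P unfolding f_def stable_kernel_def[of "\<alpha> / 2" s] P_def[symmetric] by simp
      then show ?thesis by simp
    qed
    also have "\<dots> = (\<integral>\<xi>. (\<integral>y. f y \<xi> \<partial>lborel) \<partial>lborel)"
      by (rule lborel_pair.Fubini_integral[OF int, symmetric])
    also have "\<dots> = (\<integral>\<xi>. cos (\<xi> \<bullet> x) * exp (- (s + t) * norm \<xi> powr (\<alpha> / 2)) \<partial>lborel)"
    proof (intro Bochner_Integration.integral_cong refl)
      fix \<xi> :: 'a
      define E where "E = exp (- s * norm \<xi> powr (\<alpha> / 2))"
      have "(\<integral>y. f y \<xi> \<partial>lborel) = (\<integral>y. cos (\<xi> \<bullet> x) * E * (cos (\<xi> \<bullet> y) * ?k t y) + sin (\<xi> \<bullet> x) * E * (sin (\<xi> \<bullet> y) * ?k t y) \<partial>lborel)"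
        unfolding f_def E_def[symmetric]
        by (intro Bochner_Integration.integral_cong refl) (simp add: inner_diff_right cos_diff algebra_simps)
      also have "\<dots> = cos (\<xi> \<bullet> x) * E * exp (- t * norm \<xi> powr (\<alpha> / 2))"
        using ci by (subst Bochner_Integration.integral_add) (auto simp: four(2)[OF t] sin0)
      finally show "(\<integral>y. f y \<xi> \<partial>lborel) = cos (\<xi> \<bullet> x) * exp (- (s + t) * norm \<xi> powr (\<alpha> / 2))"
        by (simp add: E_def mult_exp_exp algebra_simps)
    qed
    also have "\<dots> = P * ?k (s + t) x" using P by (simp add: stable_kernel_def P_def)
    finally have "(\<integral>y. ?k s (x - y) * ?k t y \<partial>lborel) = ?k (s + t) x" using P by simp
    moreover have "(\<integral>\<^sup>+y. ennreal (?k s (x - y)) * ennreal (?k t y) \<partial>lborel) = ennreal (\<integral>y. ?k s (x - y) * ?k t y \<partial>lborel)"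
      using i1 nn[OF s] nn[OF t] by (subst nn_integral_eq_integral[symmetric]) (auto simp: ennreal_mult)
    ultimately show ?thesis by simp
  qed
qed

section \<open>Scaling and the global lower bound\<close>

lemma stable_kernel_scaling:
  fixes x :: "'a::euclidean_space"
  assumes g: "0 < g" and t: "0 < t"
  shows "stable_kernel g t x = stable_kernel g 1 (x /\<^sub>R t powr (1 / g)) / (t powr (1 / g)) ^ DIM('a)"
proof -
  define r where "r = t powr (1 / g)"
  have r: "0 < r" using t by (simp add: r_def)
  have rg: "r powr g = t" using t g by (simp add: r_def powr_powr)
  have "(\<integral>\<xi>. cos (\<xi> \<bullet> x) * exp (- t * norm \<xi> powr g) \<partial>lborel)
     = inverse r ^ DIM('a) * (\<integral>\<xi>. cos ((inverse r *\<^sub>R \<xi>) \<bullet> x) * exp (- t * norm (inverse r *\<^sub>R \<xi>) powr g) \<partial>lborel)"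
    using r by (intro integral_dilate) auto
  also have "(\<lambda>\<xi>. cos ((inverse r *\<^sub>R \<xi>) \<bullet> x) * exp (- t * norm (inverse r *\<^sub>R \<xi>) powr g))
     = (\<lambda>\<xi>. cos (\<xi> \<bullet> (x /\<^sub>R r)) * exp (- 1 * norm \<xi> powr g))"
  proof
    fix \<xi> :: 'a
    have "norm (inverse r *\<^sub>R \<xi>) powr g = inverse (r powr g) * norm \<xi> powr g"
      using r by (simp add: powr_mult inverse_powr)
    then have "t * norm (inverse r *\<^sub>R \<xi>) powr g = norm \<xi> powr g"
      using t by (simp add: rg)
    then show "cos ((inverse r *\<^sub>R \<xi>) \<bullet> x) * exp (- t * norm (inverse r *\<^sub>R \<xi>) powr g)
       = cos (\<xi> \<bullet> (x /\<^sub>R r)) * exp (- 1 * norm \<xi> powr g)"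
      by simp
  qed
  finally show ?thesis
    unfolding stable_kernel_def r_def[symmetric] using r by (simp add: field_simps)
qed

text \<open>The tail estimate settles |x| >= R. For |x| < R the kernel at time 1 is the
  self-convolution of the kernel at time 1/2, restricted to y in a ball of radius R whose centre has
  norm 3 R: then y and x - y have norms between R and 5 R, where the rescaled tail estimate is a
  positive constant.\<close>

lemma stable_kernel_lower:
  fixes dens :: "real \<Rightarrow> 'a::euclidean_space \<Rightarrow> 'a \<Rightarrow> real"
  assumes \<alpha>: "0 < \<alpha>" "\<alpha> < 2" and d: "stable_transition_density \<alpha> dens"
  shows "\<exists>c>0. \<forall>x::'a. c * (1 + norm x) powr (- real DIM('a) - \<alpha> / 2) \<le> stable_kernel (\<alpha> / 2) 1 x"
proof -
  define g where "g = \<alpha> / 2"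
  have g: "0 < g" "g < 1" using \<alpha> by (auto simp: g_def)
  define e where "e = real DIM('a) + g"
  have e: "0 < e" using g by (simp add: e_def add_nonneg_pos)
  interpret convolution_semigroup "stable_kernel g :: real \<Rightarrow> 'a \<Rightarrow> real"
    unfolding g_def by (rule stable_kernel_convolution_semigroup[OF \<alpha>(1) d])
  obtain R c where R: "1 \<le> R" and c: "0 < c" and tail: "\<And>x::'a. R \<le> norm x \<Longrightarrow> c * norm x powr (- e) \<le> stable_kernel g 1 x"
    using stable_kernel_tail_lower[OF g, where 'a = 'a] unfolding e_def by (auto simp: minus_add_distrib)
  \<comment> \<open>The spatial scale at time 1/2. As r <= 1, dividing by r keeps points outside the
    radius R, where the tail estimate applies.\<close>
  define r where "r = (1/2) powr (1 / g)"
  have r: "0 < r" "r \<le> 1" using g by (auto simp: r_def intro: powr_le1)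
  define m where "m = c * (5 * R / r) powr (- e) / r ^ DIM('a)"
  have m: "0 < m" using c r R by (simp add: m_def)
  have half: "m \<le> stable_kernel g (1/2) z" if z: "R \<le> norm z" "norm z \<le> 5 * R" for z :: 'a
  proof -
    have nz: "norm (z /\<^sub>R r) = norm z / r" using r by (simp add: divide_inverse mult.commute)
    have "norm z \<le> norm z / r" using r by (simp add: field_simps mult_left_le_one_le)
    then have "R \<le> norm (z /\<^sub>R r)" unfolding nz using z by linarith
    from tail[OF this] have 1: "c * (norm z / r) powr (- e) \<le> stable_kernel g 1 (z /\<^sub>R r)" by (simp only: nz)
    have "(5 * R / r) powr (- e) \<le> (norm z / r) powr (- e)"
      using z r R e by (intro powr_mono2' divide_right_mono divide_pos_pos) auto
    then have "c * (5 * R / r) powr (- e) \<le> c * (norm z / r) powr (- e)"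
      using c by (intro mult_left_mono) auto
    then have "c * (5 * R / r) powr (- e) / r ^ DIM('a) \<le> stable_kernel g 1 (z /\<^sub>R r) / r ^ DIM('a)"
      using 1 r by (intro divide_right_mono) auto
    then show ?thesis
      unfolding m_def r_def using stable_kernel_scaling[OF g(1), of "1/2" z] by simp
  qed
  obtain b :: 'a where b: "b \<in> Basis" using nonempty_Basis by blast
  define y0 where "y0 = (3 * R) *\<^sub>R b"
  have y0: "norm y0 = 3 * R" using b R by (simp add: y0_def)
  define v where "v = measure lborel (ball y0 R)"
  have v: "0 < v" using content_ball_pos[of R y0] R by (simp add: v_def)
  have near: "m * m * v \<le> stable_kernel g 1 x" if x: "norm x < R" for x :: 'a
  proof -
    have "(\<integral>\<^sup>+y. ennreal (m * m) * indicator (ball y0 R) y \<partial>lborel)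
      \<le> (\<integral>\<^sup>+y. ennreal (stable_kernel g (1/2) (x - y)) * ennreal (stable_kernel g (1/2) y) \<partial>lborel)"
    proof (intro nn_integral_mono)
      fix y :: 'a
      show "ennreal (m * m) * indicator (ball y0 R) y
        \<le> ennreal (stable_kernel g (1/2) (x - y)) * ennreal (stable_kernel g (1/2) y)"
      proof (cases "y \<in> ball y0 R")
        case True
        then have n: "norm (y0 - y) < R" by (simp add: dist_norm)
        have n1: "2 * R \<le> norm y" "norm y \<le> 4 * R"
          using n y0 norm_triangle_ineq2[of y0 y] norm_triangle_ineq2[of y y0] norm_minus_commute[of y y0] by auto
        have n2: "R \<le> norm (x - y)" "norm (x - y) \<le> 5 * R"
          using n1 x norm_triangle_ineq2[of y x] norm_triangle_ineq4[of x y] norm_minus_commute[of y x] by auto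
        have "m * m \<le> stable_kernel g (1/2) (x - y) * stable_kernel g (1/2) y"
          using half[of "x - y"] half[of y] n1 n2 m R by (intro mult_mono) auto
        then show ?thesis using True m half[of "x - y"] n2
          by (simp flip: ennreal_mult'' ennreal_mult' add: ennreal_leI)
      qed simp
    qed
    also have "\<dots> = ennreal (stable_kernel g 1 x)"
      using semigroup[of "1/2" "1/2" x] by simp
    also have "(\<integral>\<^sup>+y. ennreal (m * m) * indicator (ball y0 R) y \<partial>lborel) = ennreal (m * m) * ennreal v"
      unfolding v_def using emeasure_lborel_ball_finite[of y0 R]
      by (subst nn_integral_cmult_indicator) (auto simp: emeasure_eq_ennreal_measure less_top)
    finally have "ennreal (m * m * v) \<le> ennreal (stable_kernel g 1 x)"
      using m v by (simp add: ennreal_mult)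
    then show ?thesis using nonneg[of 1 x] by simp
  qed
  define C where "C = min c (m * m * v)"
  have C: "0 < C" using c m v by (simp add: C_def)
  have "C * (1 + norm x) powr (- e) \<le> stable_kernel g 1 x" for x :: 'a
  proof (cases "norm x < R")
    case True
    have "(1 + norm x) powr (- e) \<le> 1 powr (- e)" using e by (intro powr_mono2') auto
    then have "C * (1 + norm x) powr (- e) \<le> C * 1" using C by (intro mult_left_mono) auto
    also have "\<dots> \<le> m * m * v" by (simp add: C_def)
    finally show ?thesis using near[OF True] by linarith
  next
    case False
    then have nx: "0 < norm x" using R by linarith
    have "(1 + norm x) powr (- e) \<le> norm x powr (- e)" using e nx by (intro powr_mono2') auto
    then have "C * (1 + norm x) powr (- e) \<le> c * norm x powr (- e)"
      using c by (intro mult_mono) (auto simp: C_def)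
    then show ?thesis using tail[of x] False by simp
  qed
  then show ?thesis using C by (auto simp: g_def e_def minus_add_distrib intro!: exI[of _ C])
qed

section \<open>The square functions\<close>

lemma ennpowr_mono: "x \<le> y \<Longrightarrow> 0 \<le> r \<Longrightarrow> ennpowr x r \<le> ennpowr y r"
  by (auto simp: ennpowr_def top_unique less_top intro!: ennreal_leI powr_mono2 enn2real_mono)

lemma ennpowr_ennreal: "0 \<le> y \<Longrightarrow> ennpowr (ennreal y) r = ennreal (y powr r)"
  by (simp add: ennpowr_def)

lemma ennpowr_mult:
  assumes "0 < c"
  shows "ennpowr (ennreal c * x) r = ennreal (c powr r) * ennpowr x r"
proof (cases x)
  case (real y)
  then show ?thesis using assms by (simp add: ennpowr_ennreal powr_mult flip: ennreal_mult)
next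
  case top
  then show ?thesis using assms by (simp add: ennpowr_def ennreal_mult_top)
qed

lemma ennpowr_ennpowr: "ennpowr (ennpowr x a) b = ennpowr x (a * b)"
  by (cases x) (auto simp: ennpowr_ennreal powr_powr, simp add: ennpowr_def)

lemma measurable_ennpowr [measurable (raw)]:
  assumes [measurable]: "f \<in> borel_measurable M"
  shows "(\<lambda>x. ennpowr (f x) r) \<in> borel_measurable M"
  unfolding ennpowr_def by measurable

text \<open>The comparison is pointwise and measurability is asked of the majorant, so the area
  functional can be estimated through the measurability of \<open>G_star\<close>.\<close>

lemma Lp_norm_le_mult:
  fixes u v :: "'a::euclidean_space \<Rightarrow> ennreal"
  assumes c: "0 < c" and r: "0 < r" and [measurable]: "v \<in> borel_measurable lebesgue"
    and le: "\<And>x. u x \<le> ennreal c * v x"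
  shows "Lp_norm r u \<le> ennreal c * Lp_norm r v"
proof -
  have "(\<integral>\<^sup>+x. ennpowr (u x) r \<partial>lebesgue) \<le> (\<integral>\<^sup>+x. ennreal (c powr r) * ennpowr (v x) r \<partial>lebesgue)"
    unfolding ennpowr_mult[OF c, symmetric] using r le by (intro nn_integral_mono ennpowr_mono) auto
  also have "\<dots> = ennreal (c powr r) * (\<integral>\<^sup>+x. ennpowr (v x) r \<partial>lebesgue)"
    by (intro nn_integral_cmult) measurable
  finally have "Lp_norm r u \<le> ennpowr (ennreal (c powr r) * (\<integral>\<^sup>+x. ennpowr (v x) r \<partial>lebesgue)) (1 / r)"
    unfolding Lp_norm_def using r by (intro ennpowr_mono) auto
  also have "\<dots> = ennreal c * Lp_norm r v"
    unfolding Lp_norm_def using c r by (subst ennpowr_mult) (auto simp: powr_powr)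
  finally show ?thesis .
qed

text \<open>Dyadic decomposition. Where |h| is about 2^(-n) the integrand is at most 2^d q^n 2^(nd)
  with q = 2^(-a); the ball of radius 2^(-n) has volume proportional to 2^(-nd), and a geometric
  series with ratio q < 1 remains.\<close>

lemma nn_integral_truncated_power_finite:
  assumes a: "0 < a"
  shows "(\<integral>\<^sup>+h\<in>{h::'a::euclidean_space. norm h < 1}. ennreal (norm h powr (a - real DIM('a))) \<partial>lborel) < \<infinity>"
proof -
  define d where "d = real DIM('a)"
  define v where "v = (\<integral>\<^sup>+x. indicator (cball (0::'a) 1) x \<partial>lborel)"
  have v: "v < \<infinity>" unfolding v_def using emeasure_lborel_cball_finite[of "0::'a" 1] by simp
  define q where "q = 2 powr (- a)"
  have q: "0 < q" "q < 1" using a by (auto simp: q_def powr_less_one)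
  have ball: "(\<integral>\<^sup>+x. indicator (cball (0::'a) ((1/2) ^ n)) x \<partial>lborel) = ennreal (((1/2) ^ n) ^ DIM('a)) * v" for n :: nat
  proof -
    have "(\<integral>\<^sup>+x. indicator (cball (0::'a) ((1/2) ^ n)) x \<partial>lborel)
      = ennreal (((1/2) ^ n) ^ DIM('a)) * (\<integral>\<^sup>+x. indicator (cball (0::'a) ((1/2) ^ n)) ((1/2) ^ n *\<^sub>R x) \<partial>lborel)"
      by (rule nn_integral_dilate) (auto intro!: borel_measurable_indicator)
    also have "(\<lambda>x. indicator (cball (0::'a) ((1/2) ^ n)) ((1/2) ^ n *\<^sub>R x) :: ennreal) = indicator (cball 0 1)"
      by (auto simp: fun_eq_iff split: split_indicator)
    finally show ?thesis by (simp add: v_def)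
  qed
  have "(\<integral>\<^sup>+h\<in>{h::'a. norm h < 1}. ennreal (norm h powr (a - d)) \<partial>lborel)
    \<le> (\<integral>\<^sup>+h. (\<Sum>n. ennreal (2 powr d * q ^ n * (2 ^ n) ^ DIM('a)) * indicator (cball (0::'a) ((1/2) ^ n)) h) \<partial>lborel)"
  proof (rule nn_integral_mono)
    fix h :: 'a
    let ?s = "\<lambda>n. ennreal (2 powr d * q ^ n * (2 ^ n) ^ DIM('a)) * indicator (cball (0::'a) ((1/2) ^ n)) h"
    show "ennreal (norm h powr (a - d)) * indicator {h. norm h < 1} h \<le> (\<Sum>n. ?s n)"
    proof (cases "norm h < 1 \<and> h \<noteq> 0")
      case True
      define y where "y = norm h"
      have y: "0 < y" "y < 1" using True by (auto simp: y_def)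
      \<comment> \<open>The dyadic index of |h|, with 2^(-n-1) <= |h| <= 2^(-n): the upper end
        bounds the power a > 0, the lower end the power -d.\<close>
      define n where "n = nat \<lfloor>- log 2 y\<rfloor>"
      have l: "0 \<le> - log 2 y" using y by simp
      have n: "real n \<le> - log 2 y" "- log 2 y < real n + 1"
        using l by (auto simp: n_def)
      have p: "(1/2) ^ n = 2 powr (- real n)" by (simp add: powr_minus powr_realpow power_one_over inverse_eq_divide)
      have y1: "y \<le> (1/2) ^ n"
      proof -
        have "y = 2 powr (log 2 y)" using y by simp
        also have "\<dots> \<le> 2 powr (- real n)" using n by (intro powr_mono) auto
        finally show ?thesis by (simp only: p)
      qed
      have y2: "2 powr (- real n - 1) \<le> y"
      proof -
        have "2 powr (- real n - 1) \<le> 2 powr (log 2 y)" using n by (intro powr_mono) auto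
        then show ?thesis using y by simp
      qed
      have "y powr (a - d) = y powr a * y powr (- d)" by (simp flip: powr_add)
      also have "\<dots> \<le> (2 powr (- real n)) powr a * (2 powr (- real n - 1)) powr (- d)"
        using y1 y2 y a by (intro mult_mono powr_mono2 powr_mono2') (auto simp: p d_def)
      also have "(2 powr (- real n)) powr a = q ^ n"
        unfolding q_def by (simp add: powr_powr powr_power mult.commute)
      also have "(2 powr (- real n - 1)) powr (- d) = 2 powr d * (2 ^ n) ^ DIM('a)"
      proof -
        have "(2 powr (- real n - 1)) powr (- d) = 2 powr d * 2 powr (real (n * DIM('a)))"
          by (simp add: powr_powr d_def algebra_simps flip: powr_add)
        then show ?thesis using powr_realpow[of 2 "n * DIM('a)"] by (simp add: power_mult)
      qed
      finally have "ennreal (y powr (a - d)) \<le> ?s n"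
        using y1 by (simp add: y_def ennreal_leI mult_ac)
      also have "\<dots> \<le> (\<Sum>n. ?s n)"
      proof -
        have "u n \<le> (\<Sum>n. u n)" for u :: "nat \<Rightarrow> ennreal"
          using sum_le_suminf[of u "{n}"] by simp
        then show ?thesis .
      qed
      finally show ?thesis using True by (simp add: y_def)
    next
      case False
      then have "ennreal (norm h powr (a - d)) * indicator {h. norm h < 1} h = 0"
        by (auto split: split_indicator)
      then show ?thesis by (simp only: zero_le)
    qed
  qed
  also have "\<dots> = (\<Sum>n. \<integral>\<^sup>+h. ennreal (2 powr d * q ^ n * (2 ^ n) ^ DIM('a)) * indicator (cball (0::'a) ((1/2) ^ n)) h \<partial>lborel)"
    by (rule nn_integral_suminf) (simp add: borel_measurable_times_ennreal borel_measurable_indicator)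
  also have "\<dots> = (\<Sum>n. ennreal (2 powr d * q ^ n) * v)"
  proof (rule suminf_cong)
    fix n :: nat
    have one: "(2 ^ n :: real) ^ DIM('a) * ((1/2) ^ n) ^ DIM('a) = 1"
      by (simp flip: power_mult_distrib)
    have "(\<integral>\<^sup>+h. ennreal (2 powr d * q ^ n * (2 ^ n) ^ DIM('a)) * indicator (cball (0::'a) ((1/2) ^ n)) h \<partial>lborel)
      = ennreal (2 powr d * q ^ n * (2 ^ n) ^ DIM('a)) * (ennreal (((1/2) ^ n) ^ DIM('a)) * v)"
      unfolding ball[symmetric] by (rule nn_integral_cmult) (simp add: borel_measurable_indicator)
    also have "\<dots> = ennreal (2 powr d * q ^ n * ((2 ^ n) ^ DIM('a) * ((1/2) ^ n) ^ DIM('a))) * v"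
      using q by (simp flip: mult.assoc ennreal_mult)
    finally show "(\<integral>\<^sup>+h. ennreal (2 powr d * q ^ n * (2 ^ n) ^ DIM('a)) * indicator (cball (0::'a) ((1/2) ^ n)) h \<partial>lborel) = ennreal (2 powr d * q ^ n) * v"
      unfolding one by simp
  qed
  also have "\<dots> = (\<Sum>n. ennreal (2 powr d * q ^ n)) * v"
    by (rule ennreal_suminf_multc)
  also have "(\<Sum>n. ennreal (2 powr d * q ^ n)) = ennreal (\<Sum>n. 2 powr d * q ^ n)"
    using q by (intro suminf_ennreal2 summable_mult summable_geometric) auto
  also have "\<dots> * v < \<infinity>" using v by (simp add: ennreal_mult_less_top)
  finally show ?thesis by (simp add: d_def)
qed

section \<open>Pointwise domination by the kernel\<close>

locale stable_process =
  fixes \<alpha> :: real and dens :: "real \<Rightarrow> 'a::euclidean_space \<Rightarrow> 'a \<Rightarrow> real"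
  assumes alpha: "0 < \<alpha>" "\<alpha> < 2" and dens: "stable_transition_density \<alpha> dens"

sublocale stable_process \<subseteq> convolution_semigroup "stable_kernel (\<alpha> / 2) :: real \<Rightarrow> 'a \<Rightarrow> real"
  by (rule stable_kernel_convolution_semigroup[OF alpha(1) dens])

context stable_process
begin

abbreviation kernel :: "real \<Rightarrow> 'a \<Rightarrow> real" where
  "kernel \<equiv> stable_kernel (\<alpha> / 2)"

lemma kernel_scaling:
  assumes "0 < t"
  shows "kernel t x = kernel 1 (x /\<^sub>R t powr (2 / \<alpha>)) / (t powr (2 / \<alpha>)) ^ DIM('a)"
  using stable_kernel_scaling[of "\<alpha> / 2" t x] alpha assms by simp

text \<open>With r = t^(2/\<alpha>) both sides are r^(-d) times a function of x / r. The profile of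
  K is (1 + |x/r|)^(-d-\<alpha>/2), exactly the lower bound for the kernel at time 1.\<close>

lemma K_kernel_le:
  "\<exists>C>0. \<forall>t>0. \<forall>x. K_kernel \<alpha> ((2 * real DIM('a) + \<alpha>) / (2 * real DIM('a))) t x \<le> C * kernel t x"
proof -
  obtain c where c: "0 < c" "\<And>x::'a. c * (1 + norm x) powr (- real DIM('a) - \<alpha> / 2) \<le> kernel 1 x"
    using stable_kernel_lower[OF alpha dens] by blast
  have "K_kernel \<alpha> ((2 * real DIM('a) + \<alpha>) / (2 * real DIM('a))) t x \<le> 1 / c * kernel t x" if t: "0 < t" for t and x :: 'a
  proof -
    define r where "r = t powr (2 / \<alpha>)"
    have r: "0 < r" using t by (simp add: r_def)
    have 1: "t powr (- 2 * real DIM('a) / \<alpha>) = 1 / r ^ DIM('a)"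
      using t unfolding r_def by (simp add: powr_power powr_minus_divide[symmetric] mult.commute)
    have 2: "(2 * real DIM('a) + \<alpha>) / (2 * real DIM('a)) * real DIM('a) = real DIM('a) + \<alpha> / 2"
      by (simp add: field_simps)
    have 3: "r / (r + norm x) = inverse (1 + norm (x /\<^sub>R r))"
      using r by (simp add: field_simps)
    have "(r / (r + norm x)) powr (real DIM('a) + \<alpha> / 2) = (1 + norm (x /\<^sub>R r)) powr (- real DIM('a) - \<alpha> / 2)"
      unfolding 3 by (simp add: inverse_powr powr_minus[symmetric] minus_add_distrib del: norm_scaleR)
    also have "\<dots> \<le> kernel 1 (x /\<^sub>R r) / c"
      using c(1) c(2)[of "x /\<^sub>R r"] by (simp add: field_simps del: norm_scaleR)
    finally have "(r / (r + norm x)) powr (real DIM('a) + \<alpha> / 2) / r ^ DIM('a) \<le> kernel 1 (x /\<^sub>R r) / c / r ^ DIM('a)"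
      using r by (intro divide_right_mono) auto
    then show ?thesis
      unfolding K_kernel_def 1 2 kernel_scaling[OF t] r_def[symmetric] by (simp add: field_simps)
  qed
  then show ?thesis using c(1) by (intro exI[of _ "1 / c"]) auto
qed

text \<open>The modulus of continuity and the lower bound have the same spatial profile, so
  increments are controlled by the kernel itself at the same point. The free factor L leaves room
  for increments measured at time t while the kernel sits at time t / 2.\<close>

lemma kernel_Lipschitz:
  assumes L: "0 < L"
  shows "\<exists>C>0. \<forall>t>0. \<forall>x h. norm h \<le> L * t powr (2 / \<alpha>) \<longrightarrow>
    \<bar>kernel t (x + h) - kernel t x\<bar> \<le> C * (norm h / t powr (2 / \<alpha>)) * kernel t x"
proof -
  obtain c where c: "0 < c" "\<And>x::'a. c * (1 + norm x) powr (- real DIM('a) - \<alpha> / 2) \<le> kernel 1 x"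
    using stable_kernel_lower[OF alpha dens] by blast
  have g: "0 < \<alpha> / 2" "\<alpha> / 2 < 1" using alpha by auto
  obtain C where C: "0 < C" "\<And>(x::'a) h. norm h \<le> L \<Longrightarrow>
      \<bar>kernel 1 (x + h) - kernel 1 x\<bar> \<le> C * norm h * (1 + norm x) powr (- real DIM('a) - \<alpha> / 2)"
    using stable_kernel_Lipschitz[OF g L, where 'a = 'a] by blast
  have "\<bar>kernel t (x + h) - kernel t x\<bar> \<le> C / c * (norm h / t powr (2 / \<alpha>)) * kernel t x"
    if t: "0 < t" and h: "norm h \<le> L * t powr (2 / \<alpha>)" for t and x h :: 'a
  proof -
    define r where "r = t powr (2 / \<alpha>)"
    have r: "0 < r" using t by (simp add: r_def)
    have nh: "norm (h /\<^sub>R r) = norm h / r" using r by (simp add: divide_inverse mult.commute)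
    have "norm (h /\<^sub>R r) \<le> L" unfolding nh using h r by (simp add: r_def[symmetric] field_simps)
    from C(2)[OF this, of "x /\<^sub>R r"]
    have "\<bar>kernel 1 ((x + h) /\<^sub>R r) - kernel 1 (x /\<^sub>R r)\<bar> \<le> C * (norm h / r) * (1 + norm (x /\<^sub>R r)) powr (- real DIM('a) - \<alpha> / 2)"
      unfolding nh by (simp only: scaleR_add_right)
    also have "\<dots> \<le> C * (norm h / r) * (kernel 1 (x /\<^sub>R r) / c)"
      using C(1) r c(1) c(2)[of "x /\<^sub>R r"]
      by (intro mult_left_mono) (auto simp: pos_le_divide_eq mult.commute simp del: norm_scaleR)
    finally have "\<bar>kernel 1 ((x + h) /\<^sub>R r) - kernel 1 (x /\<^sub>R r)\<bar> / r ^ DIM('a) \<le> C * (norm h / r) * (kernel 1 (x /\<^sub>R r) / c) / r ^ DIM('a)"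
      using r by (intro divide_right_mono) auto
    moreover have "\<bar>kernel t (x + h) - kernel t x\<bar> = \<bar>kernel 1 ((x + h) /\<^sub>R r) - kernel 1 (x /\<^sub>R r)\<bar> / r ^ DIM('a)"
      unfolding kernel_scaling[OF t] r_def[symmetric] using r by (simp add: abs_divide flip: diff_divide_distrib)
    moreover have "C * (norm h / r) * (kernel 1 (x /\<^sub>R r) / c) / r ^ DIM('a) = C / c * (norm h / r) * kernel t x"
      unfolding kernel_scaling[OF t] r_def[symmetric] by simp
    ultimately show ?thesis unfolding r_def[symmetric] by simp
  qed
  then show ?thesis using C(1) c(1) by (intro exI[of _ "C / c"]) auto
qed

text \<open>Q_{2s} f is Q_s applied to Q_s f, and the constant c = Q_{2s} f (x) may be subtracted
  from Q_s f because the kernel has mass one around x and around x + h. The increment of the kernel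
  is at most a multiple of the kernel, which leaves the mean of |Q_s f - c|; Cauchy-Schwarz passes
  to the variance.\<close>

lemma conv_difference_le:
  assumes L: "0 < L"
  shows "\<exists>C>0. \<forall>f s x h. admissible f \<longrightarrow> 0 < s \<longrightarrow> norm h \<le> L * s powr (2 / \<alpha>) \<longrightarrow>
    ennreal ((conv (2 * s) f (x + h) - conv (2 * s) f x)\<^sup>2) \<le> ennreal (C * (norm h / s powr (2 / \<alpha>))\<^sup>2) * variation s f x"
proof -
  obtain C where C: "0 < C" "\<And>t x h. 0 < t \<Longrightarrow> norm h \<le> L * t powr (2 / \<alpha>) \<Longrightarrow>
      \<bar>kernel t (x + h) - kernel t x\<bar> \<le> C * (norm h / t powr (2 / \<alpha>)) * kernel t x"
    using kernel_Lipschitz[OF L] by blast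
  have "ennreal ((conv (2 * s) f (x + h) - conv (2 * s) f x)\<^sup>2) \<le> ennreal (C\<^sup>2 * (norm h / s powr (2 / \<alpha>))\<^sup>2) * variation s f x"
    if f: "admissible f" and s: "0 < s" and h: "norm h \<le> L * s powr (2 / \<alpha>)" for f s x h
  proof -
    have [measurable]: "f \<in> borel_measurable borel" using f by (simp add: admissible_def)
    define u where "u = conv s f"
    have [measurable]: "u \<in> borel_measurable borel" unfolding u_def by measurable
    define c where "c = conv (2 * s) f x"
    define a where "a = C * (norm h / s powr (2 / \<alpha>))"
    have a: "0 \<le> a" using C by (simp add: a_def)
    obtain M where M: "\<And>y. \<bar>u y\<bar> \<le> M" using conv_bound(2)[OF f s] by (auto simp: u_def)
    have twice: "conv (2 * s) f z = (\<integral>y. u y * kernel s (z - y) \<partial>lborel)" for z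
      using conv_conv[OF f s s, of z] by (simp add: u_def conv_def)
    define w where "w y = \<bar>u y - c\<bar>" for y
    have [measurable]: "w \<in> borel_measurable borel" unfolding w_def by measurable
    have wb: "\<bar>w y\<bar> \<le> M + \<bar>c\<bar>" for y using M[of y] by (simp add: w_def)
    have iu: "integrable lborel (\<lambda>y. u y * kernel s (z - y))" for z
      by (rule integrable_bounded_kernel[OF _ M s]) measurable
    have iw: "integrable lborel (\<lambda>y. w y * kernel s (x - y))"
      by (rule integrable_bounded_kernel[OF _ wb s]) measurable
    have iw2: "integrable lborel (\<lambda>y. (w y)\<^sup>2 * kernel s (x - y))"
    proof (rule integrable_bounded_kernel[OF _ _ s])
      show "\<bar>(w y)\<^sup>2\<bar> \<le> (M + \<bar>c\<bar>)\<^sup>2" for y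
        using power_mono[OF wb[of y] abs_ge_zero, of 2] by simp
    qed measurable
    have ic: "integrable lborel (\<lambda>y. (u y - c) * kernel s (z - y))" for z
      using iu[of z] integrable_kernel[OF s, of z] by (simp add: left_diff_distrib)
    have shift: "conv (2 * s) f z - c = (\<integral>y. (u y - c) * kernel s (z - y) \<partial>lborel)" for z
      using iu[of z] integrable_kernel[OF s, of z] integral_kernel[OF s, of z]
      by (simp add: twice left_diff_distrib)
    have "conv (2 * s) f (x + h) - conv (2 * s) f x
      = (\<integral>y. (u y - c) * kernel s (x + h - y) \<partial>lborel) - (\<integral>y. (u y - c) * kernel s (x - y) \<partial>lborel)"
      using shift[of "x + h"] shift[of x] by simp
    also have "\<dots> = (\<integral>y. (u y - c) * kernel s (x + h - y) - (u y - c) * kernel s (x - y) \<partial>lborel)"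
      by (rule Bochner_Integration.integral_diff[OF ic ic, symmetric])
    finally have "\<bar>conv (2 * s) f (x + h) - conv (2 * s) f x\<bar>
      \<le> (\<integral>y. \<bar>(u y - c) * kernel s (x + h - y) - (u y - c) * kernel s (x - y)\<bar> \<partial>lborel)"
      by (simp add: integral_abs_bound)
    also have "\<dots> \<le> (\<integral>y. a * (w y * kernel s (x - y)) \<partial>lborel)"
    proof (rule integral_mono)
      show "integrable lborel (\<lambda>y. \<bar>(u y - c) * kernel s (x + h - y) - (u y - c) * kernel s (x - y)\<bar>)"
        using Bochner_Integration.integrable_diff[OF ic ic] by (rule integrable_abs)
      show "integrable lborel (\<lambda>y. a * (w y * kernel s (x - y)))" using iw by (rule integrable_mult_right)
      fix y
      have "\<bar>kernel s ((x - y) + h) - kernel s (x - y)\<bar> \<le> a * kernel s (x - y)"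
        using C(2)[OF s h, of "x - y"] by (simp add: a_def)
      then have "w y * \<bar>kernel s ((x - y) + h) - kernel s (x - y)\<bar> \<le> w y * (a * kernel s (x - y))"
        by (intro mult_left_mono) (auto simp: w_def)
      then show "\<bar>(u y - c) * kernel s (x + h - y) - (u y - c) * kernel s (x - y)\<bar> \<le> a * (w y * kernel s (x - y))"
        unfolding right_diff_distrib[symmetric] abs_mult w_def
        by (simp add: algebra_simps)
    qed
    also have "\<dots> = a * (\<integral>y. w y * kernel s (x - y) \<partial>lborel)" by simp
    finally have 1: "\<bar>conv (2 * s) f (x + h) - conv (2 * s) f x\<bar> \<le> a * (\<integral>y. w y * kernel s (x - y) \<partial>lborel)" .
    define m where "m = (\<integral>y. w y * kernel s (x - y) \<partial>lborel)"
    define V where "V = (\<integral>y. (w y)\<^sup>2 * kernel s (x - y) \<partial>lborel)"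
    \<comment> \<open>Cauchy-Schwarz for a probability density, in the form that the variance of
      \<open>w\<close> is nonnegative.\<close>
    have "0 \<le> (\<integral>y. (w y - m)\<^sup>2 * kernel s (x - y) \<partial>lborel)"
      using nonneg[OF s] by (intro integral_nonneg_AE AE_I2 mult_nonneg_nonneg) auto
    also have "\<dots> = (\<integral>y. (w y)\<^sup>2 * kernel s (x - y) - 2 * m * (w y * kernel s (x - y)) + m\<^sup>2 * kernel s (x - y) \<partial>lborel)"
      by (intro Bochner_Integration.integral_cong refl) (simp add: power2_eq_square algebra_simps)
    also have "\<dots> = V - 2 * m * m + m\<^sup>2"
      using iw iw2 integrable_kernel[OF s, of x] integral_kernel[OF s, of x] by (simp add: V_def m_def)
    finally have mV: "m\<^sup>2 \<le> V" by (simp add: power2_eq_square)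
    have "(conv (2 * s) f (x + h) - conv (2 * s) f x)\<^sup>2 \<le> (a * m)\<^sup>2"
      using power_mono[OF 1[folded m_def] abs_ge_zero, of 2] by simp
    also have "\<dots> \<le> a\<^sup>2 * V" unfolding power_mult_distrib using mV by (intro mult_left_mono) auto
    finally have 2: "(conv (2 * s) f (x + h) - conv (2 * s) f x)\<^sup>2 \<le> a\<^sup>2 * V" .
    have "variation s f x = ennreal V"
      unfolding variation_def V_def using iw2 nonneg[OF s]
      by (subst nn_integral_eq_integral[symmetric]) (auto simp: w_def u_def c_def mult.commute)
    moreover have "0 \<le> V" using mV zero_le_power2[of m] by linarith
    moreover have "a\<^sup>2 = C\<^sup>2 * (norm h / s powr (2 / \<alpha>))\<^sup>2" by (simp only: a_def power_mult_distrib)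
    ultimately show ?thesis
      using ennreal_leI[OF 2] by (simp add: ennreal_mult)
  qed
  moreover have "0 < C\<^sup>2" using C(1) by simp
  ultimately show ?thesis by blast
qed

text \<open>With s = t/2 and L = 2^(2/\<alpha>) the truncation radius r = t^(2/\<alpha>) equals L
  s^(2/\<alpha>), so the increment bound applies to all h in the ball. The squared increment
  contributes |h|^2, which leaves |h|^(2-\<alpha>-d), integrable near 0 because \<alpha> < 2, with
  integral of order r^(2-\<alpha>). Together with r^(-2) this is r^(-\<alpha>) = t^(-2).\<close>

lemma Gamma_form_le_variation:
  "\<exists>C>0. \<forall>f t x. admissible f \<longrightarrow> 0 < t \<longrightarrow>
    Gamma_form \<alpha> t (conv t f) x \<le> ennreal (C * t powr (- 2)) * variation (t / 2) f x"
proof -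
  define L where "L = (2::real) powr (2 / \<alpha>)"
  have L: "0 < L" by (simp add: L_def)
  obtain C where C: "0 < C" "\<And>f s x h. admissible f \<Longrightarrow> 0 < s \<Longrightarrow> norm h \<le> L * s powr (2 / \<alpha>) \<Longrightarrow>
    ennreal ((conv (2 * s) f (x + h) - conv (2 * s) f x)\<^sup>2) \<le> ennreal (C * (norm h / s powr (2 / \<alpha>))\<^sup>2) * variation s f x"
    using conv_difference_le[OF L] by blast
  define J where "J = (\<integral>\<^sup>+h\<in>{h::'a. norm h < 1}. ennreal (norm h powr ((2 - \<alpha>) - real DIM('a))) \<partial>lborel)"
  have J: "J < \<infinity>" unfolding J_def using alpha by (intro nn_integral_truncated_power_finite) simp
  have "Gamma_form \<alpha> t (conv t f) x \<le> ennreal ((C * L\<^sup>2 * enn2real J + 1) * t powr (- 2)) * variation (t / 2) f x"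
    if f: "admissible f" and t: "0 < t" for f t x
  proof -
    define r where "r = t powr (2 / \<alpha>)"
    define s where "s = t / 2"
    have s: "0 < s" using t by (simp add: s_def)
    have r: "0 < r" using t by (simp add: r_def)
    have Ls: "L * s powr (2 / \<alpha>) = r" unfolding L_def s_def r_def using t by (simp flip: powr_mult)
    have dil: "(\<integral>\<^sup>+h\<in>{h::'a. norm h < r}. ennreal (norm h powr ((2 - \<alpha>) - real DIM('a))) \<partial>lborel)
      = ennreal (r powr (2 - \<alpha>)) * J"
    proof -
      have "(\<integral>\<^sup>+h\<in>{h::'a. norm h < r}. ennreal (norm h powr ((2 - \<alpha>) - real DIM('a))) \<partial>lborel)
        = ennreal (r ^ DIM('a)) * (\<integral>\<^sup>+h. ennreal (norm (r *\<^sub>R h) powr ((2 - \<alpha>) - real DIM('a))) * indicator {h::'a. norm h < r} (r *\<^sub>R h) \<partial>lborel)"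
        using r by (intro nn_integral_dilate) auto
      also have "(\<integral>\<^sup>+h. ennreal (norm (r *\<^sub>R h) powr ((2 - \<alpha>) - real DIM('a))) * indicator {h::'a. norm h < r} (r *\<^sub>R h) \<partial>lborel)
        = (\<integral>\<^sup>+h. ennreal (r powr ((2 - \<alpha>) - real DIM('a))) * (ennreal (norm (h::'a) powr ((2 - \<alpha>) - real DIM('a))) * indicator {h. norm h < 1} h) \<partial>lborel)"
        using r by (intro nn_integral_cong) (auto simp: powr_mult ennreal_mult mult.assoc split: split_indicator)
      also have "\<dots> = ennreal (r powr ((2 - \<alpha>) - real DIM('a))) * J"
        unfolding J_def by (intro nn_integral_cmult) measurable
      also have "ennreal (r ^ DIM('a)) * \<dots> = ennreal (r powr (2 - \<alpha>)) * J"
      proof -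
        have "r ^ DIM('a) * r powr ((2 - \<alpha>) - real DIM('a)) = r powr (2 - \<alpha>)"
          using r by (simp add: powr_diff powr_realpow)
        then show ?thesis using r by (simp flip: mult.assoc ennreal_mult)
      qed
      finally show ?thesis .
    qed
    have "Gamma_form \<alpha> t (conv t f) x
      \<le> (\<integral>\<^sup>+h. (ennreal (C * (L / r)\<^sup>2) * variation s f x) * (ennreal (norm (h::'a) powr ((2 - \<alpha>) - real DIM('a))) * indicator {h. norm h < r} h) \<partial>lborel)"
      unfolding Gamma_form_def r_def[symmetric]
    proof (rule nn_integral_mono)
      fix h :: 'a
      show "ennreal ((conv t f (x + h) - conv t f x)\<^sup>2 / norm h powr (real DIM('a) + \<alpha>)) * indicator {h. norm h < r} h
        \<le> (ennreal (C * (L / r)\<^sup>2) * variation s f x) * (ennreal (norm h powr ((2 - \<alpha>) - real DIM('a))) * indicator {h. norm h < r} h)"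
      proof (cases "norm h < r \<and> h \<noteq> 0")
        case True
        define y where "y = norm h"
        have y: "0 < y" "y < r" using True by (auto simp: y_def)
        have "ennreal ((conv (2 * s) f (x + h) - conv (2 * s) f x)\<^sup>2) \<le> ennreal (C * (y / s powr (2 / \<alpha>))\<^sup>2) * variation s f x"
          unfolding y_def using C(2)[OF f s, of h x] True by (simp add: Ls)
        moreover have "y / s powr (2 / \<alpha>) = y * (L / r)"
          using Ls[symmetric] L by simp
        ultimately have "ennreal (1 / y powr (real DIM('a) + \<alpha>)) * ennreal ((conv t f (x + h) - conv t f x)\<^sup>2)
           \<le> ennreal (1 / y powr (real DIM('a) + \<alpha>)) * (ennreal (C * (y * (L / r))\<^sup>2) * variation s f x)"
          by (intro mult_left_mono) (auto simp: s_def)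
        also have "\<dots> = (ennreal (C * (L / r)\<^sup>2) * variation s f x) * ennreal (y powr ((2 - \<alpha>) - real DIM('a)))"
        proof -
          have "1 / y powr (real DIM('a) + \<alpha>) * (C * (y * (L / r))\<^sup>2) = C * (L / r)\<^sup>2 * (y\<^sup>2 / y powr (real DIM('a) + \<alpha>))"
          proof -
            have "1 / P * (C * (y * Z)\<^sup>2) = C * Z\<^sup>2 * (y\<^sup>2 / P)" for P Z :: real
              by (simp add: power_mult_distrib)
            then show ?thesis .
          qed
          also have "y\<^sup>2 / y powr (real DIM('a) + \<alpha>) = y powr ((2 - \<alpha>) - real DIM('a))"
          proof -
            have "y\<^sup>2 / y powr (real DIM('a) + \<alpha>) = y powr 2 / y powr (real DIM('a) + \<alpha>)" using y by simp
            also have "\<dots> = y powr (2 - (real DIM('a) + \<alpha>))" by (simp only: powr_diff)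
            also have "2 - (real DIM('a) + \<alpha>) = (2 - \<alpha>) - real DIM('a)" by simp
            finally show ?thesis .
          qed
          finally have eq: "1 / y powr (real DIM('a) + \<alpha>) * (C * (y * (L / r))\<^sup>2) = C * (L / r)\<^sup>2 * y powr ((2 - \<alpha>) - real DIM('a))" .
          have "0 \<le> C * (L / r)\<^sup>2" "0 \<le> 1 / y powr (real DIM('a) + \<alpha>)" using C(1) by auto
          then have e: "ennreal (1 / y powr (real DIM('a) + \<alpha>)) * ennreal (C * (y * (L / r))\<^sup>2) = ennreal (C * (L / r)\<^sup>2) * ennreal (y powr ((2 - \<alpha>) - real DIM('a)))"
            by (simp only: ennreal_mult'[symmetric] eq)
          have "u * (v * w) = (u * v) * w" "(u * v) * w = (u * w) * v" for u v w :: ennreal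
            by (simp_all only: mult_ac)
          then show ?thesis by (simp only: e)
        qed
        finally have fin: "ennreal (1 / y powr (real DIM('a) + \<alpha>)) * ennreal ((conv t f (x + h) - conv t f x)\<^sup>2)
          \<le> (ennreal (C * (L / r)\<^sup>2) * variation s f x) * ennreal (y powr ((2 - \<alpha>) - real DIM('a)))" .
        have "ennreal ((conv t f (x + h) - conv t f x)\<^sup>2 / y powr (real DIM('a) + \<alpha>))
          = ennreal (1 / y powr (real DIM('a) + \<alpha>)) * ennreal ((conv t f (x + h) - conv t f x)\<^sup>2)"
          using ennreal_mult'[of "1 / y powr (real DIM('a) + \<alpha>)" "(conv t f (x + h) - conv t f x)\<^sup>2"] by simp
        moreover have "indicator {h. norm h < r} h = (1::ennreal)" using True by simp
        ultimately show ?thesis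
          unfolding y_def[symmetric] using fin by (simp only: mult_1_right)
      next
        case False
        then have "ennreal ((conv t f (x + h) - conv t f x)\<^sup>2 / norm h powr (real DIM('a) + \<alpha>)) * indicator {h. norm h < r} h = 0"
          by (auto split: split_indicator)
        then show ?thesis by (simp only: zero_le)
      qed
    qed
    also have "\<dots> = (ennreal (C * (L / r)\<^sup>2) * variation s f x) * (ennreal (r powr (2 - \<alpha>)) * J)"
      unfolding dil[symmetric] by (intro nn_integral_cmult) measurable
    also have "\<dots> = ennreal (C * (L / r)\<^sup>2) * ennreal (r powr (2 - \<alpha>)) * ennreal (enn2real J) * variation s f x"
      using J by (simp add: mult_ac)
    also have "ennreal (C * (L / r)\<^sup>2) * ennreal (r powr (2 - \<alpha>)) * ennreal (enn2real J) = ennreal (C * L\<^sup>2 * enn2real J * t powr (- 2))"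
    proof -
      have "r powr (2 - \<alpha>) / r\<^sup>2 = r powr (2 - \<alpha>) / r powr 2" using r by simp
      also have "\<dots> = r powr (- \<alpha>)" by (simp flip: powr_diff)
      also have "\<dots> = t powr (- 2)" unfolding r_def powr_powr using alpha by simp
      finally have q1: "r powr (2 - \<alpha>) / r\<^sup>2 = t powr (- 2)" .
      have "C * (L / r)\<^sup>2 * r powr (2 - \<alpha>) * enn2real J = C * L\<^sup>2 * enn2real J * (r powr (2 - \<alpha>) / r\<^sup>2)"
        by (simp add: power_divide)
      then have q2: "C * (L / r)\<^sup>2 * r powr (2 - \<alpha>) * enn2real J = C * L\<^sup>2 * enn2real J * t powr (- 2)"
        by (simp only: q1)
      have "0 \<le> C * (L / r)\<^sup>2" "0 \<le> C * (L / r)\<^sup>2 * r powr (2 - \<alpha>)" using C(1) by auto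
      then show ?thesis by (simp only: ennreal_mult'[symmetric] q2)
    qed
    also have "ennreal (C * L\<^sup>2 * enn2real J * t powr (- 2)) * variation s f x \<le> ennreal ((C * L\<^sup>2 * enn2real J + 1) * t powr (- 2)) * variation s f x"
      by (intro mult_right_mono ennreal_leI) auto
    finally show ?thesis by (simp add: s_def)
  qed
  moreover have "0 < C * L\<^sup>2 * enn2real J + 1" using C(1) by (intro add_nonneg_pos) auto
  ultimately show ?thesis by blast
qed

end

context stable_process
begin

section \<open>Measurability, Borel representatives and the dual estimate\<close>

lemma measurable_Gamma_form [measurable (raw)]:
  assumes [measurable]: "f \<in> borel_measurable borel" "u \<in> borel_measurable M" "v \<in> borel_measurable M"
  shows "(\<lambda>x. Gamma_form \<alpha> (u x) (conv (u x) f) (v x)) \<in> borel_measurable M"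
proof -
  have [measurable]: "(\<lambda>z. conv (u (fst z)) f (v (fst z) + snd z)) \<in> borel_measurable (M \<Otimes>\<^sub>M lborel)"
    "(\<lambda>z. conv (u (fst z)) f (v (fst z))) \<in> borel_measurable (M \<Otimes>\<^sub>M lborel)"
    by (rule measurable_conv; measurable)+
  \<comment> \<open>The set depends on x through the radius; written as a conditional, its indicator
    is visibly measurable in both variables jointly.\<close>
  have ind: "(indicator {h. norm h < u x powr (2 / \<alpha>)} h :: ennreal) = (if norm h < u x powr (2 / \<alpha>) then 1 else 0)" for x and h :: 'a
    by auto
  have "(\<lambda>z. ennreal ((conv (u (fst z)) f (v (fst z) + snd z) - conv (u (fst z)) f (v (fst z)))\<^sup>2 / norm (snd z) powr (real DIM('a) + \<alpha>))
     * (if norm (snd z) < u (fst z) powr (2 / \<alpha>) then 1 else 0)) \<in> borel_measurable (M \<Otimes>\<^sub>M lborel)"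
    by measurable
  then show ?thesis
    unfolding Gamma_form_def ind by (intro lborel.borel_measurable_nn_integral) (simp add: case_prod_beta')
qed

lemma measurable_K_kernel [measurable (raw)]:
  assumes [measurable]: "u \<in> borel_measurable M" "v \<in> borel_measurable M"
  shows "(\<lambda>x. K_kernel \<alpha> l (u x) (v x :: 'a)) \<in> borel_measurable M"
  unfolding K_kernel_def by measurable

definition G_square :: "real \<Rightarrow> ('a \<Rightarrow> real) \<Rightarrow> 'a \<Rightarrow> ennreal" where
  "G_square l f x = (\<integral>\<^sup>+t\<in>{0<..}. ennreal t * (\<integral>\<^sup>+y. ennreal (K_kernel \<alpha> l t (x - y)) * Gamma_form \<alpha> t (conv t f) y \<partial>lborel) \<partial>lborel)"

lemma measurable_G_integrand:
  assumes [measurable]: "f \<in> borel_measurable borel"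
  shows "(\<lambda>(x, t). \<integral>\<^sup>+y. ennreal (K_kernel \<alpha> l t (x - y)) * Gamma_form \<alpha> t (conv t f) y \<partial>lborel) \<in> borel_measurable (lborel \<Otimes>\<^sub>M lborel)"
proof -
  have "(\<lambda>z. ennreal (K_kernel \<alpha> l (snd (fst z)) (fst (fst z) - snd z)) * Gamma_form \<alpha> (snd (fst z)) (conv (snd (fst z)) f) (snd z))
     \<in> borel_measurable ((lborel \<Otimes>\<^sub>M lborel) \<Otimes>\<^sub>M lborel)"
    by (intro borel_measurable_times_ennreal measurable_Gamma_form measurable_compose[OF measurable_K_kernel measurable_ennreal]) measurable
  then show ?thesis
    unfolding case_prod_beta' by (intro lborel.borel_measurable_nn_integral) (simp add: case_prod_beta')
qed

lemma measurable_G_square [measurable]: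
  assumes [measurable]: "f \<in> borel_measurable borel"
  shows "G_square l f \<in> borel_measurable borel"
proof -
  note m = measurable_G_integrand[OF assms, of l]
  have "(\<lambda>(x, t). ennreal t * (\<integral>\<^sup>+y. ennreal (K_kernel \<alpha> l t (x - y)) * Gamma_form \<alpha> t (conv t f) y \<partial>lborel) * indicator {0<..} t)
    \<in> borel_measurable (borel \<Otimes>\<^sub>M lborel)"
    using m unfolding case_prod_beta' by (intro borel_measurable_times_ennreal) (auto cong: measurable_cong_sets)
  then show ?thesis
    unfolding G_square_def by (rule lborel.borel_measurable_nn_integral)
qed

text \<open>The extension sees f through Lebesgue integrals against kernels, so f may be exchanged
  for an almost everywhere equal Borel function, for which joint measurability and Tonelli over
  \<open>lborel\<close> are available.\<close>

lemma Q_ext_eq_conv: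
  assumes r: "1 \<le> r" and f: "in_Lp r f"
  shows "\<exists>f'. admissible f' \<and> (\<forall>t>0. Q_ext dens t f = conv t f') \<and>
    (\<integral>\<^sup>+x. ennreal (\<bar>f' x\<bar> powr r) \<partial>lborel) = (\<integral>\<^sup>+x. ennpowr (ennreal \<bar>f x\<bar>) r \<partial>lebesgue)"
proof -
  have [measurable]: "f \<in> borel_measurable lebesgue" using f by (simp add: in_Lp_def)
  obtain f' where f' [measurable]: "f' \<in> borel_measurable lborel" and ae: "AE x in lborel. f x = f' x"
    using completion_ex_borel_measurable_real[of f lborel] by auto
  have fm [measurable]: "f' \<in> borel_measurable lebesgue" using f' by (rule measurable_completion)
  have ae': "AE x in lebesgue. f x = f' x" using ae by (rule AE_completion)
  have "(\<integral>\<^sup>+x. ennpowr (ennreal \<bar>f x\<bar>) r \<partial>lebesgue) = (\<integral>\<^sup>+x. ennreal (\<bar>f' x\<bar> powr r) \<partial>lebesgue)"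
    by (intro nn_integral_cong_AE, use ae' in eventually_elim) (simp add: ennpowr_ennreal)
  also have "\<dots> = (\<integral>\<^sup>+x. ennreal (\<bar>f' x\<bar> powr r) \<partial>lborel)"
    by (rule nn_integral_completion) measurable
  finally have eq: "(\<integral>\<^sup>+x. ennpowr (ennreal \<bar>f x\<bar>) r \<partial>lebesgue) = (\<integral>\<^sup>+x. ennreal (\<bar>f' x\<bar> powr r) \<partial>lborel)" .
  have "(\<integral>\<^sup>+x. ennpowr (ennreal \<bar>f x\<bar>) r \<partial>lebesgue) < \<infinity>"
    using f by (auto simp: in_Lp_def Lp_norm_def ennpowr_def less_top split: if_splits)
  then have adm: "admissible f'"
    unfolding admissible_def eq using r by auto
  have "Q_ext dens t f = conv t f'" if t: "0 < t" for t
  proof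
    fix x
    have "Q_ext dens t f x = (\<integral>y. f y * kernel t (x - y) \<partial>lebesgue)"
      unfolding Q_ext_def using q_dens_eq[OF alpha(1) dens t] by simp
    also have "\<dots> = (\<integral>y. f' y * kernel t (x - y) \<partial>lebesgue)"
    proof (rule integral_cong_AE)
      have [measurable]: "(\<lambda>y. kernel t (x - y)) \<in> borel_measurable lebesgue"
        by (rule measurable_completion) measurable
      show "(\<lambda>y. f y * kernel t (x - y)) \<in> borel_measurable lebesgue"
        "(\<lambda>y. f' y * kernel t (x - y)) \<in> borel_measurable lebesgue" by measurable
      show "AE y in lebesgue. f y * kernel t (x - y) = f' y * kernel t (x - y)"
        using ae' by eventually_elim simp
    qed
    also have "\<dots> = conv t f' x"
      unfolding conv_def by (rule integral_completion) measurable
    finally show "Q_ext dens t f x = conv t f' x" .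
  qed
  then show ?thesis using adm eq by auto
qed

lemma G_star_eq: "(\<And>t. 0 < t \<Longrightarrow> Q_ext dens t f = conv t f') \<Longrightarrow> G_star \<alpha> dens l f x = ennpowr (G_square l f' x) (1/2)"
  unfolding G_star_def G_square_def
  by (intro arg_cong[where f = "\<lambda>y. ennpowr y (1/2)"] nn_integral_cong) (simp split: split_indicator)

text \<open>For |y| < r = t^(2/\<alpha>) the quotient r / (r + |y|) is at least 1/2, so t K_t(y) >=
  2^(-\<lambda> d) t^(1-2d/\<alpha>). The square root halves the exponent of the constant.\<close>

lemma area_le_G_star:
  assumes l: "0 < l" and p: "1 \<le> p" and f: "in_Lp p f"
  shows "area_functional \<alpha> dens f x \<le> ennreal (2 powr (l * real DIM('a) / 2)) * G_star \<alpha> dens l f x"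
proof -
  define d where "d = real DIM('a)"
  obtain f' where adm: "admissible f'" and Q: "\<And>t. 0 < t \<Longrightarrow> Q_ext dens t f = conv t f'"
    using Q_ext_eq_conv[OF p f] by blast
  have [measurable]: "f' \<in> borel_measurable borel" using adm by (simp add: admissible_def)
  have inner: "(\<integral>\<^sup>+y\<in>{y. norm y < t powr (2 / \<alpha>)}. ennreal (t powr (1 - 2 * d / \<alpha>)) * Gamma_form \<alpha> t (conv t f') (x - y) \<partial>lborel)
    \<le> ennreal (2 powr (l * d)) * (ennreal t * (\<integral>\<^sup>+y. ennreal (K_kernel \<alpha> l t (x - y)) * Gamma_form \<alpha> t (conv t f') y \<partial>lborel))"
    if t: "0 < t" for t
  proof -
    define r where "r = t powr (2 / \<alpha>)"
    have r: "0 < r" using t by (simp add: r_def)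
    have [measurable]: "(\<lambda>y. Gamma_form \<alpha> t (conv t f') (x - y)) \<in> borel_measurable borel"
      by measurable
    have [measurable]: "(\<lambda>y. ennreal (K_kernel \<alpha> l t (x - y)) * Gamma_form \<alpha> t (conv t f') y) \<in> borel_measurable borel"
      by (intro borel_measurable_times_ennreal measurable_Gamma_form measurable_compose[OF measurable_K_kernel measurable_ennreal]) measurable
    have "(\<integral>\<^sup>+y\<in>{y. norm y < r}. ennreal (t powr (1 - 2 * d / \<alpha>)) * Gamma_form \<alpha> t (conv t f') (x - y) \<partial>lborel)
      \<le> (\<integral>\<^sup>+y. ennreal (2 powr (l * d) * t) * (ennreal (K_kernel \<alpha> l t y) * Gamma_form \<alpha> t (conv t f') (x - y)) \<partial>lborel)"
    proof (rule nn_integral_mono)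
      fix y :: 'a
      show "ennreal (t powr (1 - 2 * d / \<alpha>)) * Gamma_form \<alpha> t (conv t f') (x - y) * indicator {y. norm y < r} y
        \<le> ennreal (2 powr (l * d) * t) * (ennreal (K_kernel \<alpha> l t y) * Gamma_form \<alpha> t (conv t f') (x - y))"
      proof (cases "norm y < r")
        case True
        have "2 powr - (l * d) \<le> (r / (r + norm y)) powr (l * d)"
        proof -
          have "0 < r + norm y" using r by (simp add: add_pos_nonneg)
          then have "1 / 2 \<le> r / (r + norm y)" using True by (simp add: pos_le_divide_eq)
          then have "(1 / 2) powr (l * d) \<le> (r / (r + norm y)) powr (l * d)"
            using l by (intro powr_mono2) (auto simp: d_def)
          then show ?thesis by (simp add: powr_divide powr_minus_divide)
        qed
        then have "2 powr (l * d) * 2 powr - (l * d) \<le> 2 powr (l * d) * (r / (r + norm y)) powr (l * d)"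
          by (intro mult_left_mono) auto
        then have 1: "1 \<le> 2 powr (l * d) * (r / (r + norm y)) powr (l * d)" by (simp flip: powr_add)
        have "t powr (1 - 2 * d / \<alpha>) = t * t powr (- 2 * d / \<alpha>)"
          using t by (simp add: powr_diff powr_minus field_simps)
        then have "t powr (1 - 2 * d / \<alpha>) * 1 \<le> t * t powr (- 2 * d / \<alpha>) * (2 powr (l * d) * (r / (r + norm y)) powr (l * d))"
          using 1 t by (simp only:) (intro mult_left_mono, auto)
        also have "\<dots> = 2 powr (l * d) * t * K_kernel \<alpha> l t y"
          by (simp add: K_kernel_def r_def d_def)
        finally have "ennreal (t powr (1 - 2 * d / \<alpha>)) \<le> ennreal (2 powr (l * d) * t) * ennreal (K_kernel \<alpha> l t y)"
          using t by (simp add: ennreal_leI flip: ennreal_mult')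
        then have "ennreal (t powr (1 - 2 * d / \<alpha>)) * Gamma_form \<alpha> t (conv t f') (x - y)
          \<le> ennreal (2 powr (l * d) * t) * ennreal (K_kernel \<alpha> l t y) * Gamma_form \<alpha> t (conv t f') (x - y)"
          by (rule mult_right_mono) simp
        then show ?thesis using True by (simp add: mult.assoc)
      qed simp
    qed
    also have "\<dots> = ennreal (2 powr (l * d) * t) * (\<integral>\<^sup>+y. ennreal (K_kernel \<alpha> l t y) * Gamma_form \<alpha> t (conv t f') (x - y) \<partial>lborel)"
      by (intro nn_integral_cmult borel_measurable_times_ennreal measurable_compose[OF measurable_K_kernel measurable_ennreal]) measurable
    also have "(\<integral>\<^sup>+y. ennreal (K_kernel \<alpha> l t y) * Gamma_form \<alpha> t (conv t f') (x - y) \<partial>lborel)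
      = (\<integral>\<^sup>+y. ennreal (K_kernel \<alpha> l t (x - y)) * Gamma_form \<alpha> t (conv t f') y \<partial>lborel)"
      using nn_integral_reflect[of "\<lambda>y. ennreal (K_kernel \<alpha> l t (x - y)) * Gamma_form \<alpha> t (conv t f') y" x] by simp
    finally show ?thesis using t by (simp add: r_def ennreal_mult mult.assoc)
  qed
  have "area_functional \<alpha> dens f x = ennpowr (\<integral>\<^sup>+t\<in>{0<..}. (\<integral>\<^sup>+y\<in>{y. norm y < t powr (2 / \<alpha>)}.
      ennreal (t powr (1 - 2 * d / \<alpha>)) * Gamma_form \<alpha> t (conv t f') (x - y) \<partial>lborel) \<partial>lborel) (1/2)"
    unfolding area_functional_def d_def
    by (intro arg_cong[where f = "\<lambda>y. ennpowr y (1/2)"] nn_integral_cong) (simp add: Q split: split_indicator)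
  also have "\<dots> \<le> ennpowr (\<integral>\<^sup>+t. ennreal (2 powr (l * d)) * (ennreal t * (\<integral>\<^sup>+y. ennreal (K_kernel \<alpha> l t (x - y)) * Gamma_form \<alpha> t (conv t f') y \<partial>lborel) * indicator {0<..} t) \<partial>lborel) (1/2)"
    using inner by (intro ennpowr_mono nn_integral_mono) (auto split: split_indicator)
  also have "(\<integral>\<^sup>+t. ennreal (2 powr (l * d)) * (ennreal t * (\<integral>\<^sup>+y. ennreal (K_kernel \<alpha> l t (x - y)) * Gamma_form \<alpha> t (conv t f') y \<partial>lborel) * indicator {0<..} t) \<partial>lborel)
    = ennreal (2 powr (l * d)) * G_square l f' x"
    unfolding G_square_def
  proof (rule nn_integral_cmult)
    have "(\<lambda>t. \<integral>\<^sup>+y. ennreal (K_kernel \<alpha> l t (x - y)) * Gamma_form \<alpha> t (conv t f') y \<partial>lborel) \<in> borel_measurable lborel"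
      using measurable_compose[OF measurable_Pair1'[of x lborel lborel] measurable_G_integrand[of f' l]] by simp
    then show "(\<lambda>t. ennreal t * (\<integral>\<^sup>+y. ennreal (K_kernel \<alpha> l t (x - y)) * Gamma_form \<alpha> t (conv t f') y \<partial>lborel) * indicator {0<..} t) \<in> borel_measurable lborel"
      by (intro borel_measurable_times_ennreal) auto
  qed
  also have "ennpowr (ennreal (2 powr (l * d)) * G_square l f' x) (1/2) = ennreal (2 powr (l * d / 2)) * G_star \<alpha> dens l f x"
    using G_star_eq[OF Q, of l x] by (subst ennpowr_mult) (auto simp: powr_powr)
  finally show ?thesis by (simp add: d_def)
qed

text \<open>Tonelli moves h onto K_t, which is dominated by the even kernel at time t, so h turns
  into Q_t h. The factor t and the t^(-2) from the bound on Gamma leave dt/t, and t = 2 s is the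
  weighted variance integral. The bound is a sum of a p-th and a q-th power and not a product of
  norms; \<open>nn_integral_powr_le_of_dual_bound\<close> makes up for that.\<close>

lemma G_square_dual_bound:
  assumes p: "2 < p"
  shows "\<exists>C>0. \<forall>f h. admissible f \<longrightarrow> admissible h \<longrightarrow> (\<forall>x. 0 \<le> h x) \<longrightarrow>
    (\<integral>\<^sup>+x. ennreal (h x) * G_square ((2 * real DIM('a) + \<alpha>) / (2 * real DIM('a))) f x \<partial>lborel)
    \<le> ennreal C * ((\<integral>\<^sup>+x. ennreal (\<bar>f x\<bar> powr p) \<partial>lborel) + (\<integral>\<^sup>+x. ennreal (h x powr (p / (p - 2))) \<partial>lborel))"
proof -
  define l where "l = (2 * real DIM('a) + \<alpha>) / (2 * real DIM('a))"
  obtain B c0 C0 where B: "bellman_fun p B c0 C0" using bellman_fun_exists[OF p] by blast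
  have c0: "0 < c0" "0 < C0" using B by (auto simp: bellman_fun_def)
  obtain CK where CK: "0 < CK" "\<And>t x. 0 < t \<Longrightarrow> K_kernel \<alpha> l t x \<le> CK * kernel t x"
    using K_kernel_le unfolding l_def by blast
  obtain CG where CG: "0 < CG" "\<And>f t x. admissible f \<Longrightarrow> 0 < t \<Longrightarrow>
    Gamma_form \<alpha> t (conv t f) x \<le> ennreal (CG * t powr (- 2)) * variation (t / 2) f x"
    using Gamma_form_le_variation by blast
  have "(\<integral>\<^sup>+x. ennreal (h x) * G_square l f x \<partial>lborel)
    \<le> ennreal (CK * CG * (C0 / c0)) * ((\<integral>\<^sup>+x. ennreal (\<bar>f x\<bar> powr p) \<partial>lborel) + (\<integral>\<^sup>+x. ennreal (h x powr (p / (p - 2))) \<partial>lborel))"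
    (is "_ \<le> _ * ?N")
    if f: "admissible f" and h: "admissible h" "\<And>x. 0 \<le> h x" for f h
  proof -
    have fm [measurable]: "f \<in> borel_measurable borel" and hm [measurable]: "h \<in> borel_measurable borel"
      using f h by (auto simp: admissible_def)
    define \<Gamma> where "\<Gamma> t y = Gamma_form \<alpha> t (conv t f) y" for t y
    define I where "I x t = (\<integral>\<^sup>+y. ennreal (K_kernel \<alpha> l t (x - y)) * \<Gamma> t y \<partial>lborel)" for x t
    have Im: "(\<lambda>(x, t). I x t) \<in> borel_measurable (lborel \<Otimes>\<^sub>M lborel)"
      unfolding I_def \<Gamma>_def by (rule measurable_G_integrand) measurable
    have Im2: "(\<lambda>t. I x t) \<in> borel_measurable lborel" for x
      using measurable_compose[OF measurable_Pair1'[of x lborel lborel] Im] by simp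
    have Im1: "(\<lambda>x. I x t) \<in> borel_measurable lborel" for t
      using measurable_compose[OF measurable_Pair2'[of t lborel lborel] Im] by simp
    have \<Gamma>m: "(\<lambda>y. \<Gamma> t y) \<in> borel_measurable lborel" for t
      unfolding \<Gamma>_def by measurable
    have inner: "(\<integral>\<^sup>+x. ennreal (h x) * I x t \<partial>lborel) \<le> ennreal (CK * CG * t powr (- 2)) * (\<integral>\<^sup>+y. ennreal (conv t h y) * variation (t / 2) f y \<partial>lborel)"
      if t: "0 < t" for t
    proof -
      have "(\<integral>\<^sup>+x. ennreal (h x) * I x t \<partial>lborel)
        = (\<integral>\<^sup>+x. (\<integral>\<^sup>+y. ennreal (h x) * (ennreal (K_kernel \<alpha> l t (x - y)) * \<Gamma> t y) \<partial>lborel) \<partial>lborel)"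
        unfolding I_def using \<Gamma>m[of t]
        by (intro nn_integral_cong nn_integral_cmult[symmetric] borel_measurable_times_ennreal measurable_compose[OF measurable_K_kernel measurable_ennreal]) auto
      also have "\<dots> = (\<integral>\<^sup>+y. (\<integral>\<^sup>+x. ennreal (h x) * (ennreal (K_kernel \<alpha> l t (x - y)) * \<Gamma> t y) \<partial>lborel) \<partial>lborel)"
      proof (rule lborel_pair.Fubini'[symmetric])
        have 1: "(\<lambda>z. \<Gamma> t (snd z)) \<in> borel_measurable (lborel \<Otimes>\<^sub>M lborel)"
          by (rule measurable_compose[OF measurable_snd \<Gamma>m])
        have 2: "(\<lambda>z :: 'a \<times> 'a. ennreal (h (fst z))) \<in> borel_measurable (lborel \<Otimes>\<^sub>M lborel)"
          by measurable
        have 3: "(\<lambda>z :: 'a \<times> 'a. ennreal (K_kernel \<alpha> l t (fst z - snd z))) \<in> borel_measurable (lborel \<Otimes>\<^sub>M lborel)"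
          by measurable
        show "(\<lambda>(x, y). ennreal (h x) * (ennreal (K_kernel \<alpha> l t (x - y)) * \<Gamma> t y)) \<in> borel_measurable (lborel \<Otimes>\<^sub>M lborel)"
          unfolding case_prod_beta' by (intro borel_measurable_times_ennreal 1 2 3)
      qed
      also have "\<dots> \<le> (\<integral>\<^sup>+y. ennreal (CK * CG * t powr (- 2)) * (ennreal (conv t h y) * variation (t / 2) f y) \<partial>lborel)"
      proof (rule nn_integral_mono)
        fix y :: 'a
        have "(\<integral>\<^sup>+x. ennreal (h x) * (ennreal (K_kernel \<alpha> l t (x - y)) * \<Gamma> t y) \<partial>lborel)
          \<le> (\<integral>\<^sup>+x. (ennreal CK * \<Gamma> t y) * (ennreal (h x) * ennreal (kernel t (y - x))) \<partial>lborel)"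
        proof (rule nn_integral_mono)
          fix x
          have "kernel t (x - y) = kernel t (y - x)" using sym[OF t, of "y - x"] by simp
          then have "ennreal (K_kernel \<alpha> l t (x - y)) \<le> ennreal CK * ennreal (kernel t (y - x))"
            using CK(2)[OF t, of "x - y"] CK(1) by (simp add: ennreal_leI flip: ennreal_mult')
          then have "ennreal (h x) * (ennreal (K_kernel \<alpha> l t (x - y)) * \<Gamma> t y) \<le> ennreal (h x) * ((ennreal CK * ennreal (kernel t (y - x))) * \<Gamma> t y)"
            by (intro mult_left_mono mult_right_mono) auto
          also have "\<dots> = (ennreal CK * \<Gamma> t y) * (ennreal (h x) * ennreal (kernel t (y - x)))" by (simp only: mult_ac)
          finally show "ennreal (h x) * (ennreal (K_kernel \<alpha> l t (x - y)) * \<Gamma> t y) \<le> (ennreal CK * \<Gamma> t y) * (ennreal (h x) * ennreal (kernel t (y - x)))" .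
        qed
        also have "\<dots> = (ennreal CK * \<Gamma> t y) * ennreal (conv t h y)"
          unfolding ennreal_conv[OF h t] by (rule nn_integral_cmult) measurable
        also have "\<dots> \<le> (ennreal CK * (ennreal (CG * t powr (- 2)) * variation (t / 2) f y)) * ennreal (conv t h y)"
          unfolding \<Gamma>_def by (intro mult_right_mono mult_left_mono CG(2) f t) auto
        also have "\<dots> = (ennreal CK * ennreal (CG * t powr (- 2))) * (ennreal (conv t h y) * variation (t / 2) f y)"
          by (simp only: mult_ac)
        also have "ennreal CK * ennreal (CG * t powr (- 2)) = ennreal (CK * CG * t powr (- 2))"
          using CK(1) by (simp add: mult.assoc flip: ennreal_mult')
        finally show "(\<integral>\<^sup>+x. ennreal (h x) * (ennreal (K_kernel \<alpha> l t (x - y)) * \<Gamma> t y) \<partial>lborel)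
          \<le> ennreal (CK * CG * t powr (- 2)) * (ennreal (conv t h y) * variation (t / 2) f y)" .
      qed
      also have "\<dots> = ennreal (CK * CG * t powr (- 2)) * (\<integral>\<^sup>+y. ennreal (conv t h y) * variation (t / 2) f y \<partial>lborel)"
        by (rule nn_integral_cmult) measurable
      finally show ?thesis .
    qed
    define V where "V s = (\<integral>\<^sup>+x. ennreal (conv (2 * s) h x) * variation s f x \<partial>lborel)" for s
    have Vm [measurable]: "V \<in> borel_measurable borel"
    proof -
      have "(\<lambda>z. ennreal (conv (2 * fst z) h (snd z)) * variation (fst z) f (snd z)) \<in> borel_measurable (borel \<Otimes>\<^sub>M lborel)"
        by (intro borel_measurable_times_ennreal measurable_variation measurable_compose[OF measurable_conv measurable_ennreal]) measurable
      then show ?thesis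
        unfolding V_def by (intro lborel.borel_measurable_nn_integral) (simp add: case_prod_beta')
    qed
    have "(\<integral>\<^sup>+x. ennreal (h x) * G_square l f x \<partial>lborel)
      = (\<integral>\<^sup>+x. (\<integral>\<^sup>+t. ennreal (h x) * (ennreal t * I x t * indicator {0<..} t) \<partial>lborel) \<partial>lborel)"
      unfolding G_square_def I_def[symmetric] \<Gamma>_def[symmetric] using Im2
      by (intro nn_integral_cong nn_integral_cmult[symmetric] borel_measurable_times_ennreal) auto
    also have "\<dots> = (\<integral>\<^sup>+t. (\<integral>\<^sup>+x. ennreal (h x) * (ennreal t * I x t * indicator {0<..} t) \<partial>lborel) \<partial>lborel)"
    proof (rule lborel_pair.Fubini'[symmetric])
      have "(\<lambda>z. I (fst z) (snd z)) \<in> borel_measurable (lborel \<Otimes>\<^sub>M lborel)" using Im by (simp add: case_prod_beta')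
      then show "(\<lambda>(x, t). ennreal (h x) * (ennreal t * I x t * indicator {0<..} t)) \<in> borel_measurable (lborel \<Otimes>\<^sub>M lborel)"
        unfolding case_prod_beta' by (intro borel_measurable_times_ennreal) auto
    qed
    also have "\<dots> \<le> (\<integral>\<^sup>+t. ennreal (CK * CG) * (ennreal (1 / t) * V (t / 2) * indicator {0<..} t) \<partial>lborel)"
    proof (rule nn_integral_mono)
      fix t :: real
      show "(\<integral>\<^sup>+x. ennreal (h x) * (ennreal t * I x t * indicator {0<..} t) \<partial>lborel) \<le> ennreal (CK * CG) * (ennreal (1 / t) * V (t / 2) * indicator {0<..} t)"
      proof (cases "0 < t")
        case True
        have "(\<integral>\<^sup>+x. ennreal (h x) * (ennreal t * I x t * indicator {0<..} t) \<partial>lborel) = (\<integral>\<^sup>+x. ennreal t * (ennreal (h x) * I x t) \<partial>lborel)"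
          using True by (intro nn_integral_cong) (simp add: mult_ac)
        also have "\<dots> = ennreal t * (\<integral>\<^sup>+x. ennreal (h x) * I x t \<partial>lborel)"
          using Im1[of t] by (intro nn_integral_cmult borel_measurable_times_ennreal) auto
        also have "\<dots> \<le> ennreal t * (ennreal (CK * CG * t powr (- 2)) * V (t / 2))"
          using inner[OF True] by (intro mult_left_mono) (auto simp: V_def)
        also have "\<dots> = (ennreal t * ennreal (CK * CG * t powr (- 2))) * V (t / 2)" by (simp only: mult.assoc)
        also have "ennreal t * ennreal (CK * CG * t powr (- 2)) = ennreal (CK * CG) * ennreal (1 / t)"
        proof -
          have "t * (CK * CG * t powr (- 2)) = (CK * CG) * (1 / t)"
            using True by (simp add: powr_minus field_simps power2_eq_square)
          moreover have "0 \<le> CK * CG" "0 \<le> t" using CK CG True by auto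
          ultimately show ?thesis by (simp only: ennreal_mult'[symmetric])
        qed
        finally show ?thesis using True by (simp add: mult.assoc)
      qed simp
    qed
    also have "\<dots> = ennreal (CK * CG) * (\<integral>\<^sup>+t. ennreal (1 / t) * V (t / 2) * indicator {0<..} t \<partial>lborel)"
      by (rule nn_integral_cmult) measurable
    also have "(\<integral>\<^sup>+t. ennreal (1 / t) * V (t / 2) * indicator {0<..} t \<partial>lborel) = (\<integral>\<^sup>+s\<in>{0<..}. V s * ennreal (1 / s) \<partial>lborel)"
    proof -
      have "(\<integral>\<^sup>+t. ennreal (1 / t) * V (t / 2) * indicator {0<..} t \<partial>lborel)
        = ennreal \<bar>2\<bar> * (\<integral>\<^sup>+s. ennreal (1 / (0 + 2 * s)) * V ((0 + 2 * s) / 2) * indicator {0<..} (0 + 2 * s) \<partial>lborel)"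
        by (rule nn_integral_real_affine) auto
      also have "\<dots> = (\<integral>\<^sup>+s. 2 * (ennreal (1 / (2 * s)) * V s * indicator {0<..} (2 * s)) \<partial>lborel)"
        by (simp add: nn_integral_cmult)
      also have "\<dots> = (\<integral>\<^sup>+s\<in>{0<..}. V s * ennreal (1 / s) \<partial>lborel)"
      proof (rule nn_integral_cong)
        fix s :: real
        show "2 * (ennreal (1 / (2 * s)) * V s * indicator {0<..} (2 * s)) = V s * ennreal (1 / s) * indicator {0<..} s"
        proof (cases "0 < s")
          case True
          have "2 * (ennreal (1 / (2 * s)) * V s) = V s * (2 * ennreal (1 / (2 * s)))" by (simp only: mult_ac)
          also have "2 * ennreal (1 / (2 * s)) = ennreal (1 / s)"
            using True by (simp flip: ennreal_numeral ennreal_mult)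
          finally show ?thesis using True by simp
        qed simp
      qed
      finally show ?thesis .
    qed
    also have "\<dots> \<le> ennreal (C0 / c0) * ?N"
      unfolding V_def by (rule variation_weighted_integral_le[OF B f h])
    also have "ennreal (CK * CG) * (ennreal (C0 / c0) * ?N) = ennreal (CK * CG * (C0 / c0)) * ?N"
    proof -
      have "0 \<le> CK * CG" "0 \<le> C0 / c0" using CK CG c0 by auto
      then show ?thesis by (simp only: ennreal_mult mult.assoc[symmetric, of "ennreal (CK * CG)"])
    qed
    finally show ?thesis by (simp add: mult_left_mono)
  qed
  moreover have "0 < CK * CG * (C0 / c0)" using CK CG c0 by simp
  ultimately show ?thesis unfolding l_def by blast
qed

end

text \<open>The hypothesis is tested with \<open>h = \<mu> (min G N)\<^sup>p\<^sup>/\<^sup>2\<^sup>-\<^sup>1\<close>, cut off outside a ball; \<open>\<mu>\<close> is so small that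
  the second term of the bound is half of the left-hand side, and can be absorbed.\<close>

lemma nn_integral_powr_le_of_dual_bound:
  fixes G :: "'a::euclidean_space \<Rightarrow> ennreal"
  assumes p: "2 < p" and C: "0 < C" and [measurable]: "G \<in> borel_measurable borel"
    and bound: "\<And>h. h \<in> borel_measurable borel \<Longrightarrow> (\<And>x. 0 \<le> h x) \<Longrightarrow>
      (\<integral>\<^sup>+x. ennreal (h x powr (p / (p - 2))) \<partial>lborel) < \<infinity> \<Longrightarrow>
      (\<integral>\<^sup>+x. ennreal (h x) * G x \<partial>lborel) \<le> ennreal C * (F + (\<integral>\<^sup>+x. ennreal (h x powr (p / (p - 2))) \<partial>lborel))"
  shows "(\<integral>\<^sup>+x. ennpowr (G x) (p / 2) \<partial>lborel) \<le> ennreal ((2 * C) powr (p / 2)) * F"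
proof -
  \<comment> \<open>The positive solution of C \<mu>^q = \<mu> / 2, where q - 1 = 2 / (p -
    2).\<close>
  define \<mu> where "\<mu> = (2 * C) powr (- ((p - 2) / 2))"
  \<comment> \<open>Truncation in height and in space makes Z N finite, as the absorption requires a
    term that can be subtracted.\<close>
  define h0 where "h0 N x = enn2real (min (G x) (ennreal (real N))) * indicator (cball 0 (real N)) x" for N x
  define Z where "Z N = (\<integral>\<^sup>+x. ennreal (h0 N x powr (p / 2)) \<partial>lborel)" for N
  have \<mu>: "0 < \<mu>" using C by (simp add: \<mu>_def)
  have \<mu>q: "C * \<mu> powr (p / (p - 2)) = \<mu> / 2"
  proof -
    have "(p - 2) / 2 * (p / (p - 2)) = p / 2" using p by (simp add: field_simps)
    then have "\<mu> powr (p / (p - 2)) = (2 * C) powr (- (p / 2))"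
      by (simp only: \<mu>_def powr_powr mult_minus_left)
    also have "- (p / 2) = - ((p - 2) / 2) - 1" by (simp add: field_simps)
    finally have "\<mu> powr (p / (p - 2)) = \<mu> / (2 * C)" using C by (simp add: powr_diff \<mu>_def)
    then show ?thesis using C by simp
  qed
  have \<mu>C: "2 * C / \<mu> = (2 * C) powr (p / 2)"
  proof -
    have "p / 2 = 1 + (p - 2) / 2" by (simp add: field_simps)
    then have "(2 * C) powr (p / 2) = 2 * C * (2 * C) powr ((p - 2) / 2)"
      using C by (simp only: powr_add) simp
    moreover have "2 * C / \<mu> = 2 * C * (2 * C) powr ((p - 2) / 2)"
      unfolding \<mu>_def powr_minus divide_inverse[of "2 * C"] inverse_inverse_eq ..
    ultimately show ?thesis by (rule trans[OF _ sym, rotated])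
  qed
  have [measurable]: "cball (0 :: 'a) r \<in> sets borel" for r by simp
  have h0m [measurable]: "h0 N \<in> borel_measurable borel" for N unfolding h0_def by measurable
  have h00: "0 \<le> h0 N x" for N x by (simp add: h0_def)
  have min_fin: "min (G x) (ennreal (real N)) < top" for x N
    by (simp add: min_less_iff_disj)
  have h0N: "h0 N x \<le> real N" for N x
    using enn2real_mono[of "min (G x) (ennreal (real N))" "ennreal (real N)"] by (auto simp: h0_def split: split_indicator)
  have h0G: "ennreal (h0 N x) \<le> G x" for N x
    using min_fin[of x N] by (auto simp: h0_def split: split_indicator)
  have Z_fin: "Z N < \<infinity>" for N
  proof -
    have "Z N \<le> (\<integral>\<^sup>+x. ennreal (real N powr (p / 2)) * indicator (cball (0 :: 'a) (real N)) x \<partial>lborel)"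
      unfolding Z_def
    proof (rule nn_integral_mono)
      fix x
      show "ennreal (h0 N x powr (p / 2)) \<le> ennreal (real N powr (p / 2)) * indicator (cball 0 (real N)) x"
      proof (cases "x \<in> cball 0 (real N)")
        case True
        have "h0 N x powr (p / 2) \<le> real N powr (p / 2)"
          by (rule powr_mono2[OF _ h00 h0N]) (use p in simp)
        then show ?thesis using True by (simp add: ennreal_leI)
      next
        case False
        then have "h0 N x = 0" by (simp add: h0_def)
        then show ?thesis by simp
      qed
    qed
    also have "\<dots> < \<infinity>"
      using emeasure_bounded_finite[of "cball 0 (real N) :: 'a set"]
      by (simp add: nn_integral_cmult ennreal_mult_less_top less_top)
    finally show ?thesis .
  qed
  have Z_le: "Z N \<le> ennreal ((2 * C) powr (p / 2)) * F" for N
  proof (cases "F = top")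
    case True
    then show ?thesis using C by (simp add: ennreal_mult_top)
  next
    case False
    then obtain F' where F': "F = ennreal F'" "0 \<le> F'" by (cases F) auto
    obtain z where z: "Z N = ennreal z" "0 \<le> z" using Z_fin[of N] by (cases "Z N") auto
    \<comment> \<open>Since (p/2 - 1) q = p/2, the q-th power of h and the product of h with
      \<open>h0 N\<close> are both multiples of (h0 N)^(p/2), so both sides of the tested inequality
      involve the same integral.\<close>
    define h where "h x = \<mu> * h0 N x powr (p / 2 - 1)" for x
    have hq: "h x powr (p / (p - 2)) = \<mu> powr (p / (p - 2)) * h0 N x powr (p / 2)" for x
    proof -
      have "(p / 2 - 1) * (p / (p - 2)) = p / 2" using p by (simp add: field_simps)
      then have "(h0 N x powr (p / 2 - 1)) powr (p / (p - 2)) = h0 N x powr (p / 2)" by (simp only: powr_powr)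
      then show ?thesis using \<mu> by (simp add: h_def powr_mult del: powr_powr)
    qed
    have hqI: "(\<integral>\<^sup>+x. ennreal (h x powr (p / (p - 2))) \<partial>lborel) = ennreal (\<mu> powr (p / (p - 2)) * z)"
      unfolding hq using z by (simp add: ennreal_mult' nn_integral_cmult Z_def)
    have "ennreal (\<mu> * z) = (\<integral>\<^sup>+x. ennreal \<mu> * ennreal (h0 N x powr (p / 2)) \<partial>lborel)"
      using z \<mu> by (simp add: ennreal_mult' nn_integral_cmult Z_def)
    also have "\<dots> \<le> (\<integral>\<^sup>+x. ennreal (h x) * G x \<partial>lborel)"
    proof (rule nn_integral_mono)
      fix x
      have "h0 N x powr (p / 2) = h0 N x powr (p / 2 - 1) * h0 N x"
        using h00[of N x] p by (cases "h0 N x = 0") (auto simp: powr_diff)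
      then have "ennreal \<mu> * ennreal (h0 N x powr (p / 2)) = ennreal (h x) * ennreal (h0 N x)"
        using \<mu> h00[of N x] by (simp add: h_def mult.assoc flip: ennreal_mult')
      also have "\<dots> \<le> ennreal (h x) * G x" by (intro mult_left_mono h0G) simp
      finally show "ennreal \<mu> * ennreal (h0 N x powr (p / 2)) \<le> ennreal (h x) * G x" .
    qed
    also have "\<dots> \<le> ennreal C * (F + (\<integral>\<^sup>+x. ennreal (h x powr (p / (p - 2))) \<partial>lborel))"
    proof (rule bound)
      show "h \<in> borel_measurable borel" unfolding h_def by measurable
    qed (use \<mu> hqI in \<open>auto simp: h_def\<close>)
    also have "\<dots> = ennreal (C * (F' + \<mu> powr (p / (p - 2)) * z))"
      using F' z C unfolding hqI by (simp add: ennreal_mult' ennreal_plus)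
    finally have "\<mu> * z \<le> C * (F' + \<mu> powr (p / (p - 2)) * z)"
      using F' z C by (subst (asm) ennreal_le_iff) auto
    also have "\<dots> = C * F' + \<mu> / 2 * z" using \<mu>q by (simp add: algebra_simps)
    finally have "z \<le> 2 * C / \<mu> * F'" using \<mu> by (simp add: field_simps)
    then show ?thesis unfolding z \<mu>C F' by (simp add: ennreal_leI flip: ennreal_mult')
  qed
  have lim: "(\<lambda>N. ennreal (h0 N x powr (p / 2))) \<longlonglongrightarrow> ennpowr (G x) (p / 2)" for x
  proof -
    obtain k :: nat where k: "norm x \<le> real k" using real_arch_simple by blast
    show ?thesis
    proof (cases "G x")
      case (real g)
      obtain m :: nat where m: "g \<le> real m" using real_arch_simple by blast
      have "h0 N x = g" if "max k m \<le> N" for N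
      proof -
        have "G x \<le> ennreal (real N)" using real m that by simp
        then show ?thesis using real k that by (simp add: h0_def min_absorb1)
      qed
      then have "\<forall>\<^sub>F N in sequentially. ennreal (h0 N x powr (p / 2)) = ennpowr (G x) (p / 2)"
        using real by (intro eventually_sequentiallyI[of "max k m"]) (simp add: ennpowr_ennreal)
      then show ?thesis by (rule tendsto_eventually)
    next
      case top
      have "h0 N x = real N" if "k \<le> N" for N
        using top k that by (simp add: h0_def)
      then have ev: "\<forall>\<^sub>F N in sequentially. real N powr (p / 2) = h0 N x powr (p / 2)"
        by (intro eventually_sequentiallyI[of k]) simp
      have "filterlim (\<lambda>N. real N powr (p / 2)) at_top sequentially" using p by real_asymp
      then have "filterlim (\<lambda>N. h0 N x powr (p / 2)) at_top sequentially"
        using filterlim_cong[OF refl refl ev] by simp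
      then show ?thesis using top by (simp add: ennreal_tendsto_top_eq_at_top ennpowr_def)
    qed
  qed
  have "(\<integral>\<^sup>+x. ennpowr (G x) (p / 2) \<partial>lborel) = (\<integral>\<^sup>+x. liminf (\<lambda>N. ennreal (h0 N x powr (p / 2))) \<partial>lborel)"
    by (intro nn_integral_cong lim_imp_Liminf[symmetric] lim) simp
  \<comment> \<open>Fatou's lemma removes the truncation; the pointwise limit holds at infinite
    values of G as well.\<close>
  also have "\<dots> \<le> liminf Z"
    unfolding Z_def[abs_def] by (rule nn_integral_liminf) measurable
  also have "\<dots> \<le> ennreal ((2 * C) powr (p / 2)) * F"
    by (intro Liminf_le always_eventually allI Z_le) simp
  finally show ?thesis .
qed

lemma (in stable_process) measurable_G_star:
  assumes p: "1 \<le> p" and f: "in_Lp p f"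
  shows "G_star \<alpha> dens l f \<in> borel_measurable lebesgue"
proof -
  obtain f' where adm: "admissible f'" and Q: "\<And>t. 0 < t \<Longrightarrow> Q_ext dens t f = conv t f'"
    using Q_ext_eq_conv[OF p f] by blast
  have [measurable]: "f' \<in> borel_measurable borel" using adm by (simp add: admissible_def)
  have "G_star \<alpha> dens l f = (\<lambda>x. ennpowr (G_square l f' x) (1 / 2))"
    using G_star_eq[OF Q] by auto
  moreover have "(\<lambda>x. ennpowr (G_square l f' x) (1 / 2)) \<in> borel_measurable lborel" by measurable
  ultimately show ?thesis by (auto intro: measurable_completion)
qed

text \<open>The p-th power of the functional is the power p/2 of \<open>G_square\<close>, so test
  functions in the conjugate exponent p / (p - 2) apply. After absorption the p-th power integral of
  f enters linearly, and the p-th root gives a homogeneous estimate.\<close>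

lemma (in stable_process) Lp_norm_G_star_le:
  assumes p: "2 < p"
  shows "\<exists>c>0. \<forall>f. in_Lp p f \<longrightarrow>
    Lp_norm p (G_star \<alpha> dens ((2 * real DIM('a) + \<alpha>) / (2 * real DIM('a))) f)
      \<le> ennreal c * Lp_norm p (\<lambda>x. ennreal \<bar>f x\<bar>)"
proof -
  define l where "l = (2 * real DIM('a) + \<alpha>) / (2 * real DIM('a))"
  obtain C where C: "0 < C" and dual: "\<And>f h. admissible f \<Longrightarrow> admissible h \<Longrightarrow> (\<And>x. 0 \<le> h x) \<Longrightarrow>
    (\<integral>\<^sup>+x. ennreal (h x) * G_square l f x \<partial>lborel)
      \<le> ennreal C * ((\<integral>\<^sup>+x. ennreal (\<bar>f x\<bar> powr p) \<partial>lborel) + (\<integral>\<^sup>+x. ennreal (h x powr (p / (p - 2))) \<partial>lborel))"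
    using G_square_dual_bound[OF p] unfolding l_def by blast
  define C' where "C' = (2 * C) powr (p / 2)"
  have C': "0 < C'" using C by (simp add: C'_def)
  have "Lp_norm p (G_star \<alpha> dens l f) \<le> ennreal (C' powr (1 / p)) * Lp_norm p (\<lambda>x. ennreal \<bar>f x\<bar>)"
    if f: "in_Lp p f" for f
  proof -
    obtain f' where adm: "admissible f'" and Q: "\<And>t. 0 < t \<Longrightarrow> Q_ext dens t f = conv t f'"
      and F: "(\<integral>\<^sup>+x. ennreal (\<bar>f' x\<bar> powr p) \<partial>lborel) = (\<integral>\<^sup>+x. ennpowr (ennreal \<bar>f x\<bar>) p \<partial>lebesgue)"
      using Q_ext_eq_conv[of p f] p f by auto
    have [measurable]: "f' \<in> borel_measurable borel" using adm by (simp add: admissible_def)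
    have "(\<integral>\<^sup>+x. ennpowr (G_star \<alpha> dens l f x) p \<partial>lebesgue) = (\<integral>\<^sup>+x. ennpowr (G_square l f' x) (p / 2) \<partial>lebesgue)"
      using G_star_eq[OF Q, of l] by (simp add: ennpowr_ennpowr)
    also have "\<dots> = (\<integral>\<^sup>+x. ennpowr (G_square l f' x) (p / 2) \<partial>lborel)"
      by (rule nn_integral_completion) measurable
    also have "\<dots> \<le> ennreal C' * (\<integral>\<^sup>+x. ennreal (\<bar>f' x\<bar> powr p) \<partial>lborel)"
      unfolding C'_def
    proof (rule nn_integral_powr_le_of_dual_bound[OF p C])
      fix h :: "'a \<Rightarrow> real"
      assume h: "h \<in> borel_measurable borel" "\<And>x. 0 \<le> h x" "(\<integral>\<^sup>+x. ennreal (h x powr (p / (p - 2))) \<partial>lborel) < \<infinity>"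
      have "1 \<le> p / (p - 2)" using p by (simp add: field_simps)
      then have "admissible h" unfolding admissible_def using h by (auto intro!: exI[of _ "p / (p - 2)"])
      then show "(\<integral>\<^sup>+x. ennreal (h x) * G_square l f' x \<partial>lborel)
        \<le> ennreal C * ((\<integral>\<^sup>+x. ennreal (\<bar>f' x\<bar> powr p) \<partial>lborel) + (\<integral>\<^sup>+x. ennreal (h x powr (p / (p - 2))) \<partial>lborel))"
        using dual[OF adm] h(2) by blast
    qed measurable
    finally have "Lp_norm p (G_star \<alpha> dens l f) \<le> ennpowr (ennreal C' * (\<integral>\<^sup>+x. ennpowr (ennreal \<bar>f x\<bar>) p \<partial>lebesgue)) (1 / p)"
      unfolding Lp_norm_def F using p by (intro ennpowr_mono) auto
    then show ?thesis unfolding Lp_norm_def ennpowr_mult[OF C'] .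
  qed
  then show ?thesis
    using C' unfolding l_def[symmetric] by (intro exI[of _ "C' powr (1 / p)"]) auto
qed

theorem theorem2p3:
  fixes \<alpha> p :: real
    and dens :: "real \<Rightarrow> 'a::euclidean_space \<Rightarrow> 'a \<Rightarrow> real"
  assumes "0 < \<alpha>" "\<alpha> < 2" and "2 < p"
    and "stable_transition_density \<alpha> dens"
  shows "(\<forall>l>0. \<exists>c>0. \<forall>f :: 'a \<Rightarrow> real. in_Lp p f \<longrightarrow>
            (\<forall>x. area_functional \<alpha> dens f x \<le> ennreal c * G_star \<alpha> dens l f x)) \<and>
         (\<exists>c>0. \<forall>f :: 'a \<Rightarrow> real. in_Lp p f \<longrightarrow>
            Lp_norm p (G_star \<alpha> dens ((2 * real DIM('a) + \<alpha>) / (2 * real DIM('a))) f)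
              \<le> ennreal c * Lp_norm p (\<lambda>x. ennreal \<bar>f x\<bar>)) \<and>
         (\<exists>c>0. \<forall>f :: 'a \<Rightarrow> real. in_Lp p f \<longrightarrow>
            Lp_norm p (area_functional \<alpha> dens f)
              \<le> ennreal c * Lp_norm p (\<lambda>x. ennreal \<bar>f x\<bar>))"
proof -
  interpret stable_process \<alpha> dens by standard fact+
  define l where "l = (2 * real DIM('a) + \<alpha>) / (2 * real DIM('a))"
  define a where "a = 2 powr (l * real DIM('a) / 2)"
  have l: "0 < l" and a: "0 < a" using alpha by (auto simp: l_def a_def add_pos_pos)
  have p: "1 \<le> p" using assms by simp
  obtain c where c: "0 < c" and G: "\<And>f. in_Lp p f \<Longrightarrow>
      Lp_norm p (G_star \<alpha> dens l f) \<le> ennreal c * Lp_norm p (\<lambda>x. ennreal \<bar>f x\<bar>)"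
    using Lp_norm_G_star_le[OF assms(3)] unfolding l_def by blast
  \<comment> \<open>The pointwise comparison, used at \<lambda>0 itself, carries the norm bound over
    to the area functional.\<close>
  have A: "Lp_norm p (area_functional \<alpha> dens f) \<le> ennreal (a * c) * Lp_norm p (\<lambda>x. ennreal \<bar>f x\<bar>)"
    if f: "in_Lp p f" for f
  proof -
    have "Lp_norm p (area_functional \<alpha> dens f) \<le> ennreal a * Lp_norm p (G_star \<alpha> dens l f)"
      using area_le_G_star[OF l p f] measurable_G_star[OF p f] a p
      by (intro Lp_norm_le_mult) (auto simp: a_def)
    also have "\<dots> \<le> ennreal a * (ennreal c * Lp_norm p (\<lambda>x. ennreal \<bar>f x\<bar>))"
      by (intro mult_left_mono G f) simp
    finally show ?thesis using a by (simp add: ennreal_mult' mult.assoc)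
  qed
  have "\<exists>c>0. \<forall>f. in_Lp p f \<longrightarrow> (\<forall>x. area_functional \<alpha> dens f x \<le> ennreal c * G_star \<alpha> dens l f x)"
    if "0 < l" for l
    using area_le_G_star[OF that p] by (intro exI[of _ "2 powr (l * real DIM('a) / 2)"]) auto
  moreover have "0 < a * c" using a c by simp
  ultimately show ?thesis using c G A unfolding l_def by blast
qed

end
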